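(* Let $R$ be a Dedekind domain with field of fractions $K$, and let $\varphi : \mathbb{P}^1 \to \mathbb{P}^1$ be a post-critically finite (PCF) morphism defined over $K$. Then for every $\alpha \in \mathbb{P}^1(K)$, the set $S_{\infty}(\alpha)$ of primes of $K$ that ramify in $K_{\infty}(\alpha) = \bigcup_{n>0} K(\varphi^{-n}(\alpha))$ is finite.
   Context: Post-critically finite: Let $X$ be an irreducible, smooth variety and $\varphi : X \to X$ a finite morphism. We say that $\varphi$ is post-critically finite (PCF) if there is a non-empty Zariski-open $W \subseteq X$ such that $\varphi^{-1}(W) \subseteq W$ and such that $\varphi : W \to X$ (the restriction of $\varphi$ to $W$) is étale. Preimage fields: for $\varphi : X \to X$ defined over $K$, $\alpha \in X(K)$ and a positive integer $n$, $\varphi^n$ denotes the $n$-th iterate of $\varphi$, and $K_n(\alpha) = K(\varphi^{-n}(\alpha))$ is the extension of $K$ generated (inside a fixed algebraic closure $\overline{K}$) by the coordinates of all points of $X(\overline{K})$ mapped to $\alpha$ by $\varphi^n$. We put $K_\infty(\alpha) = \bigcup_{n>0} K_n(\alpha)$. Ramified primes: the primes of $K$ are the nonzero prime ideals of $R$. For $n \in \mathbb{N} \cup \{\infty\}$, $S_n(\alpha)$ is the set of primes of $K$ that ramify in $K_n(\alpha)$; a prime ramifies in an infinite algebraic extension of $K$ if it ramifies in some finite subextension.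
   Formalization: A prime counts as ramified in K_∞(α) only if it ramifies in some finite separable subextension; with inseparable ones the claim fails, e.g. R = F_p[t], φ(x) = x + 1/(x^p − t), α = ∞, where every prime ramifies in K(t^{1/p}). *)

theory Defs
  imports
    "HOL-Algebra.Algebraic_Closure_Type"
    "HOL-Algebra.Ring_Divisibility"
    "HOL-Algebra.Ideal_Product"
    "HOL-Algebra.Generated_Fields"
begin

section \<open>Subrings and subfields of a fixed algebraically closed field\<close>

text \<open>
  All rings and fields are subsets of one algebraically closed field, a type of class
  \<^class>\<open>alg_closed_field\<close> which plays the role of the fixed algebraic closure of \<open>K\<close>.
  \<open>subr S\<close> is the subset \<open>S\<close> with the inherited operations, as a record of HOL-Algebra.
\<close>

abbreviation ambient :: "'a::field ring" where
  "ambient \<equiv> ring_of_type_algebra"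

abbreviation subr :: "'a::field set \<Rightarrow> 'a ring" where
  "subr S \<equiv> ring_of_type_algebra\<lparr>carrier := S\<rparr>"

definition poly_over :: "'a::field set \<Rightarrow> 'a poly set" where
  "poly_over A = {f. \<forall>i. Polynomial.coeff f i \<in> A}"

definition fraction_field :: "'a::field set \<Rightarrow> 'a set" where
  "fraction_field R = {a / b |a b. a \<in> R \<and> b \<in> R \<and> b \<noteq> 0}"

definition algebraic_over :: "'a::field set \<Rightarrow> 'a \<Rightarrow> bool" where
  "algebraic_over K x \<longleftrightarrow> (\<exists>f\<in>poly_over K. f \<noteq> 0 \<and> poly f x = 0)"

definition integral_closure :: "'a::field set \<Rightarrow> 'a set \<Rightarrow> 'a set" where
  "integral_closure R L = {x \<in> L. \<exists>f\<in>poly_over R. lead_coeff f = 1 \<and> poly f x = 0}"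

text \<open>Fields are admitted as Dedekind domains; they have no nonzero prime ideals.\<close>

definition dedekind_domain :: "'a::field set \<Rightarrow> bool" where
  "dedekind_domain R \<longleftrightarrow>
     noetherian_domain (subr R) \<and>
     integral_closure R (fraction_field R) = R \<and>
     (\<forall>P. primeideal P (subr R) \<and> P \<noteq> {0} \<longrightarrow> maximalideal P (subr R))"

definition primes_of :: "'a::field set \<Rightarrow> 'a set set" where
  "primes_of R = {p. primeideal p (subr R) \<and> p \<noteq> {0}}"


section \<open>Ramification\<close>

text \<open>
  As the ambient field is algebraically closed, \<^const>\<open>rsquarefree\<close> says that the polynomial has no
  repeated root in an algebraic closure.
\<close>

definition separable_over :: "'a::field set \<Rightarrow> 'a set \<Rightarrow> bool" where
  "separable_over K L \<longleftrightarrow> (\<forall>x\<in>L. \<exists>f\<in>poly_over K. rsquarefree f \<and> poly f x = 0)"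

text \<open>
  The exponent of \<open>P\<close> in the factorization of the extended ideal \<open>pS\<close> in the Dedekind domain \<open>S\<close>.
\<close>

definition ramification_index :: "'a::field set \<Rightarrow> 'a set \<Rightarrow> 'a set \<Rightarrow> nat" where
  "ramification_index S P p =
     (GREATEST e. Idl\<^bsub>subr S\<^esub> p \<subseteq> P [^]\<^bsub>ideals_set (subr S)\<^esub> e)"

text \<open>
  Separability of the residue field extension of \<open>R/p\<close> by \<open>S/P\<close>, with polynomials over \<open>R/p\<close>
  represented by lifts to \<open>R\<close>: every residue class \<open>s + P\<close> is a root of some polynomial \<open>f\<close>
  over \<open>R/p\<close> which is coprime to its derivative.
\<close>

definition residue_separable :: "'a::field set \<Rightarrow> 'a set \<Rightarrow> 'a set \<Rightarrow> 'a set \<Rightarrow> bool" where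
  "residue_separable R p S P \<longleftrightarrow>
     (\<forall>s\<in>S. \<exists>f\<in>poly_over R.
        (\<exists>u\<in>poly_over R. \<exists>v\<in>poly_over R. u * f + v * pderiv f - 1 \<in> poly_over p) \<and>
        poly f s \<in> P)"

text \<open>For a finite separable extension \<open>L\<close> of the field of fractions of \<open>R\<close>:\<close>

definition ramified_in_finite :: "'a::field set \<Rightarrow> 'a set \<Rightarrow> 'a set \<Rightarrow> bool" where
  "ramified_in_finite R p L \<longleftrightarrow>
     (let S = integral_closure R L in
      \<exists>P. primeideal P (subr S) \<and> P \<inter> R = p \<and>
          (ramification_index S P p \<noteq> 1 \<or> \<not> residue_separable R p S P))"

text \<open>
  Ramification of a prime of a Dedekind domain is a notion for finite separable extensions of its
  field of fractions (all finite extensions, in characteristic 0).  A prime ramifies in an algebraic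
  extension \<open>E\<close> if it ramifies in some finite separable subextension.  Dropping separability here
  would make every prime \<open>(\<pi>)\<close> of \<open>\<bbbF>\<^sub>q[t]\<close> ramify in each purely inseparable extension
  such as \<open>\<bbbF>\<^sub>q(t\<^bsup>1/q\<^esup>)\<close>, which does occur inside preimage fields of PCF maps.
\<close>

definition ramifies_in :: "'a::field set \<Rightarrow> 'a set \<Rightarrow> 'a set \<Rightarrow> bool" where
  "ramifies_in R p E \<longleftrightarrow>
     (\<exists>L. subfield L ambient \<and> fraction_field R \<subseteq> L \<and> L \<subseteq> E \<and>
          ring.finite_dimension ambient (fraction_field R) L \<and>
          separable_over (fraction_field R) L \<and>
          ramified_in_finite R p L)"


section \<open>The projective line\<close>

definition proj_rel :: "'a::field \<times> 'a \<Rightarrow> 'a \<times> 'a \<Rightarrow> bool" where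
  "proj_rel u v \<longleftrightarrow> u \<noteq> (0, 0) \<and> v \<noteq> (0, 0) \<and>
     (\<exists>c. c \<noteq> 0 \<and> fst v = c * fst u \<and> snd v = c * snd u)"

quotient_type (overloaded) 'a proj1 = "'a::field \<times> 'a" / partial: proj_rel
proof (rule part_equivpI)
  show "\<exists>x :: 'a \<times> 'a. proj_rel x x"
    by (rule exI[of _ "(1, 0)"]) (auto simp: proj_rel_def)
  show "symp (proj_rel :: 'a \<times> 'a \<Rightarrow> _)"
  proof (rule sympI)
    fix u v :: "'a \<times> 'a"
    assume "proj_rel u v"
    then obtain c where "u \<noteq> (0, 0)" "v \<noteq> (0, 0)"
      and c: "c \<noteq> 0" "fst v = c * fst u" "snd v = c * snd u"
      by (auto simp: proj_rel_def)
    moreover from c have "inverse c \<noteq> 0" "fst u = inverse c * fst v" "snd u = inverse c * snd v"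
      by (auto simp: field_simps)
    ultimately show "proj_rel v u"
      unfolding proj_rel_def by blast
  qed
  show "transp (proj_rel :: 'a \<times> 'a \<Rightarrow> _)"
  proof (rule transpI)
    fix u v w :: "'a \<times> 'a"
    assume "proj_rel u v" "proj_rel v w"
    then obtain c d where "u \<noteq> (0, 0)" "w \<noteq> (0, 0)" "c \<noteq> 0" "d \<noteq> 0"
      and "fst v = c * fst u" "snd v = c * snd u" "fst w = d * fst v" "snd w = d * snd v"
      by (auto simp: proj_rel_def)
    then have "d * c \<noteq> 0" "fst w = (d * c) * fst u" "snd w = (d * c) * snd u"
      by auto
    with \<open>u \<noteq> (0, 0)\<close> \<open>w \<noteq> (0, 0)\<close> show "proj_rel u w"
      unfolding proj_rel_def by blast
  qed
qed

text \<open>The point \<open>[x : y]\<close>; only used for \<open>(x, y) \<noteq> (0, 0)\<close>.\<close>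

definition pt :: "'a::field \<Rightarrow> 'a \<Rightarrow> 'a proj1" where
  "pt x y = abs_proj1 (x, y)"

lemma pt_eq_iff:
  assumes "(x, y) \<noteq> (0, 0)" "(x', y') \<noteq> (0, 0)"
  shows "pt x y = pt x' y' \<longleftrightarrow> (\<exists>c. c \<noteq> 0 \<and> x' = c * x \<and> y' = c * y)"
proof -
  have refl: "proj_rel u u" if "u \<noteq> (0, 0)" for u :: "'a \<times> 'a"
    unfolding proj_rel_def using that by (intro conjI exI[of _ 1]) auto
  have "proj_rel (x, y) (x', y') \<longleftrightarrow> abs_proj1 (x, y) = abs_proj1 (x', y')"
    using Quotient_rel[OF Quotient_proj1] refl assms by blast
  then show ?thesis
    using assms by (auto simp: pt_def proj_rel_def)
qed

lemma pt_exhaust: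
  obtains x y where "(x, y) \<noteq> (0, 0)" "P = pt x y"
proof -
  obtain u where "proj_rel u u" "P = abs_proj1 u"
    using Quotient_abs_rep[OF Quotient_proj1] Quotient_rep_reflp[OF Quotient_proj1] by metis
  then show thesis
    using that[of "fst u" "snd u"] by (auto simp: pt_def proj_rel_def)
qed

definition rational_points :: "'a::field set \<Rightarrow> 'a proj1 set" where
  "rational_points K = {pt x y |x y. x \<in> K \<and> y \<in> K \<and> (x, y) \<noteq> (0, 0)}"

text \<open>
  A binary form of degree \<open>n\<close> is represented by its dehomogenization, a univariate polynomial \<open>f\<close>
  of degree at most \<open>n\<close>; its value at \<open>(x, y)\<close> is:
\<close>

definition form :: "nat \<Rightarrow> 'a::field poly \<Rightarrow> 'a \<Rightarrow> 'a \<Rightarrow> 'a" where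
  "form n f x y = (\<Sum>i\<le>n. Polynomial.coeff f i * x ^ i * y ^ (n - i))"

definition zariski_closed :: "'a::field proj1 set \<Rightarrow> bool" where
  "zariski_closed Z \<longleftrightarrow>
     (\<exists>T :: (nat \<times> 'a poly) set. (\<forall>(n, f)\<in>T. Polynomial.degree f \<le> n) \<and>
        Z = {pt x y |x y. (x, y) \<noteq> (0, 0) \<and> (\<forall>(n, f)\<in>T. form n f x y = 0)})"

definition zariski_open :: "'a::field proj1 set \<Rightarrow> bool" where
  "zariski_open U \<longleftrightarrow> zariski_closed (- U)"

definition P1_morphism :: "'a::field set \<Rightarrow> ('a proj1 \<Rightarrow> 'a proj1) \<Rightarrow> bool" where
  "P1_morphism K \<phi> \<longleftrightarrow>
     (\<exists>d. \<exists>F\<in>poly_over K. \<exists>G\<in>poly_over K.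
        Polynomial.degree F \<le> d \<and> Polynomial.degree G \<le> d \<and>
        (\<forall>x y. (x, y) \<noteq> (0, 0) \<longrightarrow>
           (form d F x y, form d G x y) \<noteq> (0, 0) \<and>
           \<phi> (pt x y) = pt (form d F x y) (form d G x y)))"


section \<open>Etale morphisms\<close>

text \<open>
  The local ring at \<open>P\<close> consists of germs of regular functions; a germ is represented by a total
  function on the projective line whose values outside some Zariski neighbourhood of \<open>P\<close>
  are irrelevant.
\<close>

definition near :: "'a::field proj1 \<Rightarrow> ('a proj1 \<Rightarrow> bool) \<Rightarrow> bool" where
  "near P A \<longleftrightarrow> (\<exists>U. zariski_open U \<and> P \<in> U \<and> (\<forall>Q\<in>U. A Q))"

definition regular_at :: "'a::field proj1 \<Rightarrow> ('a proj1 \<Rightarrow> 'a) \<Rightarrow> bool" where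
  "regular_at P f \<longleftrightarrow>
     (\<exists>n p q. Polynomial.degree p \<le> n \<and> Polynomial.degree q \<le> n \<and>
        near P (\<lambda>Q. \<forall>x y. (x, y) \<noteq> (0, 0) \<and> Q = pt x y \<longrightarrow>
           form n q x y \<noteq> 0 \<and> f Q = form n p x y / form n q x y))"

text \<open>
  The local ring at \<open>P\<close> is a module over the local ring at \<open>\<phi> P\<close> via \<open>f \<mapsto> f \<circ> \<phi>\<close>.
  Flatness is stated by the equational criterion: every linear relation
  \<open>\<Sum>\<^sub>i a\<^sub>i x\<^sub>i = 0\<close> is a consequence of relations among the \<open>a\<^sub>i\<close> in the base ring.
\<close>

definition flat_at :: "('a::field proj1 \<Rightarrow> 'a proj1) \<Rightarrow> 'a proj1 \<Rightarrow> bool" where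
  "flat_at \<phi> P \<longleftrightarrow>
     (\<forall>(n::nat) a x.
        (\<forall>i<n. regular_at (\<phi> P) (a i) \<and> regular_at P (x i)) \<and>
        near P (\<lambda>Q. (\<Sum>i<n. a i (\<phi> Q) * x i Q) = 0) \<longrightarrow>
        (\<exists>(m::nat) b y.
           (\<forall>j<m. regular_at P (y j) \<and> (\<forall>i<n. regular_at (\<phi> P) (b i j))) \<and>
           (\<forall>i<n. near P (\<lambda>Q. x i Q = (\<Sum>j<m. b i j (\<phi> Q) * y j Q))) \<and>
           (\<forall>j<m. near (\<phi> P) (\<lambda>Q. (\<Sum>i<n. a i Q * b i j Q) = 0))))"

text \<open>
  The maximal ideal at \<open>P\<close> is generated by the pullback of the maximal ideal at \<open>\<phi> P\<close>.
  Separability of residue fields is automatic at points over an algebraically closed field.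
\<close>

definition unramified_at :: "('a::field proj1 \<Rightarrow> 'a proj1) \<Rightarrow> 'a proj1 \<Rightarrow> bool" where
  "unramified_at \<phi> P \<longleftrightarrow>
     (\<forall>f. regular_at P f \<and> f P = 0 \<longrightarrow>
        (\<exists>(m::nat) g h.
           (\<forall>i<m. regular_at P (g i) \<and> regular_at (\<phi> P) (h i) \<and> h i (\<phi> P) = 0) \<and>
           near P (\<lambda>Q. f Q = (\<Sum>i<m. g i Q * h i (\<phi> Q)))))"

definition etale_at :: "('a::field proj1 \<Rightarrow> 'a proj1) \<Rightarrow> 'a proj1 \<Rightarrow> bool" where
  "etale_at \<phi> P \<longleftrightarrow> flat_at \<phi> P \<and> unramified_at \<phi> P"


section \<open>Post-critically finite morphisms and preimage fields\<close>

text \<open>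
  A morphism between projective varieties is finite if and only if it has finite fibres.
\<close>

definition finite_morphism :: "('a::field proj1 \<Rightarrow> 'a proj1) \<Rightarrow> bool" where
  "finite_morphism \<phi> \<longleftrightarrow> (\<forall>Q. finite (\<phi> -` {Q}))"

text \<open>
  The variety is identified with its points over the algebraically closed ground field, so \<open>W\<close> is
  a geometric open subset, not required to be defined over a smaller field, and the restriction
  of \<open>\<phi>\<close> to \<open>W\<close> is etale if it is etale at every point of \<open>W\<close>.
\<close>

definition PCF :: "('a::field proj1 \<Rightarrow> 'a proj1) \<Rightarrow> bool" where
  "PCF \<phi> \<longleftrightarrow> finite_morphism \<phi> \<and>
     (\<exists>W. zariski_open W \<and> W \<noteq> {} \<and> \<phi> -` W \<subseteq> W \<and> (\<forall>P\<in>W. etale_at \<phi> P))"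

definition coordinates :: "'a::field proj1 \<Rightarrow> 'a set" where
  "coordinates P =
     {x / y |x y. y \<noteq> 0 \<and> P = pt x y} \<union> {y / x |x y. x \<noteq> 0 \<and> P = pt x y}"

definition preimage_field ::
    "'a::field set \<Rightarrow> ('a proj1 \<Rightarrow> 'a proj1) \<Rightarrow> nat \<Rightarrow> 'a proj1 \<Rightarrow> 'a set" where
  "preimage_field K \<phi> n \<alpha> =
     generate_field ambient (K \<union> (\<Union>\<beta>\<in>(\<phi> ^^ n) -` {\<alpha>}. coordinates \<beta>))"

definition preimage_field_inf ::
    "'a::field set \<Rightarrow> ('a proj1 \<Rightarrow> 'a proj1) \<Rightarrow> 'a proj1 \<Rightarrow> 'a set" where
  "preimage_field_inf K \<phi> \<alpha> = (\<Union>n\<in>{0<..}. preimage_field K \<phi> n \<alpha>)"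

definition ramified_primes_inf ::
    "'a::field set \<Rightarrow> ('a proj1 \<Rightarrow> 'a proj1) \<Rightarrow> 'a proj1 \<Rightarrow> 'a set set" where
  "ramified_primes_inf R \<phi> \<alpha> =
     {p \<in> primes_of R. ramifies_in R p (preimage_field_inf (fraction_field R) \<phi> \<alpha>)}"

end

theory Submission
  imports Defs
begin

text \<open>
  Fix a finite separable \<open>L \<subseteq> K\<^sub>\<infinity>(\<alpha>)\<close> and a prime \<open>P\<close> of \<open>L\<close> over \<open>p\<close>, and choose a valuation ring \<open>V\<close> of
  the algebraic closure lying over \<open>P\<close>.  A uniformizer \<open>\<pi>\<close> of \<open>p\<close> stays a uniformizer in every subfield
  obtained from \<open>K\<close> by adjoining simple roots modulo the maximal ideal of \<open>V\<close>; by Zorn's lemma there is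
  a maximal such extension \<open>E\<close>, which is henselian, and \<open>P\<close> is unramified as soon as \<open>L \<subseteq> E\<close>.

  Let \<open>Z\<close> be the complement of the open set \<open>W\<close> in the definition of PCF: it is finite, mapped into
  itself, and contains all ramification points.  For all but finitely many \<open>p\<close> the map and the
  finitely many points of \<open>Z\<close>, \<open>\<phi>\<^sup>-\<^sup>1(Z)\<close> and \<open>\<alpha>\<close> have good reduction modulo \<open>V\<close>.  A
  preimage of \<open>\<beta>\<close> which is not congruent to a point of \<open>Z\<close> is then a simple root of the equation
  \<open>\<phi>(x) = \<beta>\<close> modulo \<open>V\<close>, and its own preimages are again not congruent to points of \<open>Z\<close>, so
  that by induction all iterated preimages lie in \<open>E\<close>, up to \<open>q\<close>-th roots which arise from
  the inseparability of points of \<open>Z\<close> and \<open>\<phi>\<^sup>-\<^sup>1(Z)\<close> and are harmless for separable \<open>L\<close>.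
\<close>

section \<open>Polynomials over subrings and local rings\<close>

text \<open>The excluded primes have to be chosen before \<open>n\<close>, \<open>L\<close> and
  \<open>E\<close>, although infinitely many preimages occur. Every condition on \<open>V\<close>
  therefore concerns finitely many fixed algebraic elements: coefficients of \<phi>, a Bezout
  relation, a Wronskian, coordinates of finitely many points. It asks that nonzero elements be units
  of \<open>V\<close>, which follows as soon as a suitable nonzero element of \<open>R\<close> is a
  unit, and that fails at only finitely many primes.

  The value group of \<open>V\<close> is divisible, so \<open>V\<close> itself has no uniformizer.
  Unramifiedness is tested element by element, by asking for values that are integral multiples of
  that of \<pi>. This controls ramification indices only; separability of residue fields, demanded
  as well, is extracted from the membership of \<open>L\<close> in every henselian unramified
  \<open>E\<close>, by comparison with an \<open>E\<close> built over an auxiliary root.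

  Points of \<open>Z\<close> and their preimages need not be simple roots modulo \<open>V\<close>;
  being finitely many and algebraic, they are put into the henselian field directly, up to
  \<open>q\<close>-th roots.\<close>

locale subdomain =
  fixes A :: "'a::field set"
  assumes one_mem: "1 \<in> A"
    and diff_mem: "x \<in> A \<Longrightarrow> y \<in> A \<Longrightarrow> x - y \<in> A"
    and mult_mem: "x \<in> A \<Longrightarrow> y \<in> A \<Longrightarrow> x * y \<in> A"
begin

lemma zero_mem: "0 \<in> A"
  using diff_mem[OF one_mem one_mem] by simp

lemma uminus_mem: "x \<in> A \<Longrightarrow> - x \<in> A"
  using diff_mem[OF zero_mem] by force

lemma add_mem: "x \<in> A \<Longrightarrow> y \<in> A \<Longrightarrow> x + y \<in> A"
  using diff_mem[OF _ uminus_mem] by force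

lemma power_mem: "x \<in> A \<Longrightarrow> x ^ n \<in> A"
  by (induction n) (auto intro: one_mem mult_mem)

lemma sum_mem: "(\<And>i. i \<in> I \<Longrightarrow> f i \<in> A) \<Longrightarrow> sum f I \<in> A"
  by (induction I rule: infinite_finite_induct) (auto intro: zero_mem add_mem)

lemma of_nat_mem: "of_nat n \<in> A"
  by (induction n) (auto intro: zero_mem add_mem one_mem)

lemmas ring_mem = one_mem diff_mem mult_mem zero_mem uminus_mem add_mem power_mem sum_mem of_nat_mem

lemma poly_mem: "f \<in> poly_over A \<Longrightarrow> x \<in> A \<Longrightarrow> poly f x \<in> A"
  unfolding poly_altdef by (intro sum_mem mult_mem power_mem) (auto simp: poly_over_def)

lemma poly_over_add: "f \<in> poly_over A \<Longrightarrow> g \<in> poly_over A \<Longrightarrow> f + g \<in> poly_over A"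
  by (auto simp: poly_over_def intro: ring_mem)

lemma poly_over_diff: "f \<in> poly_over A \<Longrightarrow> g \<in> poly_over A \<Longrightarrow> f - g \<in> poly_over A"
  by (auto simp: poly_over_def intro: ring_mem)

lemma poly_over_mult: "f \<in> poly_over A \<Longrightarrow> g \<in> poly_over A \<Longrightarrow> f * g \<in> poly_over A"
  by (auto simp: poly_over_def coeff_mult intro!: ring_mem)

lemma poly_over_smult: "c \<in> A \<Longrightarrow> f \<in> poly_over A \<Longrightarrow> smult c f \<in> poly_over A"
  by (auto simp: poly_over_def intro!: ring_mem)

lemma poly_over_monom: "c \<in> A \<Longrightarrow> monom c n \<in> poly_over A"
  by (auto simp: poly_over_def coeff_monom intro!: ring_mem)

lemma poly_over_0: "0 \<in> poly_over A"
  by (auto simp: poly_over_def intro!: ring_mem)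

lemma poly_over_1: "1 \<in> poly_over A"
  using poly_over_monom[OF one_mem, of 0] by (simp add: one_pCons monom_0)

lemma poly_over_pCons: "c \<in> A \<Longrightarrow> f \<in> poly_over A \<Longrightarrow> pCons c f \<in> poly_over A"
  by (auto simp: poly_over_def coeff_pCons intro!: ring_mem split: nat.splits)

lemma poly_over_pderiv: "f \<in> poly_over A \<Longrightarrow> pderiv f \<in> poly_over A"
  by (auto simp: poly_over_def coeff_pderiv simp del: of_nat_Suc intro!: mult_mem of_nat_mem)

lemma poly_over_sum: "(\<And>i. i \<in> I \<Longrightarrow> f i \<in> poly_over A) \<Longrightarrow> sum f I \<in> poly_over A"
  by (induction I rule: infinite_finite_induct) (auto intro: poly_over_0 poly_over_add)

lemmas poly_over_mem = poly_over_add poly_over_diff poly_over_mult poly_over_smult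
  poly_over_monom poly_over_0 poly_over_1 poly_over_pCons poly_over_pderiv poly_over_sum

lemma monic_division:
  assumes "m \<in> poly_over A" "lead_coeff m = 1" "f \<in> poly_over A"
  shows "\<exists>q\<in>poly_over A. \<exists>r\<in>poly_over A. f = m * q + r \<and> (r = 0 \<or> degree r < degree m)"
  using assms(3)
proof (induction "degree f" arbitrary: f rule: less_induct)
  case less
  show ?case
  proof (cases "f = 0 \<or> degree f < degree m")
    case True
    then show ?thesis
      using less.prems by (intro bexI[of _ 0] bexI[of _ f]) (auto intro: poly_over_mem)
  next
    case False
    define t where "t = monom (lead_coeff f) (degree f - degree m)"
    have t: "t \<in> poly_over A"
      using less.prems by (auto simp: t_def poly_over_def coeff_monom intro: zero_mem)
    have deg_t: "degree (m * t) = degree f"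
      using False assms(2) by (subst degree_mult_eq) (auto simp: t_def Polynomial.degree_monom_eq)
    have "lead_coeff (m * t) = lead_coeff f"
      unfolding lead_coeff_mult assms(2) using False by (simp add: t_def Polynomial.degree_monom_eq)
    with deg_t have "coeff (f - m * t) (degree f) = 0"
      by simp
    moreover have "degree (f - m * t) \<le> degree f"
      using deg_t by (intro degree_diff_le) auto
    ultimately have lt: "f - m * t = 0 \<or> degree (f - m * t) < degree f"
      by (metis le_neq_implies_less leading_coeff_0_iff)
    have mem: "f - m * t \<in> poly_over A"
      by (intro poly_over_mem less.prems assms t)
    show ?thesis
    proof (cases "f - m * t = 0")
      case True
      then show ?thesis
        by (intro bexI[of _ t] bexI[of _ 0] t poly_over_mem) auto
    next
      case False
      with lt less.hyps[OF _ mem] obtain q r where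
        *: "q \<in> poly_over A" "r \<in> poly_over A" "f - m * t = m * q + r"
          "r = 0 \<or> degree r < degree m"
        by blast
      have "f = m * (q + t) + r"
        using *(3) by (simp add: algebra_simps)
      with * t show ?thesis
        by (intro bexI[of _ "q + t"] bexI[of _ r]) (auto intro: poly_over_mem)
    qed
  qed
qed

text \<open>Horner's recursion keeps the second-order remainder \<open>c\<close> inside
  \<open>A\<close> without dividing by factorials, so the formula is available in every
  characteristic.\<close>

lemma taylor2:
  assumes "f \<in> poly_over A" "a \<in> A" "b \<in> A"
  shows "\<exists>c\<in>A. poly f a - poly f b = (a - b) * (poly (pderiv f) b + (a - b) * c)"
  using assms(1)
proof (induction f rule: pCons_induct)
  case 0
  then show ?case by (intro bexI[of _ 0]) (auto intro: ring_mem)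
next
  case (pCons e f)
  have f: "f \<in> poly_over A"
    using pCons.prems by (auto simp: poly_over_def coeff_pCons split: nat.splits)
  then obtain c where c: "c \<in> A" and eq: "poly f a - poly f b = (a - b) * (poly (pderiv f) b + (a - b) * c)"
    using pCons.IH by blast
  have "poly (pCons e f) a - poly (pCons e f) b = a * (poly f a - poly f b) + (a - b) * poly f b"
    by (simp add: algebra_simps)
  also have "\<dots> = (a - b) * (poly (pderiv (pCons e f)) b + (a - b) * (poly (pderiv f) b + a * c))"
    unfolding eq by (simp add: pderiv_pCons algebra_simps)
  finally show ?case
    using c f assms by (intro bexI[of _ "poly (pderiv f) b + a * c"]) (auto intro!: ring_mem poly_mem poly_over_mem)
qed

end

lemma poly_over_mono: "A \<subseteq> B \<Longrightarrow> f \<in> poly_over A \<Longrightarrow> f \<in> poly_over B"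
  by (auto simp: poly_over_def)

lemma poly_over_Int: "poly_over (A \<inter> B) = poly_over A \<inter> poly_over B"
  by (auto simp: poly_over_def)

text \<open>Elements outside \<open>\<nn>\<close> are invertible in \<open>A\<close>, so
  \<open>\<nn>\<close> is the maximal ideal of a local ring. Polynomials over the residue field are
  represented by lifts: a difference in \<open>poly_over \<nn>\<close> means equal
  reductions.\<close>

locale local_subdomain = subdomain A for A :: "'a::field set" +
  fixes \<nn> :: "'a set"
  assumes ideal_subset: "\<nn> \<subseteq> A"
    and ideal_zero: "0 \<in> \<nn>"
    and ideal_add: "x \<in> \<nn> \<Longrightarrow> y \<in> \<nn> \<Longrightarrow> x + y \<in> \<nn>"
    and ideal_mult: "a \<in> A \<Longrightarrow> x \<in> \<nn> \<Longrightarrow> a * x \<in> \<nn>"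
    and one_notin: "1 \<notin> \<nn>"
    and inverse_mem: "x \<in> A \<Longrightarrow> x \<notin> \<nn> \<Longrightarrow> inverse x \<in> A"
begin

lemma ideal_mult2: "x \<in> \<nn> \<Longrightarrow> a \<in> A \<Longrightarrow> x * a \<in> \<nn>"
  using ideal_mult by (simp add: mult.commute)

lemma ideal_uminus: "x \<in> \<nn> \<Longrightarrow> - x \<in> \<nn>"
  using ideal_mult[OF uminus_mem[OF one_mem]] by force

lemma ideal_diff: "x \<in> \<nn> \<Longrightarrow> y \<in> \<nn> \<Longrightarrow> x - y \<in> \<nn>"
  using ideal_add[OF _ ideal_uminus] by force

lemma ideal_sum: "(\<And>i. i \<in> I \<Longrightarrow> f i \<in> \<nn>) \<Longrightarrow> sum f I \<in> \<nn>"
  by (induction I rule: infinite_finite_induct) (auto intro: ideal_zero ideal_add)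

lemma ideal_prime: "x \<in> A \<Longrightarrow> y \<in> A \<Longrightarrow> x * y \<in> \<nn> \<Longrightarrow> x \<in> \<nn> \<or> y \<in> \<nn>"
proof (rule ccontr)
  assume *: "x \<in> A" "y \<in> A" "x * y \<in> \<nn>" "\<not> (x \<in> \<nn> \<or> y \<in> \<nn>)"
  then have "inverse x * (x * y) \<in> \<nn>"
    by (simp add: ideal_mult inverse_mem)
  moreover have "inverse x * (x * y) = y"
    using * ideal_zero by (metis left_inverse mult.assoc mult_1)
  ultimately show False using * by metis
qed

lemma ideal_power: "x \<in> A \<Longrightarrow> x ^ n \<in> \<nn> \<Longrightarrow> x \<in> \<nn>"
  by (induction n) (use one_notin ideal_prime power_mem in auto)

lemma notin_add: "x \<in> \<nn> \<Longrightarrow> y \<notin> \<nn> \<Longrightarrow> x + y \<notin> \<nn>"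
  using ideal_diff[of "x + y" x] by auto

lemma ideal_cong: "x - y \<in> \<nn> \<Longrightarrow> x \<in> \<nn> \<longleftrightarrow> y \<in> \<nn>"
  using ideal_diff[of x "x - y"] ideal_add[of "x - y" y] by auto

lemma poly_over_ideal_subset: "f \<in> poly_over \<nn> \<Longrightarrow> f \<in> poly_over A"
  using poly_over_mono ideal_subset by blast

lemma poly_over_ideal_diff: "f \<in> poly_over \<nn> \<Longrightarrow> g \<in> poly_over \<nn> \<Longrightarrow> f - g \<in> poly_over \<nn>"
  by (auto simp: poly_over_def intro: ideal_diff)

lemma poly_over_ideal_add: "f \<in> poly_over \<nn> \<Longrightarrow> g \<in> poly_over \<nn> \<Longrightarrow> f + g \<in> poly_over \<nn>"
  by (auto simp: poly_over_def intro: ideal_add)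

lemma poly_over_ideal_mult: "f \<in> poly_over A \<Longrightarrow> g \<in> poly_over \<nn> \<Longrightarrow> f * g \<in> poly_over \<nn>"
  by (auto simp: poly_over_def coeff_mult intro!: ideal_sum ideal_mult)

lemma poly_over_ideal_mult2: "g \<in> poly_over \<nn> \<Longrightarrow> f \<in> poly_over A \<Longrightarrow> g * f \<in> poly_over \<nn>"
  using poly_over_ideal_mult by (simp add: mult.commute)

lemma poly_over_ideal_pderiv: "f \<in> poly_over \<nn> \<Longrightarrow> pderiv f \<in> poly_over \<nn>"
  by (auto simp: poly_over_def coeff_pderiv simp del: of_nat_Suc intro!: ideal_mult of_nat_mem)

lemma poly_over_ideal_0: "0 \<in> poly_over \<nn>"
  by (auto simp: poly_over_def ideal_zero)

lemma poly_ideal: "f \<in> poly_over \<nn> \<Longrightarrow> x \<in> A \<Longrightarrow> poly f x \<in> \<nn>"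
  unfolding poly_altdef by (intro ideal_sum ideal_mult2 power_mem) (auto simp: poly_over_def)

lemma poly_cong_arg:
  assumes "f \<in> poly_over A" "x \<in> A" "y \<in> A" "x - y \<in> \<nn>"
  shows "poly f x - poly f y \<in> \<nn>"
proof -
  obtain c where "c \<in> A" "poly f x - poly f y = (x - y) * (poly (pderiv f) y + (x - y) * c)"
    using taylor2[OF assms(1-3)] by blast
  then show ?thesis
    using assms by (auto intro!: ideal_mult2 ring_mem poly_mem poly_over_mem)
qed

lemma monic_notin: "lead_coeff f = 1 \<Longrightarrow> f \<notin> poly_over \<nn>"
  using one_notin unfolding poly_over_def by (metis (mono_tags) mem_Collect_eq)

text \<open>Above the index \<open>k\<close> of the highest coefficient outside \<open>\<nn>\<close>
  all coefficients reduce to zero. Cutting them off leaves the reduction unchanged, and the new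
  leading coefficient is invertible, so it can be scaled to 1.\<close>

lemma monic_normalize:
  assumes "g \<in> poly_over A" "g \<notin> poly_over \<nn>"
  obtains u h where "u \<in> A" "h \<in> poly_over A" "lead_coeff h = 1" "degree h \<le> degree g"
    "h - smult u g \<in> poly_over \<nn>"
proof -
  define k where "k = (GREATEST i. coeff g i \<notin> \<nn>)"
  have ex: "\<exists>i. coeff g i \<notin> \<nn>"
    using assms(2) by (auto simp: poly_over_def)
  have bound: "coeff g i \<notin> \<nn> \<Longrightarrow> i \<le> degree g" for i
    using ideal_zero le_degree[of g i] by metis
  have k: "coeff g k \<notin> \<nn>"
    unfolding k_def using ex bound by (metis (mono_tags, lifting) GreatestI_nat)
  have above: "coeff g i \<in> \<nn>" if "i > k" for i
    using that bound Greatest_le_nat[of "\<lambda>i. coeff g i \<notin> \<nn>" i "degree g"] unfolding k_def by force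
  define u where "u = inverse (coeff g k)"
  have g: "coeff g i \<in> A" for i
    using assms(1) by (auto simp: poly_over_def)
  have u: "u \<in> A"
    unfolding u_def using k g by (intro inverse_mem)
  define h where "h = smult u (poly_cutoff (Suc k) g)"
  have c: "coeff h i = (if i \<le> k then u * coeff g i else 0)" for i
    by (simp add: h_def coeff_poly_cutoff)
  have "coeff h k = 1"
    using k ideal_zero by (metis c u_def left_inverse order_refl)
  moreover have "degree h \<le> k"
    by (rule degree_le) (simp add: c)
  ultimately have "degree h = k" "lead_coeff h = 1"
    by (metis le_antisym le_degree zero_neq_one)+
  show thesis
  proof (rule that)
    show "h \<in> poly_over A"
      using u g by (auto simp: poly_over_def c intro: ring_mem)
    show "degree h \<le> degree g"
      using \<open>degree h = k\<close> bound k by simp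
    show "h - smult u g \<in> poly_over \<nn>"
      using u above by (auto simp: poly_over_def c not_le intro: ideal_zero ideal_uminus ideal_mult)
  qed fact+
qed

text \<open>\<open>J\<close> is the full preimage of a nonzero ideal of the polynomial ring over the
  residue field, which is principal; a monic lift \<open>d\<close> of least degree generates it by
  division with remainder. With maximal ideal \<open>{0}\<close> this yields greatest common
  divisors over a field.\<close>

lemma poly_ideal_generator:
  assumes sub: "J \<subseteq> poly_over A"
    and diff: "\<And>f g. f \<in> J \<Longrightarrow> g \<in> J \<Longrightarrow> f - g \<in> J"
    and mult: "\<And>f g. f \<in> poly_over A \<Longrightarrow> g \<in> J \<Longrightarrow> f * g \<in> J"
    and ideal: "poly_over \<nn> \<subseteq> J"
    and ex: "g\<^sub>0 \<in> J" "g\<^sub>0 \<notin> poly_over \<nn>"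
  obtains d where "d \<in> J" "lead_coeff d = 1"
    "\<And>g. g \<in> J \<Longrightarrow> g \<notin> poly_over \<nn> \<Longrightarrow> degree d \<le> degree g"
    "\<And>g. g \<in> J \<Longrightarrow> \<exists>q\<in>poly_over A. g - d * q \<in> poly_over \<nn>"
proof -
  have add: "f + g \<in> J" if "f \<in> J" "g \<in> J" for f g
    using diff[OF that(1) diff[OF diff[OF that(2,2)] that(2)]] by simp
  have monic: "\<exists>h\<in>J. lead_coeff h = 1 \<and> degree h \<le> degree g" if g: "g \<in> J" "g \<notin> poly_over \<nn>" for g
  proof -
    obtain u h where h: "u \<in> A" "h \<in> poly_over A" "lead_coeff h = 1" "degree h \<le> degree g"
      "h - smult u g \<in> poly_over \<nn>"
      using monic_normalize g sub by blast
    have "[:u:] * g \<in> J"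
      using h g by (intro mult poly_over_mem)
    then have "(h - smult u g) + smult u g \<in> J"
      using h ideal by (intro add) auto
    with h show ?thesis by auto
  qed
  define P where "P h \<longleftrightarrow> h \<in> J \<and> lead_coeff h = 1" for h
  obtain d where d: "P d" "\<And>h. P h \<Longrightarrow> degree d \<le> degree h"
    using ex_has_least_nat[of P _ degree] monic[OF ex] unfolding P_def by blast
  have least: "degree d \<le> degree g" if "g \<in> J" "g \<notin> poly_over \<nn>" for g
    using monic[OF that] d(2) unfolding P_def by force
  show thesis
  proof (rule that[of d])
    show "d \<in> J" "lead_coeff d = 1"
      using d by (auto simp: P_def)
    fix g assume g: "g \<in> J"
    obtain q r where qr: "q \<in> poly_over A" "r \<in> poly_over A" "g = d * q + r"
      "r = 0 \<or> degree r < degree d"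
      using monic_division[of d g] \<open>d \<in> J\<close> \<open>lead_coeff d = 1\<close> g sub by blast
    have "r = g - q * d" using qr by simp
    also have "\<dots> \<in> J"
      using g \<open>d \<in> J\<close> qr by (intro diff mult)
    finally have "r \<in> poly_over \<nn>"
      using qr(4) least[of r] poly_over_ideal_0 by fastforce
    then show "\<exists>q\<in>poly_over A. g - d * q \<in> poly_over \<nn>"
      using qr by (intro bexI[of _ q]) auto
  qed (fact least)
qed

text \<open>\<open>d\<close> lifts the minimal polynomial of the residue class of \<open>x\<close>
  over the residue field of \<open>A\<close>; the given \<open>g\<close> witnesses that this class
  is algebraic.\<close>

lemma minimal_poly_mod:
  assumes V: "local_subdomain V \<mm>" "A \<subseteq> V" "\<nn> \<subseteq> \<mm>" "A \<inter> \<mm> \<subseteq> \<nn>" and x: "x \<in> V"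
    and g: "g \<in> poly_over A" "g \<notin> poly_over \<nn>" "poly g x \<in> \<mm>"
  obtains d where "d \<in> poly_over A" "lead_coeff d = 1" "poly d x \<in> \<mm>"
    "\<And>g. g \<in> poly_over A \<Longrightarrow> poly g x \<in> \<mm> \<Longrightarrow> g \<notin> poly_over \<nn> \<Longrightarrow> degree d \<le> degree g"
    "\<And>g. g \<in> poly_over A \<Longrightarrow> poly g x \<in> \<mm> \<Longrightarrow> \<exists>q\<in>poly_over A. g - d * q \<in> poly_over \<nn>"
proof -
  interpret V: local_subdomain V \<mm> by fact
  define J where "J = {g \<in> poly_over A. poly g x \<in> \<mm>}"
  show thesis
  proof (rule poly_ideal_generator[of J g])
    show "f * g \<in> J" if "f \<in> poly_over A" "g \<in> J" for f g
      using that assms by (auto simp: J_def intro!: poly_over_mem V.ideal_mult V.poly_mem dest: poly_over_mono)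
    show "poly_over \<nn> \<subseteq> J"
      using assms by (auto simp: J_def intro: poly_over_ideal_subset V.poly_ideal dest: poly_over_mono)
  qed (use g that in \<open>auto simp: J_def intro: poly_over_mem V.ideal_diff\<close>)
qed

end

section \<open>Valuation rings and unramified subfields\<close>

lemma poly_over_reflect: "0 \<in> A \<Longrightarrow> f \<in> poly_over A \<Longrightarrow> reflect_poly f \<in> poly_over A"
  by (auto simp: poly_over_def coeff_reflect_poly)

definition nonunits :: "'a::field set \<Rightarrow> 'a set" where
  "nonunits V = {x \<in> V. x = 0 \<or> inverse x \<notin> V}"

locale valuation_ring = subdomain V for V :: "'a::field set" +
  assumes total: "x \<in> V \<or> inverse x \<in> V"
begin

sublocale local_subdomain V "nonunits V"
proof unfold_locales
  show "nonunits V \<subseteq> V" "0 \<in> nonunits V" "1 \<notin> nonunits V"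
    by (auto simp: nonunits_def intro: ring_mem)
  show *: "a * x \<in> nonunits V" if "a \<in> V" "x \<in> nonunits V" for a x
  proof (rule ccontr)
    assume "a * x \<notin> nonunits V"
    with that have "a * x \<noteq> 0" "inverse (a * x) \<in> V"
      by (auto simp: nonunits_def intro: ring_mem)
    moreover have "a * inverse (a * x) = inverse x"
      using \<open>a * x \<noteq> 0\<close> by (simp add: field_simps)
    ultimately have "inverse x \<in> V"
      using that mult_mem[of a "inverse (a * x)"] by metis
    with that \<open>a * x \<noteq> 0\<close> show False
      by (auto simp: nonunits_def)
  qed
  \<comment> \<open>Factor out the summand of smaller value.\<close>
  have aux: "x + y \<in> nonunits V" if "y \<in> nonunits V" "y \<noteq> 0" "x / y \<in> V" for x y
  proof -
    have "x + y = (x / y + 1) * y"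
      using that by (simp add: field_simps)
    also have "\<dots> \<in> nonunits V"
      using that by (intro * add_mem one_mem)
    finally show ?thesis .
  qed
  show "x + y \<in> nonunits V" if "x \<in> nonunits V" "y \<in> nonunits V" for x y
  proof (cases "x = 0 \<or> y = 0")
    case False
    then show ?thesis
      using total[of "x / y"] aux[of y x] aux[of x y] that by (auto simp: add.commute)
  qed (use that in auto)
  show "inverse x \<in> V" if "x \<in> V" "x \<notin> nonunits V" for x
    using that by (auto simp: nonunits_def)
qed

abbreviation unit :: "'a \<Rightarrow> bool" where
  "unit x \<equiv> x \<in> V \<and> x \<notin> nonunits V"

lemma unit_nonzero: "unit x \<Longrightarrow> x \<noteq> 0"
  using ideal_zero by auto

lemma unit_mult: "unit x \<Longrightarrow> unit y \<Longrightarrow> unit (x * y)"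
  using ideal_prime mult_mem by blast

lemma unit_inverse: "unit x \<Longrightarrow> unit (inverse x)"
  by (simp add: nonunits_def)

lemma unit_divide: "unit x \<Longrightarrow> unit y \<Longrightarrow> unit (x / y)"
  unfolding divide_inverse by (intro unit_mult unit_inverse)

lemma unit_power: "unit x \<Longrightarrow> unit (x ^ n)"
  using ideal_power power_mem by blast

lemma divide_unit_mem: "x \<in> V \<Longrightarrow> unit y \<Longrightarrow> x / y \<in> V"
  unfolding divide_inverse by (intro mult_mem inverse_mem) auto

lemma inverse_nonunit: "x \<notin> V \<Longrightarrow> inverse x \<in> nonunits V"
  using total[of x] by (auto simp: nonunits_def)

text \<open>If \<open>x\<close> were outside \<open>V\<close>, then \<open>inverse x\<close> would
  be a nonunit root of the reversed polynomial, whose constant term, the leading coefficient of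
  \<open>f\<close>, would then be a nonunit too.\<close>

lemma integral_mem:
  assumes "f \<in> poly_over V" "lead_coeff f \<notin> nonunits V" "poly f x = 0"
  shows "x \<in> V"
proof (rule ccontr)
  assume "x \<notin> V"
  then have y: "inverse x \<in> nonunits V" "inverse x \<in> V" "x \<noteq> 0"
    using inverse_nonunit total zero_mem by auto
  have r: "reflect_poly f \<in> poly_over V"
    using assms by (intro poly_over_reflect ring_mem)
  have "poly (reflect_poly f) (inverse x) = 0"
    using assms y by (subst poly_reflect_poly_nz) auto
  then have "poly (reflect_poly f) 0 \<in> nonunits V"
    using poly_cong_arg[OF r y(2) zero_mem] y ideal_uminus[of "- lead_coeff f"]
    by (auto simp: poly_0_coeff_0)
  with assms show False
    by (simp add: poly_0_coeff_0)
qed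

end

section \<open>Subfields and simple extensions\<close>

locale subfield_set = subdomain E for E :: "'a::field set" +
  assumes inverse_mem: "x \<in> E \<Longrightarrow> inverse x \<in> E"
begin

lemma divide_mem: "x \<in> E \<Longrightarrow> y \<in> E \<Longrightarrow> x / y \<in> E"
  unfolding divide_inverse by (intro mult_mem inverse_mem)

end

text \<open>A vanishing denominator yields the quotient 0, which belongs to the generated field
  anyway, so none is excluded.\<close>

definition adjoin :: "'a::field set \<Rightarrow> 'a \<Rightarrow> 'a set" where
  "adjoin E \<theta> = {poly g \<theta> / poly h \<theta> |g h. g \<in> poly_over E \<and> h \<in> poly_over E}"

context subfield_set
begin

lemma adjoinE:
  assumes "x \<in> adjoin E \<theta>"
  obtains g h where "g \<in> poly_over E" "h \<in> poly_over E" "poly h \<theta> \<noteq> 0" "x = poly g \<theta> / poly h \<theta>"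
proof -
  obtain g h where *: "g \<in> poly_over E" "h \<in> poly_over E" "x = poly g \<theta> / poly h \<theta>"
    using assms by (auto simp: adjoin_def)
  show thesis
  proof (cases "poly h \<theta> = 0")
    case True
    with * show thesis
      by (intro that[of 0 1]) (auto intro: poly_over_mem)
  qed (use * that in auto)
qed

lemma adjoinI: "g \<in> poly_over E \<Longrightarrow> h \<in> poly_over E \<Longrightarrow> poly g \<theta> / poly h \<theta> \<in> adjoin E \<theta>"
  by (auto simp: adjoin_def)

lemma adjoin_superset: "E \<subseteq> adjoin E \<theta>"
  using adjoinI[of "[:c:]" 1 \<theta> for c] by (force intro: poly_over_mem)

lemma adjoin_generator: "\<theta> \<in> adjoin E \<theta>"
  using adjoinI[of "[:0, 1:]" 1 \<theta>] by (force intro: poly_over_mem ring_mem)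

lemma subfield_set_adjoin: "subfield_set (adjoin E \<theta>)"
proof unfold_locales
  show "1 \<in> adjoin E \<theta>"
    using adjoin_superset one_mem by auto
  fix x y assume "x \<in> adjoin E \<theta>" "y \<in> adjoin E \<theta>"
  then obtain g h g' h' where *: "g \<in> poly_over E" "h \<in> poly_over E" "poly h \<theta> \<noteq> 0" "x = poly g \<theta> / poly h \<theta>"
    "g' \<in> poly_over E" "h' \<in> poly_over E" "poly h' \<theta> \<noteq> 0" "y = poly g' \<theta> / poly h' \<theta>"
    by (metis adjoinE)
  have "poly (g * h' - g' * h) \<theta> / poly (h * h') \<theta> \<in> adjoin E \<theta>"
    using * by (intro adjoinI poly_over_mem)
  also have "poly (g * h' - g' * h) \<theta> / poly (h * h') \<theta> = x - y"
    using * by (simp add: diff_divide_distrib)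
  finally show "x - y \<in> adjoin E \<theta>" .
  have "poly (g * g') \<theta> / poly (h * h') \<theta> \<in> adjoin E \<theta>"
    using * by (intro adjoinI poly_over_mem)
  then show "x * y \<in> adjoin E \<theta>"
    using * by simp
next
  fix x assume "x \<in> adjoin E \<theta>"
  then obtain g h where "g \<in> poly_over E" "h \<in> poly_over E" "x = poly g \<theta> / poly h \<theta>"
    by (metis adjoinE)
  then show "inverse x \<in> adjoin E \<theta>"
    using adjoinI[of h g \<theta>] by simp
qed

end

text \<open>Hensel's lemma as a membership condition instead of an existence statement: in an
  algebraically closed ambient field the roots exist already, and only their lying in
  \<open>E\<close> is in question.\<close>

definition henselian :: "'a::field set \<Rightarrow> 'a set \<Rightarrow> bool" where
  "henselian V E \<longleftrightarrow> (\<forall>f\<in>poly_over (E \<inter> V). \<forall>\<theta>\<in>V. poly f \<theta> = 0 \<and> poly (pderiv f) \<theta> \<notin> nonunits V \<longrightarrow> \<theta> \<in> E)"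

text \<open>\<open>V\<close> will live on an algebraically closed field, where values are infinitely
  divisible, so \<open>\<pi>\<close> is a uniformizer only for certain subfields.
  \<open>separated\<close> makes repeated division by \<open>\<pi>\<close> terminate.\<close>

locale uniformized_valuation_ring = valuation_ring V for V :: "'a::field set" +
  fixes \<pi> :: 'a
  assumes pi_nonunit: "\<pi> \<in> nonunits V"
    and pi_nonzero: "\<pi> \<noteq> 0"
    and separated: "a \<noteq> 0 \<Longrightarrow> \<exists>n. a / \<pi> ^ n \<notin> V"
begin

lemma pi_mem: "\<pi> \<in> V"
  using pi_nonunit ideal_subset by blast

text \<open>The value of \<open>x\<close> is an integral multiple of that of \<open>\<pi>\<close>;
  the difference \<open>m - n\<close> of natural exponents stands for the integer.\<close>

definition discrete :: "'a \<Rightarrow> bool" where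
  "discrete x \<longleftrightarrow> (\<exists>n m. unit (x * \<pi> ^ n / \<pi> ^ m))"

lemma discreteI: "unit u \<Longrightarrow> x * \<pi> ^ n = u * \<pi> ^ m \<Longrightarrow> discrete x"
  unfolding discrete_def using pi_nonzero by (intro exI[of _ n] exI[of _ m]) simp

lemma discreteE:
  assumes "discrete x"
  obtains n m u where "unit u" "x * \<pi> ^ n = u * \<pi> ^ m"
proof -
  obtain n m where "unit (x * \<pi> ^ n / \<pi> ^ m)"
    using assms unfolding discrete_def by blast
  then show thesis
    using pi_nonzero by (intro that[of "x * \<pi> ^ n / \<pi> ^ m" n m]) auto
qed

lemma discrete_unit: "unit u \<Longrightarrow> discrete u"
  by (rule discreteI[of u u 0 0]) auto

lemma discrete_pi: "discrete \<pi>"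
  using one_mem one_notin by (intro discreteI[of 1 \<pi> 0 1]) auto

lemma discrete_mult:
  assumes "discrete x" "discrete y" shows "discrete (x * y)"
proof -
  obtain n m u n' m' u' where "unit u" "x * \<pi> ^ n = u * \<pi> ^ m" "unit u'" "y * \<pi> ^ n' = u' * \<pi> ^ m'"
    using assms by (metis discreteE)
  note * = this
  have "(x * y) * \<pi> ^ (n + n') = (x * \<pi> ^ n) * (y * \<pi> ^ n')"
    by (simp add: power_add mult_ac)
  also have "\<dots> = (u * u') * \<pi> ^ (m + m')"
    unfolding *(2,4) by (simp add: power_add mult_ac)
  finally have "(x * y) * \<pi> ^ (n + n') = (u * u') * \<pi> ^ (m + m')" .
  moreover have "unit (u * u')"
    using * unit_mult by blast
  ultimately show ?thesis
    using discreteI by blast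
qed

lemma discrete_inverse:
  assumes "discrete x" shows "discrete (inverse x)"
proof -
  obtain n m u where *: "unit u" "x * \<pi> ^ n = u * \<pi> ^ m"
    using assms by (metis discreteE)
  then have "x \<noteq> 0"
    using pi_nonzero unit_nonzero by auto
  with * have "inverse x * \<pi> ^ m = inverse u * \<pi> ^ n"
    using unit_nonzero[of u] by (simp add: field_simps)
  then show ?thesis
    using * unit_inverse discreteI by blast
qed

lemma discrete_power: "discrete x \<Longrightarrow> discrete (x ^ n)"
  using one_mem one_notin by (induction n) (auto intro: discrete_unit discrete_mult)

lemma discrete_divide: "discrete x \<Longrightarrow> discrete y \<Longrightarrow> discrete (x / y)"
  unfolding divide_inverse by (intro discrete_mult discrete_inverse)

lemma discrete_nonunit:
  assumes "discrete x" "x \<in> nonunits V" shows "x / \<pi> \<in> V"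
proof -
  obtain n m u where *: "unit u" "x * \<pi> ^ n = u * \<pi> ^ m"
    using assms by (metis discreteE)
  have "n < m"
  proof (rule ccontr)
    assume "\<not> n < m"
    then have "\<pi> ^ n = \<pi> ^ (n - m) * \<pi> ^ m"
      by (simp flip: power_add)
    with * have "u = x * \<pi> ^ (n - m)"
      using pi_nonzero by simp
    with assms * show False
      using ideal_mult2 pi_mem power_mem by blast
  qed
  then have "\<pi> ^ m = \<pi> * \<pi> ^ (m - n - 1) * \<pi> ^ n"
    by (simp flip: power_add power_Suc)
  with * have "x / \<pi> = u * \<pi> ^ (m - n - 1)"
    using pi_nonzero by (simp add: field_simps)
  then show ?thesis
    using * pi_mem by (auto intro: ring_mem)
qed

lemma clear_denominator: "\<exists>n. a * \<pi> ^ n \<in> V"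
proof (cases "a \<in> V")
  case True
  then show ?thesis by (intro exI[of _ 0]) auto
next
  case False
  then have "a \<noteq> 0" using zero_mem by auto
  with separated[of "inverse a"] obtain n where "inverse a / \<pi> ^ n \<notin> V" by auto
  with total[of "inverse a / \<pi> ^ n"] have "inverse (inverse a / \<pi> ^ n) \<in> V" by blast
  also have "inverse (inverse a / \<pi> ^ n) = a * \<pi> ^ n" by (simp add: field_simps)
  finally show ?thesis ..
qed

lemma clear_denominators: "\<exists>n. smult (\<pi> ^ n) g \<in> poly_over V"
proof (induction g rule: pCons_induct)
  case 0
  then show ?case by (auto intro: poly_over_mem)
next
  case (pCons a g)
  obtain n m where n: "a * \<pi> ^ n \<in> V" and m: "smult (\<pi> ^ m) g \<in> poly_over V"
    using clear_denominator pCons.IH by blast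
  have "(a * \<pi> ^ n) * \<pi> ^ m \<in> V" "smult (\<pi> ^ n) (smult (\<pi> ^ m) g) \<in> poly_over V"
    using n m by (auto simp del: smult_smult intro!: mult_mem[OF n] poly_over_smult power_mem pi_mem)
  then have "pCons ((a * \<pi> ^ n) * \<pi> ^ m) (smult (\<pi> ^ n) (smult (\<pi> ^ m) g)) \<in> poly_over V"
    by (rule poly_over_pCons)
  then have "smult (\<pi> ^ (n + m)) (pCons a g) \<in> poly_over V"
    by (simp add: power_add mult_ac)
  then show ?case by blast
qed

text \<open>The value group of \<open>E\<close> is generated by the value of \<open>\<pi>\<close>.
  As the condition refers to single elements, it survives unions of chains; residue fields are left
  unrestricted.\<close>

definition unramified_subfield :: "'a set \<Rightarrow> bool" where
  "unramified_subfield E \<longleftrightarrow> subfield_set E \<and> \<pi> \<in> E \<and> (\<forall>x\<in>E. x \<noteq> 0 \<longrightarrow> discrete x)"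

lemma local_subdomain_Int:
  assumes "subfield_set E" shows "local_subdomain (E \<inter> V) (E \<inter> nonunits V)"
proof -
  interpret E: subfield_set E by fact
  show ?thesis
  proof unfold_locales
    show "E \<inter> nonunits V \<subseteq> E \<inter> V" "1 \<notin> E \<inter> nonunits V"
      using ideal_subset one_notin by auto
  qed (simp_all add: one_mem E.one_mem diff_mem E.diff_mem mult_mem E.mult_mem E.zero_mem ideal_zero
        E.add_mem ideal_add ideal_mult E.inverse_mem inverse_mem)
qed

text \<open>\<open>m\<close> plays the part of a minimal polynomial of the residue class of
  \<open>\<theta>\<close>, and \<open>f\<close> reduces to \<open>m * h\<close> with
  \<open>h(\<theta>)\<close> a unit. Whenever \<open>g(\<theta>)\<close> is a nonunit, a unit
  multiple of it is \<open>\<pi>\<close> times another polynomial value, so nonzero values are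
  powers of \<open>\<pi>\<close> up to units. A general \<open>h\<close> covers simple roots;
  \<open>h = 1\<close> covers roots of a lift of \<open>m\<close>, which may be inseparable modulo
  \<open>V\<close>.\<close>

lemma unramified_adjoin:
  assumes E: "unramified_subfield E" and \<theta>: "\<theta> \<in> V"
    and f: "f \<in> poly_over (E \<inter> V)" "poly f \<theta> = 0"
    and m: "m \<in> poly_over (E \<inter> V)" and h: "h \<in> poly_over (E \<inter> V)" "poly h \<theta> \<notin> nonunits V"
    and fmh: "f - m * h \<in> poly_over (E \<inter> nonunits V)"
    and div: "\<And>g. g \<in> poly_over (E \<inter> V) \<Longrightarrow> poly g \<theta> \<in> nonunits V \<Longrightarrow>
      \<exists>q\<in>poly_over (E \<inter> V). g - m * q \<in> poly_over (E \<inter> nonunits V)"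
  shows "unramified_subfield (adjoin E \<theta>)"
proof -
  interpret E: subfield_set E using E by (auto simp: unramified_subfield_def)
  interpret EV: local_subdomain "E \<inter> V" "E \<inter> nonunits V"
    by (rule local_subdomain_Int) (rule E.subfield_set_axioms)
  have step: "\<exists>g\<^sub>1\<in>poly_over (E \<inter> V). poly g \<theta> * poly h \<theta> = \<pi> * poly g\<^sub>1 \<theta>"
    if g: "g \<in> poly_over (E \<inter> V)" "poly g \<theta> \<in> nonunits V" for g
  proof -
    obtain q where q: "q \<in> poly_over (E \<inter> V)" "g - m * q \<in> poly_over (E \<inter> nonunits V)"
      using div[OF g] by blast
    \<comment> \<open>This is \<open>g * h - f * q\<close>: it agrees with \<open>g * h\<close> at
      \<open>\<theta>\<close> since \<open>f\<close> vanishes there, and all its coefficients are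
      nonunits in \<open>E\<close>, hence divisible by \<open>\<pi>\<close>.\<close>
    define s where "s = (g - m * q) * h - (f - m * h) * q"
    have "s \<in> poly_over (E \<inter> nonunits V)"
      unfolding s_def by (rule EV.poly_over_ideal_diff; rule EV.poly_over_ideal_mult2) (fact q h fmh)+
    then have c: "coeff s i \<in> E" "coeff s i \<in> nonunits V" for i
      by (auto simp: poly_over_def)
    have "coeff s i / \<pi> \<in> E \<inter> V" for i
    proof (cases "coeff s i = 0")
      case False
      with c E discrete_nonunit show ?thesis
        by (auto simp: unramified_subfield_def intro: E.divide_mem)
    qed (auto intro: ring_mem E.ring_mem)
    then have "smult (inverse \<pi>) s \<in> poly_over (E \<inter> V)"
      by (simp add: poly_over_def divide_inverse mult.commute)
    moreover have "poly g \<theta> * poly h \<theta> = poly s \<theta>"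
      using f by (simp add: s_def algebra_simps)
    ultimately show ?thesis
      using pi_nonzero by (intro bexI[of _ "smult (inverse \<pi>) s"]) auto
  qed
  have mem: "poly g \<theta> \<in> V" if "g \<in> poly_over (E \<inter> V)" for g
    using that \<theta> by (auto simp: poly_over_Int intro: poly_mem)
  \<comment> \<open>Each step divides by \<open>\<pi>\<close> up to the unit
    \<open>h(\<theta>)\<close> and lowers by one the exponent \<open>n\<close> supplied by
    \<open>separated\<close>, so a unit is reached.\<close>
  have disc1: "discrete (poly g \<theta>)" if "g \<in> poly_over (E \<inter> V)" "poly g \<theta> / \<pi> ^ n \<notin> V" for g n
    using that
  proof (induction n arbitrary: g)
    case 0
    then show ?case using mem by auto
  next
    case (Suc n)
    show ?case
    proof (cases "poly g \<theta> \<in> nonunits V")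
      case True
      then obtain g' where g': "g' \<in> poly_over (E \<inter> V)" "poly g \<theta> * poly h \<theta> = \<pi> * poly g' \<theta>"
        using step Suc.prems by blast
      have hu: "unit (poly h \<theta>)" using h mem by auto
      have "poly g' \<theta> / \<pi> ^ n \<notin> V"
      proof
        assume "poly g' \<theta> / \<pi> ^ n \<in> V"
        then have "(poly g' \<theta> / \<pi> ^ n) / poly h \<theta> \<in> V"
          by (rule divide_unit_mem[OF _ hu])
        moreover have "(poly g' \<theta> / \<pi> ^ n) / poly h \<theta> = poly g \<theta> / \<pi> ^ Suc n"
          using g' pi_nonzero unit_nonzero[OF hu] by (simp add: field_simps)
        ultimately show False using Suc.prems by simp
      qed
      then have "discrete (\<pi> * poly g' \<theta> / poly h \<theta>)"
        by (intro discrete_divide[OF _ discrete_unit[OF hu]] discrete_mult discrete_pi Suc.IH g')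
      also have "\<pi> * poly g' \<theta> / poly h \<theta> = poly g \<theta>"
        using g'(2) unit_nonzero[OF hu] by (simp flip: g'(2))
      finally show ?thesis .
    qed (use mem Suc.prems discrete_unit in auto)
  qed
  have disc2: "discrete (poly g \<theta>)" if g: "g \<in> poly_over E" "poly g \<theta> \<noteq> 0" for g
  proof -
    obtain n where n: "smult (\<pi> ^ n) g \<in> poly_over V"
      using clear_denominators by blast
    have "smult (\<pi> ^ n) g \<in> poly_over (E \<inter> V)"
      using n g E by (auto simp: poly_over_Int unramified_subfield_def intro: E.poly_over_mem E.ring_mem)
    moreover have "poly (smult (\<pi> ^ n) g) \<theta> \<noteq> 0"
      using g pi_nonzero by auto
    ultimately have "discrete (poly (smult (\<pi> ^ n) g) \<theta>)"
      using disc1 separated by blast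
    then have "discrete (poly (smult (\<pi> ^ n) g) \<theta> / \<pi> ^ n)"
      by (intro discrete_divide discrete_power discrete_pi)
    then show ?thesis
      using pi_nonzero by simp
  qed
  have "discrete x" if "x \<in> adjoin E \<theta>" "x \<noteq> 0" for x
    using that by (auto elim!: E.adjoinE intro!: discrete_divide disc2)
  then show ?thesis
    using E E.subfield_set_adjoin E.adjoin_superset by (auto simp: unramified_subfield_def)
qed

lemma unramified_adjoin_simple_root:
  assumes E: "unramified_subfield E" and \<theta>: "\<theta> \<in> V"
    and f: "f \<in> poly_over (E \<inter> V)" "poly f \<theta> = 0" "poly (pderiv f) \<theta> \<notin> nonunits V"
  shows "unramified_subfield (adjoin E \<theta>)"
proof -
  interpret E: subfield_set E using E by (auto simp: unramified_subfield_def)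
  interpret EV: local_subdomain "E \<inter> V" "E \<inter> nonunits V"
    by (rule local_subdomain_Int) (rule E.subfield_set_axioms)
  have ev: "poly g \<theta> \<in> nonunits V" if "g \<in> poly_over (E \<inter> nonunits V)" for g
    using that \<theta> by (auto simp: poly_over_Int intro: poly_ideal)
  have fn: "f \<notin> poly_over (E \<inter> nonunits V)"
    using f ev EV.poly_over_ideal_pderiv by blast
  obtain m where m: "m \<in> poly_over (E \<inter> V)" "poly m \<theta> \<in> nonunits V"
    "\<And>g. g \<in> poly_over (E \<inter> V) \<Longrightarrow> poly g \<theta> \<in> nonunits V \<Longrightarrow>
      \<exists>q\<in>poly_over (E \<inter> V). g - m * q \<in> poly_over (E \<inter> nonunits V)"
  proof (rule EV.minimal_poly_mod[OF local_subdomain_axioms _ _ _ \<theta> f(1) fn])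
    show "poly f \<theta> \<in> nonunits V" using f ideal_zero by simp
  qed (use that in blast)+
  obtain h where h: "h \<in> poly_over (E \<inter> V)" "f - m * h \<in> poly_over (E \<inter> nonunits V)"
    using m(3)[OF f(1)] f(2) ideal_zero by auto
  have mem: "poly g \<theta> \<in> V" if "g \<in> poly_over (E \<inter> V)" for g
    using that \<theta> by (auto simp: poly_over_Int intro: poly_mem)
  \<comment> \<open>If \<open>m\<close> and \<open>h\<close> both vanished at
    \<open>\<theta>\<close> modulo the maximal ideal, the root would be double and the derivative of
    \<open>f\<close> a nonunit there.\<close>
  have "poly h \<theta> \<notin> nonunits V"
  proof
    assume "poly h \<theta> \<in> nonunits V"
    then have "poly m \<theta> * poly (pderiv h) \<theta> + poly h \<theta> * poly (pderiv m) \<theta> + poly (pderiv (f - m * h)) \<theta> \<in> nonunits V"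
      by (intro ideal_add ideal_mult2[of "poly m \<theta>"] ideal_mult2[of "poly h \<theta>"])
        (auto intro!: m(1,2) h mem ev[OF EV.poly_over_ideal_pderiv] EV.poly_over_pderiv)
    then show False
      using f by (simp add: pderiv_diff pderiv_mult algebra_simps)
  qed
  with m h show ?thesis
    using unramified_adjoin[OF E \<theta> f(1,2)] by blast
qed

lemma unramified_Union:
  assumes "subset.chain (Collect unramified_subfield) C" "C \<noteq> {}"
  shows "unramified_subfield (\<Union>C)"
proof -
  have C: "unramified_subfield E" if "E \<in> C" for E
    using assms that by (auto simp: subset.chain_def)
  have common: "\<exists>E\<in>C. x \<in> E \<and> y \<in> E" if "x \<in> \<Union>C" "y \<in> \<Union>C" for x y
    using that assms unfolding subset.chain_def by blast
  have "subfield_set (\<Union>C)"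
  proof unfold_locales
    show "1 \<in> \<Union>C"
      using assms(2) C unfolding unramified_subfield_def subfield_set_def subdomain_def by blast
    show "x - y \<in> \<Union>C" "x * y \<in> \<Union>C" if "x \<in> \<Union>C" "y \<in> \<Union>C" for x y
      using common[OF that] C unfolding unramified_subfield_def subfield_set_def subdomain_def by blast+
    show "inverse x \<in> \<Union>C" if "x \<in> \<Union>C" for x
      using that C unfolding unramified_subfield_def subfield_set_def subfield_set_axioms_def by blast
  qed
  then show ?thesis
    using assms(2) C unfolding unramified_subfield_def by blast
qed

lemma henselian_extension:
  assumes "unramified_subfield E"
  obtains E' where "E \<subseteq> E'" "unramified_subfield E'" "henselian V E'"
proof -
  define S where "S = {E'. E \<subseteq> E' \<and> unramified_subfield E'}"
  have "\<exists>M\<in>S. \<forall>N\<in>S. M \<subseteq> N \<longrightarrow> N = M"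
  proof (rule subset_Zorn_nonempty)
    show "S \<noteq> {}" using assms by (auto simp: S_def)
    fix C assume C: "C \<noteq> {}" "subset.chain S C"
    then have "subset.chain (Collect unramified_subfield) C"
      by (auto simp: subset.chain_def S_def)
    then have "unramified_subfield (\<Union>C)" using C unramified_Union by blast
    then show "\<Union>C \<in> S"
      using C unfolding S_def subset.chain_def by blast
  qed
  then obtain M where M: "M \<in> S" "\<And>N. N \<in> S \<Longrightarrow> M \<subseteq> N \<Longrightarrow> N = M"
    by blast
  interpret M: subfield_set M using M by (auto simp: S_def unramified_subfield_def)
  have "henselian V M"
    unfolding henselian_def
  proof (intro ballI impI)
    fix f \<theta> assume *: "f \<in> poly_over (M \<inter> V)" "\<theta> \<in> V" "poly f \<theta> = 0 \<and> poly (pderiv f) \<theta> \<notin> nonunits V"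
    then have "unramified_subfield (adjoin M \<theta>)"
      using M unramified_adjoin_simple_root by (auto simp: S_def)
    then have "adjoin M \<theta> = M"
      using M M.adjoin_superset[of \<theta>] by (auto simp: S_def)
    then show "\<theta> \<in> M"
      using M.adjoin_generator by blast
  qed
  with M that show thesis by (auto simp: S_def)
qed

end

section \<open>Residue fields and existence of valuation rings\<close>

lemma degree_pderiv_le: "degree (pderiv f) \<le> degree f - 1"
  by (rule degree_le) (auto simp: coeff_pderiv coeff_eq_0)

text \<open>All roots of a monic \<open>H\<close> over \<open>V\<close> lie in \<open>V\<close>, so
  \<open>H(s)\<close> is the product of the differences \<open>s - x\<close> over the roots; as the
  maximal ideal is prime, one factor is a nonunit. Roots are split off one at a time.\<close>

lemma monic_root_mod:
  fixes V :: "'a::alg_closed_field set"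
  assumes "valuation_ring V" "H \<in> poly_over V" "lead_coeff H = 1" "s \<in> V" "poly H s \<in> nonunits V"
  shows "\<exists>x\<in>V. poly H x = 0 \<and> s - x \<in> nonunits V"
  using assms(2,3,5)
proof (induction "degree H" arbitrary: H rule: less_induct)
  case less
  interpret valuation_ring V by fact
  have "degree H \<noteq> 0"
  proof
    assume "degree H = 0"
    then have "H = [:lead_coeff H:]"
      by (metis degree_0_id)
    then show False
      using less.prems one_notin by (metis mult_zero_right add_0_right poly_0 poly_pCons)
  qed
  then obtain x where x: "poly H x = 0"
    using alg_closed_imp_poly_has_root by blast
  have xV: "x \<in> V"
    using less.prems x one_notin by (intro integral_mem[of H]) auto
  have "[:- x, 1:] \<in> poly_over V"
    using xV by (intro poly_over_pCons poly_over_0 uminus_mem one_mem)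
  then obtain q r where qr: "q \<in> poly_over V" "r \<in> poly_over V" "H = [:- x, 1:] * q + r"
    "r = 0 \<or> degree r < degree [:- x, 1:]"
    using monic_division[of "[:- x, 1:]" H] less.prems by auto
  have "r = [:poly r x:]"
    using qr(4) degree_0_id by (cases "r = 0") (force elim: degree_eq_zeroE)+
  moreover have "poly r x = 0"
    using qr(3) x by simp
  ultimately have H: "H = [:- x, 1:] * q"
    using qr(3) by simp
  have "q \<noteq> 0" using H less.prems by auto
  then have deg: "degree q < degree H"
    unfolding H by (subst degree_mult_eq) auto
  have monic: "lead_coeff q = 1"
    using less.prems(2) unfolding H lead_coeff_mult by simp
  show ?case
  proof (cases "s - x \<in> nonunits V")
    case True
    then show ?thesis using x xV by blast
  next
    case False
    have "(s - x) * poly q s \<in> nonunits V"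
      using less.prems(3) unfolding H by (simp add: algebra_simps)
    then have "poly q s \<in> nonunits V"
      using False ideal_prime[of "s - x" "poly q s"] assms(4) xV qr(1) diff_mem poly_mem by blast
    then obtain y where "y \<in> V" "poly q y = 0" "s - y \<in> nonunits V"
      using less.hyps[OF deg qr(1) monic] by blast
    then show ?thesis
      unfolding H by (intro bexI[of _ y]) auto
  qed
qed

text \<open>
  A residue class \<open>s\<close> that is inseparable over the residue field of \<open>K\<close> is impossible: its minimal
  polynomial lifts to a polynomial \<open>H\<close> over \<open>K\<close> for which \<open>H s / \<pi>\<close> is a unit; then \<open>\<pi>\<close> is still a
  uniformizer of \<open>K(x)\<close> for a root \<open>x \<equiv> s\<close> of \<open>H\<close>, and as \<open>s\<close> lies in an unramified extension of
  \<open>K(x)\<close>, Taylor's formula makes \<open>H s = H s - H x\<close> divisible by more than \<open>\<pi>\<close>.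
\<close>

lemma residually_separable:
  fixes V :: "'a::alg_closed_field set"
  assumes "uniformized_valuation_ring V \<pi>" and K: "uniformized_valuation_ring.unramified_subfield V \<pi> K" and s: "s \<in> V"
    and g: "g \<in> poly_over (K \<inter> V)" "lead_coeff g = 1" "poly g s \<in> nonunits V"
    and all: "\<And>E. K \<subseteq> E \<Longrightarrow> uniformized_valuation_ring.unramified_subfield V \<pi> E \<Longrightarrow> henselian V E \<Longrightarrow> s \<in> E"
  obtains f u v where "f \<in> poly_over (K \<inter> V)" "u \<in> poly_over (K \<inter> V)" "v \<in> poly_over (K \<inter> V)"
    "poly f s \<in> nonunits V" "u * f + v * pderiv f - 1 \<in> poly_over (K \<inter> nonunits V)"
proof -
  interpret uniformized_valuation_ring V \<pi> by fact
  interpret K: subfield_set K using K by (auto simp: unramified_subfield_def)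
  interpret KV: local_subdomain "K \<inter> V" "K \<inter> nonunits V"
    by (rule local_subdomain_Int) (rule K.subfield_set_axioms)
  have mem: "poly f y \<in> V" if "f \<in> poly_over (K \<inter> V)" "y \<in> V" for f y
    using that by (auto simp: poly_over_Int intro: poly_mem)
  have ev: "poly f y \<in> nonunits V" if "f \<in> poly_over (K \<inter> nonunits V)" "y \<in> V" for f y
    using that by (auto simp: poly_over_Int intro: poly_ideal)
  obtain m where m: "m \<in> poly_over (K \<inter> V)" "lead_coeff m = 1" "poly m s \<in> nonunits V"
    and least: "\<And>g. g \<in> poly_over (K \<inter> V) \<Longrightarrow> poly g s \<in> nonunits V \<Longrightarrow>
      g \<notin> poly_over (K \<inter> nonunits V) \<Longrightarrow> degree m \<le> degree g"
    and div: "\<And>g. g \<in> poly_over (K \<inter> V) \<Longrightarrow> poly g s \<in> nonunits V \<Longrightarrow>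
      \<exists>q\<in>poly_over (K \<inter> V). g - m * q \<in> poly_over (K \<inter> nonunits V)"
  proof (rule KV.minimal_poly_mod[OF local_subdomain_axioms _ _ _ s g(1) KV.monic_notin[OF g(2)] g(3)])
  qed (use that in blast)+
  have deg_m: "degree m \<noteq> 0"
  proof
    assume "degree m = 0"
    then have "m = [:1:]"
      using m(2) by (metis degree_0_id)
    then show False
      using m(3) one_notin by simp
  qed
  show thesis
  proof (cases "pderiv m \<in> poly_over (K \<inter> nonunits V)")
    case False
    have m': "pderiv m \<in> poly_over (K \<inter> V)"
      using m by (intro KV.poly_over_mem)
    have nz: "poly (pderiv m) s \<notin> nonunits V"
      using least[OF m' _ False] degree_pderiv_le[of m] deg_m by linarith
    \<comment> \<open>\<open>J\<close> reduces to the ideal generated by \<open>m\<close> and its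
      derivative; its generator \<open>d\<close> is their greatest common divisor, to be shown
      trivial.\<close>
    define J where "J = {j \<in> poly_over (K \<inter> V). \<exists>u\<in>poly_over (K \<inter> V). \<exists>v\<in>poly_over (K \<inter> V).
      j - (u * m + v * pderiv m) \<in> poly_over (K \<inter> nonunits V)}"
    have mJ: "m \<in> J"
    proof -
      have "m - (1 * m + 0 * pderiv m) \<in> poly_over (K \<inter> nonunits V)"
        using KV.poly_over_ideal_0 by simp
      then show ?thesis
        unfolding J_def using m(1) KV.poly_over_0 KV.poly_over_1 by blast
    qed
    have m'J: "pderiv m \<in> J"
    proof -
      have "pderiv m - (0 * m + 1 * pderiv m) \<in> poly_over (K \<inter> nonunits V)"
        using KV.poly_over_ideal_0 by simp
      then show ?thesis
        unfolding J_def using m' KV.poly_over_0 KV.poly_over_1 by blast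
    qed
    have diffJ: "f - g \<in> J" if "f \<in> J" "g \<in> J" for f g
    proof -
      obtain u v where f: "f \<in> poly_over (K \<inter> V)" "u \<in> poly_over (K \<inter> V)" "v \<in> poly_over (K \<inter> V)"
        "f - (u * m + v * pderiv m) \<in> poly_over (K \<inter> nonunits V)"
        using \<open>f \<in> J\<close> unfolding J_def by blast
      obtain u' v' where g: "g \<in> poly_over (K \<inter> V)" "u' \<in> poly_over (K \<inter> V)" "v' \<in> poly_over (K \<inter> V)"
        "g - (u' * m + v' * pderiv m) \<in> poly_over (K \<inter> nonunits V)"
        using \<open>g \<in> J\<close> unfolding J_def by blast
      have "(f - g) - ((u - u') * m + (v - v') * pderiv m) =
          (f - (u * m + v * pderiv m)) - (g - (u' * m + v' * pderiv m))"
        by (simp add: algebra_simps)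
      also have "\<dots> \<in> poly_over (K \<inter> nonunits V)"
        using f(4) g(4) by (rule KV.poly_over_ideal_diff)
      finally show ?thesis
        unfolding J_def using f g KV.poly_over_diff by blast
    qed
    have multJ: "f * g \<in> J" if "f \<in> poly_over (K \<inter> V)" "g \<in> J" for f g
    proof -
      obtain u v where *: "g \<in> poly_over (K \<inter> V)" "u \<in> poly_over (K \<inter> V)" "v \<in> poly_over (K \<inter> V)"
        "g - (u * m + v * pderiv m) \<in> poly_over (K \<inter> nonunits V)"
        using \<open>g \<in> J\<close> unfolding J_def by blast
      have "f * g - ((f * u) * m + (f * v) * pderiv m) = f * (g - (u * m + v * pderiv m))"
        by (simp add: algebra_simps)
      also have "\<dots> \<in> poly_over (K \<inter> nonunits V)"
        using that(1) *(4) by (rule KV.poly_over_ideal_mult)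
      finally show ?thesis
        unfolding J_def using * that KV.poly_over_mult by blast
    qed
    have idealJ: "poly_over (K \<inter> nonunits V) \<subseteq> J"
    proof
      fix f assume f: "f \<in> poly_over (K \<inter> nonunits V)"
      then show "f \<in> J"
        unfolding J_def using KV.poly_over_ideal_subset[OF f]
        by (auto intro!: bexI[OF _ KV.poly_over_0])
    qed
    obtain d where d: "d \<in> J" "lead_coeff d = 1"
      "\<And>g. g \<in> J \<Longrightarrow> \<exists>q\<in>poly_over (K \<inter> V). g - d * q \<in> poly_over (K \<inter> nonunits V)"
    proof (rule KV.poly_ideal_generator[of J m])
      show "J \<subseteq> poly_over (K \<inter> V)" by (auto simp: J_def)
    qed (use diffJ multJ idealJ mJ KV.monic_notin[OF m(2)] that in blast)+
    have dA: "d \<in> poly_over (K \<inter> V)" using d by (simp add: J_def)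
    obtain e where e: "e \<in> poly_over (K \<inter> V)" "m - d * e \<in> poly_over (K \<inter> nonunits V)"
      using d(3)[OF mJ] by blast
    obtain e' where e': "e' \<in> poly_over (K \<inter> V)" "pderiv m - d * e' \<in> poly_over (K \<inter> nonunits V)"
      using d(3)[OF m'J] by blast
    \<comment> \<open>\<open>d\<close> divides \<open>pderiv m\<close> modulo the maximal ideal, and
      that derivative does not vanish at \<open>s\<close> by minimality of \<open>m\<close>.\<close>
    have ds: "poly d s \<notin> nonunits V"
    proof
      assume "poly d s \<in> nonunits V"
      then have "poly (pderiv m - d * e') s + poly d s * poly e' s \<in> nonunits V"
        using ev[OF e'(2) s] mem[OF e'(1) s] by (intro ideal_add ideal_mult2)
      with nz show False by simp
    qed
    have "poly m s - poly (m - d * e) s \<in> nonunits V"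
      using m(3) ev[OF e(2) s] by (rule ideal_diff)
    then have es: "poly e s \<in> nonunits V"
      using ds ideal_prime[OF mem[OF dA s] mem[OF e(1) s]] by simp
    have "e \<notin> poly_over (K \<inter> nonunits V)"
    proof
      assume "e \<in> poly_over (K \<inter> nonunits V)"
      then have "(m - d * e) + d * e \<in> poly_over (K \<inter> nonunits V)"
        using e dA by (intro KV.poly_over_ideal_add KV.poly_over_ideal_mult)
      with KV.monic_notin[OF m(2)] show False by simp
    qed
    then obtain w h where h: "w \<in> K \<inter> V" "h \<in> poly_over (K \<inter> V)" "lead_coeff h = 1"
      "h - smult w e \<in> poly_over (K \<inter> nonunits V)"
      using KV.monic_normalize[OF e(1)] by metis
    have hs: "poly h s \<in> nonunits V"
    proof -
      have "poly (h - smult w e) s + w * poly e s \<in> nonunits V"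
        using ev[OF h(4) s] es h(1) by (intro ideal_add ideal_mult) auto
      then show ?thesis by simp
    qed
    have deg_mh: "degree m \<le> degree h"
      using least[OF h(2) hs KV.monic_notin[OF h(3)]] .
    \<comment> \<open>Since \<open>d(s)\<close> is a unit, the cofactor \<open>e\<close>, and so its
      monic multiple \<open>h\<close>, vanishes at \<open>s\<close> modulo \<open>V\<close>; thus
      \<open>h\<close> has degree at least that of \<open>m\<close>, while \<open>d * h\<close>
      reduces to a constant multiple of \<open>m\<close>. Only \<open>degree d = 0\<close> is
      left.\<close>
    have "d * h - smult w m = d * (h - smult w e) - [:w:] * (m - d * e)"
      by (simp add: algebra_simps)
    also have "\<dots> \<in> poly_over (K \<inter> nonunits V)"
      by (rule KV.poly_over_ideal_diff; rule KV.poly_over_ideal_mult)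
        (fact dA h e KV.poly_over_pCons[OF h(1) KV.poly_over_0])+
    finally have "coeff (d * h - smult w m) (degree d + degree h) \<in> nonunits V"
      by (simp add: poly_over_def)
    moreover have "coeff (d * h) (degree d + degree h) = 1"
      using d(2) h(3) by (simp add: coeff_mult_degree_sum)
    ultimately have "coeff m (degree d + degree h) \<noteq> 0"
      using one_notin by auto
    then have "degree d + degree h \<le> degree m"
      by (rule le_degree)
    with deg_mh have "degree d = 0" by simp
    with d(2) have "d = 1"
      by (metis degree_0_id one_pCons)
    with d(1) obtain u v where uv: "u \<in> poly_over (K \<inter> V)" "v \<in> poly_over (K \<inter> V)"
      "1 - (u * m + v * pderiv m) \<in> poly_over (K \<inter> nonunits V)"
      by (auto simp: J_def)
    have "0 - (1 - (u * m + v * pderiv m)) \<in> poly_over (K \<inter> nonunits V)"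
      by (rule KV.poly_over_ideal_diff[OF KV.poly_over_ideal_0 uv(3)])
    with that[OF m(1) uv(1,2) m(3)] show thesis by simp
  next
    case True
    obtain E where E: "K \<subseteq> E" "unramified_subfield E" "henselian V E"
      using henselian_extension[OF K] by blast
    have sE: "s \<in> E" using all E by blast
    interpret E: subfield_set E using E by (auto simp: unramified_subfield_def)
    have piK: "\<pi> \<in> K \<inter> nonunits V"
      using K pi_nonunit by (auto simp: unramified_subfield_def)
    have "poly m s \<in> E"
      using sE m E by (intro E.poly_mem) (auto simp: poly_over_def)
    then have q: "poly m s / \<pi> \<in> V"
      using E m discrete_nonunit zero_mem by (cases "poly m s = 0") (auto simp: unramified_subfield_def)
    \<comment> \<open>\<open>m(s) / \<pi>\<close> and \<open>m(s) / \<pi> + 1\<close> cannot both be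
      nonunits, so \<open>m\<close> or \<open>m + \<pi>\<close> takes at \<open>s\<close> a value
      divisible by \<open>\<pi>\<close> exactly once.\<close>
    define H where "H = (if poly m s / \<pi> \<notin> nonunits V then m else m + [:\<pi>:])"
    have Hs: "poly H s / \<pi> \<notin> nonunits V"
    proof (cases "poly m s / \<pi> \<in> nonunits V")
      case True
      then have "poly m s / \<pi> + 1 \<notin> nonunits V"
        using one_notin notin_add by blast
      with True show ?thesis
        using pi_nonzero by (simp add: H_def add_divide_distrib)
    qed (simp add: H_def)
    have c: "[:\<pi>:] \<in> poly_over (K \<inter> nonunits V)"
      using piK ideal_zero K.zero_mem by (auto simp: poly_over_def coeff_pCons split: nat.splits)
    have Hm: "H - m * 1 \<in> poly_over (K \<inter> nonunits V)"
      using c KV.poly_over_ideal_0 by (auto simp: H_def)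
    have HA: "H \<in> poly_over (K \<inter> V)"
      using m c KV.poly_over_ideal_subset by (auto simp: H_def intro: KV.poly_over_add)
    have "degree (m + [:\<pi>:]) = degree m"
      using deg_m by (intro degree_add_eq_left) auto
    then have monic: "lead_coeff H = 1"
      using m deg_m by (auto simp: H_def coeff_pCons split: nat.splits)
    have H': "pderiv H = pderiv m"
      by (auto simp: H_def pderiv_add pderiv_pCons)
    have "poly H s = poly m s + poly (H - m * 1) s"
      by simp
    also have "\<dots> \<in> nonunits V"
      using m(3) ev[OF Hm s] by (rule ideal_add)
    finally obtain x where x: "x \<in> V" "poly H x = 0" "s - x \<in> nonunits V"
      using monic_root_mod[OF valuation_ring_axioms _ monic s] HA by (auto simp: poly_over_Int)
    \<comment> \<open>Here \<open>f = H\<close> and \<open>h = 1\<close>: \<open>m\<close> is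
      minimal at \<open>x\<close> as well, because \<open>x\<close> and \<open>s\<close> have the
      same residue class.\<close>
    have "unramified_subfield (adjoin K x)"
    proof (rule unramified_adjoin[OF K x(1) HA x(2) m(1) KV.poly_over_1 _ Hm])
      show "poly 1 x \<notin> nonunits V" using one_notin by simp
      fix g assume g: "g \<in> poly_over (K \<inter> V)" "poly g x \<in> nonunits V"
      then have "poly g s - poly g x \<in> nonunits V"
        using s x by (intro poly_cong_arg) (auto simp: poly_over_Int)
      with g have "poly g s \<in> nonunits V"
        using ideal_cong by blast
      with g div show "\<exists>q\<in>poly_over (K \<inter> V). g - m * q \<in> poly_over (K \<inter> nonunits V)"
        by blast
    qed
    then obtain L where L: "adjoin K x \<subseteq> L" "unramified_subfield L" "henselian V L"
      using henselian_extension by blast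
    have "K \<subseteq> L" "x \<in> L"
      using L K.adjoin_superset K.adjoin_generator by blast+
    with all L have sL: "s \<in> L" by blast
    interpret L: subfield_set L using L by (auto simp: unramified_subfield_def)
    have "(s - x) / \<pi> \<in> V"
      using discrete_nonunit[OF _ x(3)] L L.diff_mem[OF sL \<open>x \<in> L\<close>] zero_mem
      by (cases "s - x = 0") (auto simp: unramified_subfield_def)
    moreover obtain c where c: "c \<in> V" "poly H s - poly H x = (s - x) * (poly (pderiv H) x + (s - x) * c)"
      using taylor2[of H s x] HA s x by (auto simp: poly_over_Int)
    \<comment> \<open>\<open>H\<close> and \<open>m\<close> have the same derivative, whose
      coefficients all reduce to zero in the present case.\<close>
    moreover have "poly (pderiv H) x + (s - x) * c \<in> nonunits V"
      unfolding H' using ev[OF True x(1)] x c by (intro ideal_add ideal_mult2)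
    ultimately have "(s - x) / \<pi> * (poly (pderiv H) x + (s - x) * c) \<in> nonunits V"
      by (intro ideal_mult)
    with c x Hs show thesis by simp
  qed
qed

section \<open>Chevalley's existence theorem for valuation rings\<close>

inductive_set ideal_span :: "'a::field set \<Rightarrow> 'a set \<Rightarrow> 'a set" for P B where
  zero: "0 \<in> ideal_span P B"
| add: "s \<in> ideal_span P B \<Longrightarrow> p \<in> P \<Longrightarrow> b \<in> B \<Longrightarrow> s + p * b \<in> ideal_span P B"

lemma ideal_span_mono: "B \<subseteq> B' \<Longrightarrow> ideal_span P B \<subseteq> ideal_span P B'"
proof
  fix x assume "B \<subseteq> B'" "x \<in> ideal_span P B"
  from this(2,1) show "x \<in> ideal_span P B'"
    by induction (auto intro: ideal_span.intros)
qed

text \<open>A sum has finitely many terms, so it lives in a single member of the chain; this makes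
  properness of the extended ideal an inductive condition for Zorn's lemma.\<close>

lemma ideal_span_Union_chain:
  assumes "subset.chain S C" "C \<noteq> {}" "x \<in> ideal_span P (\<Union>C)"
  shows "\<exists>B\<in>C. x \<in> ideal_span P B"
  using assms(3)
proof induction
  case zero
  then show ?case using assms(2) ideal_span.zero by blast
next
  case (add s p b)
  then obtain B B' where B: "B \<in> C" "B' \<in> C" "s \<in> ideal_span P B" "b \<in> B'"
    by blast
  then have "B \<subseteq> B' \<or> B' \<subseteq> B"
    using assms(1) unfolding subset.chain_def by blast
  then obtain M where "M \<in> C" "B \<subseteq> M" "B' \<subseteq> M"
    using B by blast
  then show ?case
    using B add ideal_span_mono[of B M P] by (intro bexI[of _ M] ideal_span.add) auto
qed

context subdomain
begin

lemma ideal_span_add: "x \<in> ideal_span P A \<Longrightarrow> y \<in> ideal_span P A \<Longrightarrow> x + y \<in> ideal_span P A"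
proof (rotate_tac, induction y rule: ideal_span.induct)
  case (add s p b)
  then show ?case
    using ideal_span.add[of "x + s" P A p b] by (simp add: add.assoc)
qed simp

lemma ideal_span_mult: "x \<in> ideal_span P A \<Longrightarrow> a \<in> A \<Longrightarrow> a * x \<in> ideal_span P A"
proof (induction rule: ideal_span.induct)
  case (add s p b)
  then have "a * s + p * (a * b) \<in> ideal_span P A"
    by (intro ideal_span.add mult_mem)
  then show ?case by (simp add: algebra_simps)
qed (auto intro: ideal_span.intros)

lemma ideal_span_subset: "P \<subseteq> A \<Longrightarrow> ideal_span P A \<subseteq> A"
proof
  fix x assume "x \<in> ideal_span P A" "P \<subseteq> A"
  then show "x \<in> A" by induction (auto intro: ring_mem)
qed

lemma ideal_span_superset: "P \<subseteq> ideal_span P A"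
  using ideal_span.add[OF ideal_span.zero _ one_mem] by force

text \<open>The relation for \<open>inverse x\<close>, multiplied by a power of \<open>x\<close>,
  rewrites the top term of the relation for \<open>x\<close> in lower degrees. Scaling by
  \<open>1 - b 0\<close> is compensated by the constant term, so \<open>1 - b 0\<close> need not be
  inverted.\<close>

lemma chevalley_descent:
  assumes P: "P \<subseteq> A" "1 \<notin> ideal_span P A" and "x \<noteq> 0"
    and f: "f \<in> poly_over (ideal_span P A)" "poly f x = 1"
    and g: "g \<in> poly_over (ideal_span P A)" "poly g (inverse x) = 1" "degree g \<le> degree f"
  shows "\<exists>h\<in>poly_over (ideal_span P A). poly h x = 1 \<and> degree h < degree f"
proof -
  define n a b where "n = degree f" and "a = coeff f n" and "b = coeff g"
  define J where "J = ideal_span P A"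
  note add = ideal_span_add[of _ P, folded J_def] and mult = ideal_span_mult[of _ P, folded J_def]
  have JA: "J \<subseteq> A" using ideal_span_subset P J_def by blast
  have J: "coeff f i \<in> J" "b i \<in> J" for i
    using f g by (auto simp: poly_over_def J_def b_def)
  have zero: "0 \<in> J" by (auto simp: J_def intro: ideal_span.zero)
  have "n \<noteq> 0"
  proof
    assume "n = 0"
    then have "f = [:coeff f 0:]" by (metis degree_0_id n_def)
    then have "coeff f 0 = 1"
      using f(2) by (metis mult_zero_right add_0_right poly_0 poly_pCons)
    with J(1)[of 0] P show False by (simp add: J_def)
  qed
  \<comment> \<open>From \<open>1 = b 0 + (1 - b 0) * f(x)\<close>: in the top term
    \<open>a * x ^ n\<close> of \<open>f\<close>, the product \<open>(1 - b 0) * x ^ n\<close> is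
    replaced by the sum of the \<open>b j * x ^ (n - j)\<close>.\<close>
  define h where "h = [:b 0:] + smult (1 - b 0) (f - monom a n) + smult a (\<Sum>j=1..n. monom (b j) (n - j))"
  have "1 = (\<Sum>j\<le>n. b j * inverse x ^ j)"
    using g poly_altdef[of g "inverse x"] sum.mono_neutral_left[of "{..n}" "{..degree g}" "\<lambda>j. b j * inverse x ^ j"]
    by (auto simp: b_def n_def coeff_eq_0)
  also have "\<dots> = b 0 + (\<Sum>j=1..n. b j * inverse x ^ j)"
    by (simp add: atMost_atLeast0 sum.atLeast_Suc_atMost)
  finally have "1 - b 0 = (\<Sum>j=1..n. b j * inverse x ^ j)"
    by (metis add_diff_cancel_left')
  then have "x ^ n * (1 - b 0) = (\<Sum>j=1..n. b j * (inverse x ^ j * x ^ n))"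
    by (simp add: sum_distrib_left mult_ac)
  also have "\<dots> = (\<Sum>j=1..n. b j * x ^ (n - j))"
    using \<open>x \<noteq> 0\<close> by (intro sum.cong) (auto simp: power_diff field_simps)
  finally have "poly h x = b 0 + (1 - b 0) * (1 - a * x ^ n) + a * (x ^ n * (1 - b 0))"
    using f by (simp add: h_def poly_sum poly_monom)
  also have "\<dots> = 1" by (simp add: algebra_simps)
  finally have "poly h x = 1" .
  moreover have "degree h < n"
  proof (rule degree_lessI)
    show "\<forall>k\<ge>n. coeff h k = 0"
    proof (intro allI impI)
      fix k assume "n \<le> k"
      moreover have "coeff f k = 0" if "k > n"
        using that by (simp add: n_def coeff_eq_0)
      ultimately show "coeff h k = 0"
        using \<open>n \<noteq> 0\<close> by (auto simp: h_def coeff_sum coeff_pCons a_def intro!: sum.neutral split: nat.splits)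
    qed
  qed (use \<open>n \<noteq> 0\<close> in auto)
  moreover have "coeff h i \<in> J" for i
  proof -
    have sumJ: "sum F I \<in> J" if "\<And>i. i \<in> I \<Longrightarrow> F i \<in> J" for F :: "nat \<Rightarrow> 'a" and I
      using that by (induction I rule: infinite_finite_induct) (auto intro: zero add)
    have a: "a \<in> A" "1 - b 0 \<in> A"
      using J JA by (auto simp: a_def intro!: ring_mem)
    have 1: "coeff [:b 0:] i \<in> J"
      using J zero by (auto simp: coeff_pCons split: nat.splits)
    have 2: "coeff (f - monom a n) i \<in> J"
      using J zero by (auto simp: a_def)
    have 3: "coeff (\<Sum>j=1..n. monom (b j) (n - j)) i \<in> J"
      using J zero by (auto simp: coeff_sum intro!: sumJ)
    show ?thesis
      unfolding h_def coeff_add coeff_smult by (intro add mult 1 2 3 a)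
  qed
  ultimately show ?thesis
    by (auto simp: poly_over_def J_def n_def)
qed

lemma subdomain_polynomials: "subdomain {poly f x |f. f \<in> poly_over A}"
proof unfold_locales
  show "1 \<in> {poly f x |f. f \<in> poly_over A}"
    using poly_over_1 by (force intro: exI[of _ 1])
  fix y z assume "y \<in> {poly f x |f. f \<in> poly_over A}" "z \<in> {poly f x |f. f \<in> poly_over A}"
  then obtain f g where "f \<in> poly_over A" "g \<in> poly_over A" "y = poly f x" "z = poly g x"
    by blast
  then show "y - z \<in> {poly f x |f. f \<in> poly_over A}" "y * z \<in> {poly f x |f. f \<in> poly_over A}"
    using poly_over_diff[of f g] poly_over_mult[of f g] by (auto simp flip: poly_diff poly_mult)
qed

theorem valuation_ring_over_prime:
  assumes P: "P \<subseteq> A" "0 \<in> P" "1 \<notin> P" "\<And>x y. x \<in> P \<Longrightarrow> y \<in> P \<Longrightarrow> x + y \<in> P"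
    "\<And>a x. a \<in> A \<Longrightarrow> x \<in> P \<Longrightarrow> a * x \<in> P"
    "\<And>a b. a \<in> A \<Longrightarrow> b \<in> A \<Longrightarrow> a * b \<in> P \<Longrightarrow> a \<in> P \<or> b \<in> P"
  shows "\<exists>V. valuation_ring V \<and> A \<subseteq> V \<and> nonunits V \<inter> A = P"
proof -
  \<comment> \<open>Localizing at \<open>P\<close> first makes every element of \<open>A\<close>
    outside \<open>P\<close> a unit, so that the maximal ideal of the final ring meets
    \<open>A\<close> in exactly \<open>P\<close>.\<close>
  define A' where "A' = {a / b |a b. a \<in> A \<and> b \<in> A \<and> b \<notin> P}"
  have AA': "A \<subseteq> A'"
    unfolding A'_def using one_mem P(3) by force
  have A': "subdomain A'"
  proof unfold_locales
    show "1 \<in> A'" using AA' one_mem by blast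
    fix x y assume "x \<in> A'" "y \<in> A'"
    then obtain a b c d where *: "a \<in> A" "b \<in> A" "b \<notin> P" "c \<in> A" "d \<in> A" "d \<notin> P" "x = a / b" "y = c / d"
      unfolding A'_def by blast
    then have nz: "b \<noteq> 0" "d \<noteq> 0" and bd: "b * d \<notin> P" "b * d \<in> A"
      using P(2,6) mult_mem by blast+
    have "x - y = (a * d - c * b) / (b * d)" "x * y = (a * c) / (b * d)"
      using * nz by (auto simp: diff_frac_eq)
    moreover have "a * d - c * b \<in> A" "a * c \<in> A"
      using * by (auto intro: ring_mem)
    ultimately show "x - y \<in> A'" "x * y \<in> A'"
      unfolding A'_def using bd by blast+
  qed
  have span: "x \<in> {a / b |a b. a \<in> P \<and> b \<in> A \<and> b \<notin> P}" if "x \<in> ideal_span P A'" for x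
    using that
  proof induction
    case zero
    have "0 = 0 / (1 :: 'a)" by simp
    then show ?case using P(2,3) one_mem by blast
  next
    case (add s p b)
    then obtain c d e g where *: "c \<in> P" "d \<in> A" "d \<notin> P" "s = c / d" "e \<in> A" "g \<in> A" "g \<notin> P" "b = e / g"
      unfolding A'_def by blast
    then have nz: "d \<noteq> 0" "g \<noteq> 0" and dg: "d * g \<notin> P" "d * g \<in> A"
      using P(2,6) mult_mem by blast+
    have "s + p * b = (g * c + (d * e) * p) / (d * g)"
      unfolding *(4,8) using nz by (simp add: field_simps)
    moreover have "g * c + (d * e) * p \<in> P"
      using * add by (intro P(4,5) mult_mem)
    ultimately show ?case using dg by blast
  qed
  \<comment> \<open>Overrings in which the ideal extended from \<open>P\<close> is still proper; a
    maximal one turns out to be a valuation ring.\<close>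
  define S where "S = {B. subdomain B \<and> A' \<subseteq> B \<and> 1 \<notin> ideal_span P B}"
  have "\<exists>M\<in>S. \<forall>B\<in>S. M \<subseteq> B \<longrightarrow> B = M"
  proof (rule subset_Zorn_nonempty)
    have "1 \<notin> ideal_span P A'"
    proof
      assume "1 \<in> ideal_span P A'"
      then obtain a b where *: "1 = a / b" "a \<in> P" "b \<in> A" "b \<notin> P" using span by blast
      then have "b \<noteq> 0" using P(2) by blast
      with * have "a = b" by (simp add: field_simps)
      with * show False by simp
    qed
    then show "S \<noteq> {}" using A' by (auto simp: S_def)
    fix C assume C: "C \<noteq> {}" "subset.chain S C"
    have sub: "subdomain B" "A' \<subseteq> B" "1 \<notin> ideal_span P B" if "B \<in> C" for B
      using that C by (auto simp: S_def subset.chain_def)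
    have common: "\<exists>E\<in>C. x \<in> E \<and> y \<in> E" if "x \<in> \<Union>C" "y \<in> \<Union>C" for x y
      using that C unfolding subset.chain_def by blast
    have "subdomain (\<Union>C)"
    proof unfold_locales
      show "1 \<in> \<Union>C" using C sub by (auto simp: subdomain_def)
      show "x - y \<in> \<Union>C" "x * y \<in> \<Union>C" if "x \<in> \<Union>C" "y \<in> \<Union>C" for x y
        using common[OF that] sub unfolding subdomain_def by blast+
    qed
    moreover have "1 \<notin> ideal_span P (\<Union>C)"
      using ideal_span_Union_chain[OF C(2,1)] sub by blast
    ultimately show "\<Union>C \<in> S" using C(1) sub(2) unfolding S_def by blast
  qed
  then obtain M where M: "M \<in> S" "\<And>B. B \<in> S \<Longrightarrow> M \<subseteq> B \<Longrightarrow> B = M"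
    by blast
  interpret M: subdomain M using M by (simp add: S_def)
  have AM: "A' \<subseteq> M" "A \<subseteq> M" and one: "1 \<notin> ideal_span P M" using M AA' by (auto simp: S_def)
  then have PM: "P \<subseteq> M" using P(1) by blast
  \<comment> \<open>Adjoining an \<open>x\<close> outside the maximal \<open>M\<close> makes the
    extended ideal contain 1, which is a relation for \<open>x\<close> with coefficients in the
    ideal of \<open>M\<close>.\<close>
  have ex: "\<exists>f\<in>poly_over (ideal_span P M). poly f x = 1" if "x \<notin> M" for x
  proof -
    let ?B = "{poly f x |f. f \<in> poly_over M}"
    have sup: "M \<subseteq> ?B"
    proof
      fix c assume "c \<in> M"
      then have "[:c:] \<in> poly_over M" by (intro M.poly_over_mem)
      then show "c \<in> ?B" by (force intro: exI[of _ "[:c:]"])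
    qed
    have "[:0, 1:] \<in> poly_over M" by (intro M.poly_over_mem M.ring_mem)
    then have "x \<in> ?B" by (force intro: exI[of _ "[:0, 1:]"])
    with that M sup have "?B \<notin> S" by blast
    then have "1 \<in> ideal_span P ?B"
      using M.subdomain_polynomials sup AM by (auto simp: S_def)
    moreover have "y \<in> {poly f x |f. f \<in> poly_over (ideal_span P M)}" if "y \<in> ideal_span P ?B" for y
      using that
    proof induction
      case zero
      then show ?case
        by (auto simp: poly_over_def intro!: exI[of _ 0] ideal_span.zero)
    next
      case (add s p b)
      then obtain f g where f: "s = poly f x" "f \<in> poly_over (ideal_span P M)" and g: "b = poly g x" "g \<in> poly_over M"
        by blast
      have "f + smult p g \<in> poly_over (ideal_span P M)"
        using f g add by (auto simp: poly_over_def intro: ideal_span.add)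
      then show ?case
        using f g by (intro CollectI exI[of _ "f + smult p g"]) auto
    qed
    ultimately show ?thesis by force
  qed
  have "valuation_ring M"
  proof unfold_locales
    fix x
    show "x \<in> M \<or> inverse x \<in> M"
    proof (rule ccontr)
      assume *: "\<not> (x \<in> M \<or> inverse x \<in> M)"
      then have "x \<noteq> 0" using M.zero_mem by auto
      \<comment> \<open>Relations for \<open>x\<close> and for \<open>inverse x\<close> are
        minimized jointly by the sum of their degrees; the descent then lowers whichever degree is
        larger.\<close>
      define Q where "Q fg \<longleftrightarrow> fst fg \<in> poly_over (ideal_span P M) \<and> snd fg \<in> poly_over (ideal_span P M)
        \<and> poly (fst fg) x = 1 \<and> poly (snd fg) (inverse x) = 1" for fg
      obtain f\<^sub>0 g\<^sub>0 where "Q (f\<^sub>0, g\<^sub>0)"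
        using * ex[of x] ex[of "inverse x"] by (auto simp: Q_def)
      then obtain fg where fg: "Q fg"
        and least: "\<And>fg'. Q fg' \<Longrightarrow> degree (fst fg) + degree (snd fg) \<le> degree (fst fg') + degree (snd fg')"
        using ex_has_least_nat[of Q _ "\<lambda>fg. degree (fst fg) + degree (snd fg)"] by blast
      show False
      proof (cases "degree (snd fg) \<le> degree (fst fg)")
        case True
        then obtain h where "h \<in> poly_over (ideal_span P M)" "poly h x = 1" "degree h < degree (fst fg)"
          using M.chevalley_descent[OF PM one \<open>x \<noteq> 0\<close>] fg unfolding Q_def by blast
        with fg least[of "(h, snd fg)"] show False by (simp add: Q_def)
      next
        case False
        then have "degree (fst fg) \<le> degree (snd fg)" by simp
        then obtain h where "h \<in> poly_over (ideal_span P M)" "poly h (inverse x) = 1" "degree h < degree (snd fg)"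
          using M.chevalley_descent[OF PM one, of "inverse x" "snd fg" "fst fg"] fg \<open>x \<noteq> 0\<close> unfolding Q_def by auto
        with fg least[of "(fst fg, h)"] show False by (simp add: Q_def)
      qed
    qed
  qed
  moreover have "nonunits M \<inter> A = P"
  proof (intro equalityI subsetI)
    fix a assume a: "a \<in> nonunits M \<inter> A"
    show "a \<in> P"
    proof (rule ccontr)
      assume "a \<notin> P"
      then have "1 / a \<in> A'" using a one_mem by (auto simp: A'_def)
      then have "inverse a \<in> M" using AM by (auto simp: divide_inverse)
      with a \<open>a \<notin> P\<close> P(2) show False by (auto simp: nonunits_def)
    qed
  next
    fix p assume p: "p \<in> P"
    have "inverse p \<notin> M" if "p \<noteq> 0"
    proof
      assume "inverse p \<in> M"
      then have "inverse p * p \<in> ideal_span P M"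
        using p M.ideal_span_superset by (intro M.ideal_span_mult) auto
      with one that show False by simp
    qed
    then show "p \<in> nonunits M \<inter> A"
      using p P(1) PM by (auto simp: nonunits_def)
  qed
  ultimately show ?thesis
    using AM by blast
qed

end

section \<open>Dedekind domains\<close>

lemma subr_simps [simp]:
  "carrier (subr S) = S" "monoid.mult (subr S) x y = x * y" "one (subr S) = 1"
  "ring.zero (subr S) = 0" "add (subr S) x y = x + y"
  by (auto simp: ring_of_type_algebra_def)

lemma ambient_simps [simp]:
  "carrier ambient = UNIV" "monoid.mult ambient x y = x * y" "one ambient = 1"
  "ring.zero ambient = 0" "add ambient x y = x + y"
  by (auto simp: ring_of_type_algebra_def)

lemma subdomain_if_cring:
  assumes "cring (subr S)" shows "subdomain S"
proof -
  interpret cring "subr S" by fact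
  show ?thesis
  proof unfold_locales
    show "x * y \<in> S" if "x \<in> S" "y \<in> S" for x y
      using m_closed[of x y] that by auto
    show "1 \<in> S" using one_closed by simp
    fix x y assume "x \<in> S" "y \<in> S"
    then obtain z where "z \<in> S" "y + z = 0"
      using a_inv_closed[of y] r_neg[of y] by auto
    moreover have "x - y = x + z"
      using \<open>y + z = 0\<close> by (simp add: add_eq_0_iff2)
    ultimately show "x - y \<in> S"
      using a_closed[of x z] \<open>x \<in> S\<close> by (metis subr_simps(1,5))
  qed
qed

lemma ideal_subrD:
  assumes "ideal I (subr S)"
  shows "I \<subseteq> S" "0 \<in> I" "x \<in> I \<Longrightarrow> y \<in> I \<Longrightarrow> x + y \<in> I" "a \<in> S \<Longrightarrow> x \<in> I \<Longrightarrow> a * x \<in> I"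
proof -
  interpret ideal I "subr S" by fact
  show "I \<subseteq> S" using Icarr by auto
  show "0 \<in> I" using additive_subgroup.zero_closed[OF is_additive_subgroup] by simp
  show "x + y \<in> I" if "x \<in> I" "y \<in> I"
    using additive_subgroup.a_closed[OF is_additive_subgroup that] by simp
  show "a * x \<in> I" if "a \<in> S" "x \<in> I"
    using I_l_closed[of x a] that by simp
qed

lemma ideal_subrI:
  assumes "cring (subr S)" "I \<subseteq> S" "0 \<in> I"
    and add: "\<And>x y. x \<in> I \<Longrightarrow> y \<in> I \<Longrightarrow> x + y \<in> I"
    and mult: "\<And>a x. a \<in> S \<Longrightarrow> x \<in> I \<Longrightarrow> a * x \<in> I"
  shows "ideal I (subr S)"
proof (rule idealI)
  interpret cring "subr S" by fact
  interpret S: subdomain S by (rule subdomain_if_cring) fact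
  show "ring (subr S)" by (rule ring_axioms)
  show "subgroup I (add_monoid (subr S))"
  proof (rule add.subgroupI)
    show "\<ominus>\<^bsub>subr S\<^esub> x \<in> I" if "x \<in> I" for x
    proof -
      have "- x \<in> I"
        using mult[of "- 1" x] that S.uminus_mem S.one_mem by auto
      moreover have "\<ominus>\<^bsub>subr S\<^esub> x = - x"
        using that assms(2) \<open>- x \<in> I\<close> by (intro minus_equality) auto
      ultimately show ?thesis
        by simp
    qed
  qed (use assms in auto)
  show "x \<otimes>\<^bsub>subr S\<^esub> a \<in> I" "a \<otimes>\<^bsub>subr S\<^esub> x \<in> I" if "a \<in> I" "x \<in> carrier (subr S)" for a x
    using mult[of x a] that by (auto simp: mult.commute)
qed

lemma primeideal_subrD:
  assumes "primeideal I (subr S)"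
  shows "1 \<notin> I" "a \<in> S \<Longrightarrow> b \<in> S \<Longrightarrow> a * b \<in> I \<Longrightarrow> a \<in> I \<or> b \<in> I"
    "ideal I (subr S)" "cring (subr S)"
proof -
  interpret primeideal I "subr S" by fact
  show "a \<in> S \<Longrightarrow> b \<in> S \<Longrightarrow> a * b \<in> I \<Longrightarrow> a \<in> I \<or> b \<in> I"
    using I_prime[of a b] by auto
  show "ideal I (subr S)" "cring (subr S)"
    by (rule ideal_axioms, rule cring_axioms)
  show "1 \<notin> I"
    using I_notcarr I_l_closed[of 1] Icarr by force
qed

locale dedekind =
  fixes R :: "'a::field set"
  assumes dedekind: "dedekind_domain R"
begin

lemma noetherian: "noetherian_domain (subr R)"
  using dedekind by (simp add: dedekind_domain_def)

lemma cring: "cring (subr R)"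
  using noetherian by (simp add: noetherian_domain_def domain_def)

sublocale subdomain R
  by (rule subdomain_if_cring) (rule cring)

abbreviation K :: "'a set" where "K \<equiv> fraction_field R"

lemma fraction_fieldI: "a \<in> R \<Longrightarrow> b \<in> R \<Longrightarrow> b \<noteq> 0 \<Longrightarrow> a / b \<in> K"
  by (auto simp: fraction_field_def)

lemma R_subset: "R \<subseteq> K"
  using fraction_fieldI[OF _ one_mem] by force

lemma subfield_set_fraction_field: "subfield_set K"
proof unfold_locales
  show "1 \<in> K" using R_subset one_mem by blast
  fix x y assume "x \<in> K" "y \<in> K"
  then obtain a b c d where *: "a \<in> R" "b \<in> R" "b \<noteq> 0" "c \<in> R" "d \<in> R" "d \<noteq> 0" "x = a / b" "y = c / d"
    by (auto simp: fraction_field_def)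
  have "(a * d - c * b) / (b * d) \<in> K" "(a * c) / (b * d) \<in> K"
    using * by (auto intro!: fraction_fieldI ring_mem)
  then show "x - y \<in> K" "x * y \<in> K"
    using * by (simp_all add: diff_frac_eq)
next
  fix x assume "x \<in> K"
  then obtain a b where "a \<in> R" "b \<in> R" "b \<noteq> 0" "x = a / b"
    by (auto simp: fraction_field_def)
  then show "inverse x \<in> K"
    using fraction_fieldI[of b a] zero_mem R_subset by (cases "a = 0") auto
qed

section \<open>Noetherian arguments and inverses of prime ideals\<close>

lemma maximal_ideal_exists:
  assumes "S \<noteq> {}" "\<And>I. I \<in> S \<Longrightarrow> ideal I (subr R)"
  shows "\<exists>M\<in>S. \<forall>I\<in>S. M \<subseteq> I \<longrightarrow> I = M"
proof (rule subset_Zorn_nonempty)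
  interpret noetherian_domain "subr R" by (rule noetherian)
  fix C assume C: "C \<noteq> {}" "subset.chain S C"
  then have "subset.chain {I. ideal I (subr R)} C"
    using assms(2) by (auto simp: subset.chain_def)
  then have "\<Union>C \<in> C" using C ideal_chain_is_trivial by blast
  then show "\<Union>C \<in> S" using C by (auto simp: subset.chain_def)
qed fact

lemma integrally_closed:
  assumes "c \<in> K" "f \<in> poly_over R" "lead_coeff f = 1" "poly f c = 0"
  shows "c \<in> R"
proof -
  have "c \<in> integral_closure R K"
    using assms by (auto simp: integral_closure_def)
  then show ?thesis
    using dedekind by (simp add: dedekind_domain_def)
qed

lemma prime_maximal:
  assumes "primeideal P (subr R)" "P \<noteq> {0}" "ideal I (subr R)" "P \<subseteq> I" "1 \<notin> I"
  shows "I = P"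
proof -
  have "maximalideal P (subr R)"
    using dedekind assms by (auto simp: dedekind_domain_def)
  then show ?thesis
    using maximalideal.I_maximal[of P "subr R" I] assms ideal_subrD(1)[of I R] one_mem by auto
qed

lemma prime_inverse:
  assumes "primeideal P (subr R)" "P \<noteq> {0}" "a \<in> R" "a \<notin> P"
  obtains b where "b \<in> R" "a * b - 1 \<in> P"
proof -
  note P = primeideal_subrD[OF assms(1)] and I = ideal_subrD[OF primeideal_subrD(3)[OF assms(1)]]
  define J where "J = {x + a * b |x b. x \<in> P \<and> b \<in> R}"
  have J: "ideal J (subr R)"
  proof (rule ideal_subrI[OF P(4)])
    show "J \<subseteq> R" using assms I by (auto simp: J_def intro!: ring_mem)
    show "0 \<in> J" using I(2) zero_mem by (force simp: J_def)
    fix x y assume "x \<in> J" "y \<in> J"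
    then obtain p q b c where "p \<in> P" "q \<in> P" "b \<in> R" "c \<in> R" "x = p + a * b" "y = q + a * c"
      by (auto simp: J_def)
    then have "x + y = (p + q) + a * (b + c)" "p + q \<in> P" "b + c \<in> R"
      using I(3) add_mem by (auto simp: algebra_simps)
    then show "x + y \<in> J" by (auto simp: J_def)
  next
    fix c x assume "c \<in> R" "x \<in> J"
    then obtain p b where "p \<in> P" "b \<in> R" "x = p + a * b"
      by (auto simp: J_def)
    then have "c * x = c * p + a * (c * b)" "c * p \<in> P" "c * b \<in> R"
      using I(4) mult_mem \<open>c \<in> R\<close> by (auto simp: algebra_simps)
    then show "c * x \<in> J" by (auto simp: J_def)
  qed
  have PJ: "P \<subseteq> J" using zero_mem by (force simp: J_def)
  have "a \<in> J" using one_mem I(2) by (force simp: J_def)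
  then have "J \<noteq> P" using assms by blast
  then have "1 \<in> J" using prime_maximal[OF assms(1,2) J PJ] by blast
  then obtain p b where "p \<in> P" "b \<in> R" "1 = p + a * b" by (auto simp: J_def)
  moreover from this have "a * b - 1 = (- 1) * p" by (simp add: algebra_simps)
  moreover have "(- 1) * p \<in> P" using I(4) uminus_mem one_mem \<open>p \<in> P\<close> by blast
  ultimately show thesis using that by metis
qed

text \<open>If all \<open>c ^ n * s\<close> stayed in \<open>R\<close>, the ideals generated by
  \<open>s, c * s, ..., c ^ n * s\<close> would form a stationary chain; a repetition expresses
  \<open>c ^ Suc N\<close> through lower powers and makes \<open>c\<close> integral over
  \<open>R\<close>.\<close>

lemma not_almost_integral:
  assumes c: "c \<in> K" "c \<notin> R" and s: "s \<in> R" "s \<noteq> 0"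
  shows "\<exists>n. c ^ n * s \<notin> R"
proof (rule ccontr)
  assume *: "\<nexists>n. c ^ n * s \<notin> R"
  define I where "I n = {poly f c * s |f. f \<in> poly_over R \<and> degree f \<le> n}" for n :: nat
  have I: "ideal (I n) (subr R)" for n
  proof (rule ideal_subrI[OF cring])
    have "poly f c * s \<in> R" if "f \<in> poly_over R" for f
      unfolding poly_altdef sum_distrib_right mult.assoc
      using that * by (intro sum_mem mult_mem[of "coeff f _"]) (auto simp: poly_over_def)
    then show "I n \<subseteq> R" by (auto simp: I_def)
    show "0 \<in> I n" by (force simp: I_def intro: exI[of _ 0] poly_over_0)
    fix x y assume "x \<in> I n" "y \<in> I n"
    then obtain f g where "f \<in> poly_over R" "g \<in> poly_over R" "degree f \<le> n" "degree g \<le> n"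
      "x = poly f c * s" "y = poly g c * s" by (auto simp: I_def)
    then show "x + y \<in> I n"
      unfolding I_def by (intro CollectI exI[of _ "f + g"]) (auto simp: distrib_right intro: poly_over_add degree_add_le)
  next
    fix a x assume "a \<in> R" "x \<in> I n"
    then obtain f where "f \<in> poly_over R" "degree f \<le> n" "x = poly f c * s" by (auto simp: I_def)
    with \<open>a \<in> R\<close> show "a * x \<in> I n"
      unfolding I_def using degree_smult_le[of a f]
      by (intro CollectI exI[of _ "smult a f"]) (auto simp: algebra_simps intro: poly_over_smult)
  qed
  have "\<exists>M\<in>range I. \<forall>J\<in>range I. M \<subseteq> J \<longrightarrow> J = M"
    by (rule maximal_ideal_exists) (use I in auto)
  then obtain N where N: "\<And>n. I N \<subseteq> I n \<Longrightarrow> I n = I N"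
    by auto
  have "I N \<subseteq> I (Suc N)" by (force simp: I_def)
  then have "I (Suc N) = I N" by (rule N)
  moreover have "c ^ Suc N * s \<in> I (Suc N)"
    unfolding I_def
    by (intro CollectI exI[of _ "monom 1 (Suc N)"] conjI poly_over_monom one_mem degree_monom_le) (simp add: poly_monom)
  ultimately obtain f where f: "f \<in> poly_over R" "degree f \<le> N" "c ^ Suc N * s = poly f c * s"
    unfolding I_def by auto
  define g where "g = monom 1 (Suc N) - f"
  have "coeff g (Suc N) = 1" using f(2) by (simp add: g_def coeff_eq_0)
  moreover have "degree g \<le> Suc N"
    unfolding g_def using f(2) by (intro degree_diff_le degree_monom_le) auto
  ultimately have "lead_coeff g = 1" by (metis le_antisym le_degree zero_neq_one)
  moreover have "poly g c = 0" using f(3) s by (simp add: g_def poly_monom)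
  moreover have "g \<in> poly_over R" unfolding g_def using f by (intro poly_over_diff poly_over_monom one_mem)
  ultimately show False using integrally_closed c by blast
qed

text \<open>
  The ideal quotients \<open>(a : b) \<subseteq> P\<close> with \<open>a \<in> P\<close> fixed have a maximal member, which is prime, hence
  equal to \<open>P\<close>; then \<open>c = b / a\<close> is an element of the inverse of \<open>P\<close> outside \<open>R\<close>.
\<close>

lemma prime_inverse_element:
  assumes "primeideal P (subr R)" "P \<noteq> {0}"
  obtains c where "c \<in> K" "c \<notin> R" "\<And>x. x \<in> P \<Longrightarrow> c * x \<in> R"
proof -
  note P = primeideal_subrD[OF assms(1)] and I = ideal_subrD[OF primeideal_subrD(3)[OF assms(1)]]
  obtain a where a: "a \<in> P" "a \<noteq> 0" using assms(2) I(2) by blast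
  then have aR: "a \<in> R" using I(1) by blast
  define Q where "Q b = {r \<in> R. \<exists>t\<in>R. r * b = a * t}" for b
  have Q: "ideal (Q b) (subr R)" if "b \<in> R" for b
  proof (rule ideal_subrI[OF cring])
    show "Q b \<subseteq> R" "0 \<in> Q b" using zero_mem by (auto simp: Q_def)
    fix x y assume "x \<in> Q b" "y \<in> Q b"
    then obtain t u where "x \<in> R" "y \<in> R" "t \<in> R" "u \<in> R" "x * b = a * t" "y * b = a * u" by (auto simp: Q_def)
    then show "x + y \<in> Q b" by (auto simp: Q_def distrib_right intro!: add_mem bexI[of _ "t + u"]) (simp add: distrib_left)
  next
    fix c x assume "c \<in> R" "x \<in> Q b"
    then obtain t where "x \<in> R" "t \<in> R" "x * b = a * t" by (auto simp: Q_def)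
    with \<open>c \<in> R\<close> show "c * x \<in> Q b"
      unfolding Q_def by (intro CollectI conjI bexI[of _ "c * t"] mult_mem) (simp_all add: mult.assoc mult.left_commute)
  qed
  define S where "S = {Q b |b. b \<in> R \<and> Q b \<subseteq> P}"
  \<comment> \<open>\<open>Q b\<close> is the ideal quotient \<open>(a : b)\<close>, and
    \<open>Q 1\<close> is the principal ideal of \<open>a\<close>, so the family is
    nonempty.\<close>
  have "Q 1 \<subseteq> P" using a I(4) by (auto simp: Q_def) (metis mult.commute)
  then have "S \<noteq> {}" using one_mem by (auto simp: S_def)
  moreover have "ideal I (subr R)" if "I \<in> S" for I
    using that Q by (auto simp: S_def)
  ultimately obtain M where M: "M \<in> S" "\<And>I. I \<in> S \<Longrightarrow> M \<subseteq> I \<Longrightarrow> I = M"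
    using maximal_ideal_exists[of S] by metis
  then obtain b where b: "b \<in> R" "M = Q b" "Q b \<subseteq> P" by (auto simp: S_def)
  have mono: "Q b \<subseteq> Q (s * b)" if "s \<in> R" for s
    using that by (auto simp: Q_def) (metis mult.commute mult.left_commute mult_mem)
  \<comment> \<open>Multiplying \<open>b\<close> by an element outside the prime \<open>P\<close>
    can only enlarge the quotient, and keeps it inside \<open>P\<close>; maximality forces
    equality.\<close>
  have key: "Q (s * b) = Q b" if "s \<in> R" "s \<notin> P" for s
  proof -
    have "r \<in> P" if "r \<in> Q (s * b)" for r
    proof -
      have "r * s \<in> Q b" using that \<open>s \<in> R\<close> by (auto simp: Q_def mult_ac intro: mult_mem)
      then show ?thesis using b P(2)[of r s] that \<open>s \<in> R\<close> \<open>s \<notin> P\<close> by (auto simp: Q_def)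
    qed
    then have "Q (s * b) \<in> S" using that b mult_mem by (auto simp: S_def)
    then show ?thesis using M mono that b by blast
  qed
  have "primeideal (Q b) (subr R)"
  proof (rule primeidealI[OF Q[OF b(1)] cring])
    show "carrier (subr R) \<noteq> Q b" using b P(1) one_mem by auto
    fix x y assume "x \<in> carrier (subr R)" "y \<in> carrier (subr R)" "x \<otimes>\<^bsub>subr R\<^esub> y \<in> Q b"
    then have xy: "x \<in> R" "y \<in> R" "x * y \<in> Q b" by auto
    show "x \<in> Q b \<or> y \<in> Q b"
    proof (rule ccontr)
      assume neg: "\<not> (x \<in> Q b \<or> y \<in> Q b)"
      have "x \<in> Q (y * b)" using xy by (auto simp: Q_def mult_ac)
      then have "Q (y * b) \<noteq> Q b" using neg by auto
      \<comment> \<open>The quotient for \<open>y * b\<close> is strictly larger, so it must leave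
        \<open>P\<close>; an element \<open>s\<close> of it outside \<open>P\<close> transfers the
        membership of \<open>y\<close> back to \<open>Q b\<close>.\<close>
      then have "Q (y * b) \<notin> S" using M mono xy b by blast
      then have "\<not> Q (y * b) \<subseteq> P" using mult_mem[OF xy(2) b(1)] unfolding S_def by blast
      then obtain s where s: "s \<in> Q (y * b)" "s \<notin> P" by blast
      then have "y \<in> Q (s * b)" using xy by (auto simp: Q_def mult_ac)
      then have "y \<in> Q b" using key[of s] s by (auto simp: Q_def)
      with neg show False by simp
    qed
  qed
  moreover have "a \<in> Q b" using aR b by (auto simp: Q_def)
  ultimately have "Q b = P"
    using prime_maximal[of "Q b" P] P b a by auto
  show thesis
  proof (rule that[of "b / a"])
    show "b / a \<in> K" using b aR a by (intro fraction_fieldI)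
    show "b / a \<notin> R"
    proof
      assume "b / a \<in> R"
      then have "1 \<in> Q b" using a one_mem by (auto simp: Q_def intro!: bexI[of _ "b / a"])
      with \<open>Q b = P\<close> P(1) show False by simp
    qed
    fix x assume "x \<in> P"
    then obtain t where "t \<in> R" "x * b = a * t" using \<open>Q b = P\<close> by (auto simp: Q_def)
    then have "b / a * x = t" using a by (simp add: field_simps)
    with \<open>t \<in> R\<close> show "b / a * x \<in> R" by simp
  qed
qed

text \<open>Multiplication by \<open>c\<close> lowers the order at \<open>P\<close>: it maps
  \<open>P\<close> into \<open>R\<close>, and since \<open>c\<close> is not almost integral, every
  nonzero \<open>s\<close> leaves \<open>P\<close> after finitely many steps, at a stage where it is
  still in \<open>R\<close>. The last stage before leaving yields \<open>\<pi>\<close>. So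
  \<open>c\<close> acts as the inverse of a uniformizer without passing to the localization.\<close>

lemma prime_uniformizer:
  assumes "primeideal P (subr R)" "P \<noteq> {0}"
  obtains c \<pi> where "\<pi> \<in> P" "c * \<pi> \<in> R" "c * \<pi> \<notin> P" "\<And>x. x \<in> P \<Longrightarrow> c * x \<in> R"
    "\<And>s. s \<in> R \<Longrightarrow> s \<noteq> 0 \<Longrightarrow> \<exists>n. c ^ n * s \<in> R \<and> c ^ n * s \<notin> P"
proof -
  note P = primeideal_subrD[OF assms(1)] and I = ideal_subrD[OF primeideal_subrD(3)[OF assms(1)]]
  obtain c where c: "c \<in> K" "c \<notin> R" "\<And>x. x \<in> P \<Longrightarrow> c * x \<in> R"
    using prime_inverse_element[OF assms] by blast
  have reach: "\<exists>n. c ^ n * s \<in> R \<and> c ^ n * s \<notin> P" if s: "s \<in> R" "s \<noteq> 0" for s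
  proof (rule ccontr)
    assume *: "\<nexists>n. c ^ n * s \<in> R \<and> c ^ n * s \<notin> P"
    have "c ^ n * s \<in> R" for n
    proof (induction n)
      case (Suc n)
      then have "c * (c ^ n * s) \<in> R" using * c(3) by blast
      then show ?case by (simp add: mult.assoc)
    qed (use s in auto)
    with not_almost_integral[OF c(1,2) s] show False by blast
  qed
  obtain a where a: "a \<in> P" "a \<noteq> 0" using assms(2) I(2) by blast
  obtain n where n: "c ^ n * a \<in> R" "c ^ n * a \<notin> P" using reach[of a] a I(1) by blast
  have "\<exists>\<pi>\<in>P. c * \<pi> \<in> R \<and> c * \<pi> \<notin> P"
  proof (rule ccontr)
    assume *: "\<not> (\<exists>\<pi>\<in>P. c * \<pi> \<in> R \<and> c * \<pi> \<notin> P)"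
    have "c ^ k * a \<in> P" for k
    proof (induction k)
      case (Suc k)
      then have "c * (c ^ k * a) \<in> P" using * c(3) by blast
      then show ?case by (simp add: mult.assoc)
    qed (use a in auto)
    with n show False by blast
  qed
  with reach c(3) that show thesis by blast
qed

text \<open>Noetherian induction. An ideal maximal among the nonzero ideals contained in infinitely
  many primes is not prime, since nonzero primes are maximal; so it contains a product
  \<open>x * y\<close> with neither factor, and every prime over it lies over one of the two larger
  ideals obtained by adding \<open>x\<close> or \<open>y\<close>.\<close>

lemma finite_primes_containing:
  assumes "r \<in> R" "r \<noteq> 0"
  shows "finite {p \<in> primes_of R. r \<in> p}"
proof -
  define bad where "bad = {I. ideal I (subr R) \<and> I \<noteq> {0} \<and> infinite {p \<in> primes_of R. I \<subseteq> p}}"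
  have "bad = {}"
  proof (rule ccontr)
    assume "bad \<noteq> {}"
    then obtain M where M: "M \<in> bad" "\<And>I. I \<in> bad \<Longrightarrow> M \<subseteq> I \<Longrightarrow> I = M"
      using maximal_ideal_exists[of bad] unfolding bad_def by blast
    then have Mi: "ideal M (subr R)" "M \<noteq> {0}" "infinite {p \<in> primes_of R. M \<subseteq> p}" by (auto simp: bad_def)
    note I = ideal_subrD[OF Mi(1)]
    have "\<not> primeideal M (subr R)"
    proof
      assume pr: "primeideal M (subr R)"
      have "{p \<in> primes_of R. M \<subseteq> p} \<subseteq> {M}"
        using prime_maximal[OF pr Mi(2)] primeideal_subrD(1,3) unfolding primes_of_def by blast
      with Mi(3) show False using finite_subset by blast
    qed
    moreover have "R \<noteq> M"
    proof
      assume "R = M"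
      then have "{p \<in> primes_of R. M \<subseteq> p} = {}"
        using one_mem primeideal_subrD(1) by (auto simp: primes_of_def)
      with Mi(3) show False by (metis finite.emptyI)
    qed
    ultimately obtain x y where xy: "x \<in> R" "y \<in> R" "x * y \<in> M" "x \<notin> M" "y \<notin> M"
      using primeidealI[OF Mi(1) cring] by auto
    define N where "N z = {m + z * b |m b. m \<in> M \<and> b \<in> R}" for z
    have N: "ideal (N z) (subr R)" if "z \<in> R" for z
    proof (rule ideal_subrI[OF cring])
      show "N z \<subseteq> R" using that I by (auto simp: N_def intro!: ring_mem)
      show "0 \<in> N z" using I(2) zero_mem by (force simp: N_def)
      fix u v assume "u \<in> N z" "v \<in> N z"
      then obtain p q b c where "p \<in> M" "q \<in> M" "b \<in> R" "c \<in> R" "u = p + z * b" "v = q + z * c"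
        by (auto simp: N_def)
      then have "u + v = (p + q) + z * (b + c)" "p + q \<in> M" "b + c \<in> R"
        using I(3) add_mem by (auto simp: algebra_simps)
      then show "u + v \<in> N z" by (auto simp: N_def)
    next
      fix c u assume "c \<in> R" "u \<in> N z"
      then obtain p b where "p \<in> M" "b \<in> R" "u = p + z * b"
        by (auto simp: N_def)
      then have "c * u = c * p + z * (c * b)" "c * p \<in> M" "c * b \<in> R"
        using I(4) mult_mem \<open>c \<in> R\<close> by (auto simp: algebra_simps)
      then show "c * u \<in> N z" by (auto simp: N_def)
    qed
    have sup: "M \<subseteq> N z" "z \<in> N z" for z
      using zero_mem one_mem I(2) by (force simp: N_def)+
    have fin: "finite {p \<in> primes_of R. N z \<subseteq> p}" if "z \<in> R" "z \<notin> M" for z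
    proof (rule ccontr)
      assume "\<not> ?thesis"
      then have "N z \<in> bad" using N[OF that(1)] sup[of z] that I(2) by (auto simp: bad_def)
      then show False using M sup[of z] that by blast
    qed
    have "{p \<in> primes_of R. M \<subseteq> p} \<subseteq> {p \<in> primes_of R. N x \<subseteq> p} \<union> {p \<in> primes_of R. N y \<subseteq> p}"
    proof
      fix p assume p: "p \<in> {p \<in> primes_of R. M \<subseteq> p}"
      then have pr: "primeideal p (subr R)" by (simp add: primes_of_def)
      have Np: "N z \<subseteq> p" if "z \<in> p" for z
        using p that ideal_subrD[OF primeideal_subrD(3)[OF pr]] by (auto simp: N_def) (metis mult.commute subsetD)
      have "x \<in> p \<or> y \<in> p" using p xy primeideal_subrD(2)[OF pr] by blast
      then show "p \<in> {p \<in> primes_of R. N x \<subseteq> p} \<union> {p \<in> primes_of R. N y \<subseteq> p}"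
        using Np p by blast
    qed
    with fin[of x] fin[of y] xy Mi(3) show False
      by (meson finite_UnI finite_subset)
  qed
  define I where "I = {r * a |a. a \<in> R}"
  have "ideal I (subr R)"
  proof (rule ideal_subrI[OF cring])
    show "I \<subseteq> R" "0 \<in> I" using assms zero_mem by (auto simp: I_def intro: mult_mem)
    show "x + y \<in> I" if "x \<in> I" "y \<in> I" for x y
      using that add_mem by (auto simp: I_def simp flip: distrib_left)
    show "a * x \<in> I" if "a \<in> R" "x \<in> I" for a x
      using that mult_mem by (auto simp: I_def mult.left_commute)
  qed
  moreover have "r \<in> I" using one_mem by (force simp: I_def)
  ultimately have "finite {p \<in> primes_of R. I \<subseteq> p}"
    using \<open>bad = {}\<close> assms by (auto simp: bad_def)
  moreover have "I \<subseteq> p" if "p \<in> primes_of R" "r \<in> p" for p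
  proof -
    have "ideal p (subr R)" using that primeideal_subrD(3) by (auto simp: primes_of_def)
    from ideal_subrD(4)[OF this _ that(2)] show ?thesis
      by (auto simp: I_def mult.commute)
  qed
  then have "{p \<in> primes_of R. r \<in> p} \<subseteq> {p \<in> primes_of R. I \<subseteq> p}"
    by blast
  ultimately show ?thesis by (meson finite_subset)
qed

end

section \<open>Unramifiedness criterion\<close>

context dedekind
begin

section \<open>Algebraic elements and valuation rings over a prime\<close>

lemma clear_fractions:
  assumes "f \<in> poly_over K"
  shows "\<exists>d\<in>R. d \<noteq> 0 \<and> smult d f \<in> poly_over R"
  using assms
proof (induction f rule: pCons_induct)
  case 0
  then show ?case using one_mem poly_over_0 by (intro bexI[of _ 1]) auto
next
  case (pCons a f)
  have "f \<in> poly_over K" "a \<in> K"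
    using pCons.prems by (auto simp: poly_over_def coeff_pCons split: nat.splits)
  then obtain d b c where *: "d \<in> R" "d \<noteq> 0" "smult d f \<in> poly_over R" "b \<in> R" "c \<in> R" "c \<noteq> 0" "a = b / c"
    using pCons.IH by (auto simp: fraction_field_def)
  then have "smult (d * c) (pCons a f) = pCons (d * b) (smult c (smult d f))"
    by (simp add: mult.commute)
  moreover have "pCons (d * b) (smult c (smult d f)) \<in> poly_over R"
    by (intro poly_over_pCons poly_over_smult mult_mem *(1,3,4,5))
  ultimately show ?case
    using * by (intro bexI[of _ "d * c"] mult_mem) auto
qed

text \<open>A relation of least degree has nonzero constant term, so \<open>a = - x * g(x)\<close>
  is a nonzero element of \<open>R\<close> divisible by \<open>x\<close>. This transports statements
  about \<open>R\<close> to all algebraic elements.\<close>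

lemma algebraic_relation:
  assumes "algebraic_over K x" "x \<noteq> 0"
  obtains a g where "a \<in> R" "a \<noteq> 0" "g \<in> poly_over R" "poly (pCons a g) x = 0"
proof -
  define Q where "Q f \<longleftrightarrow> f \<in> poly_over R \<and> f \<noteq> 0 \<and> poly f x = 0" for f
  obtain f\<^sub>0 where "f\<^sub>0 \<in> poly_over K" "f\<^sub>0 \<noteq> 0" "poly f\<^sub>0 x = 0"
    using assms(1) by (auto simp: algebraic_over_def)
  with clear_fractions[of f\<^sub>0] have "\<exists>f. Q f"
    unfolding Q_def by (metis mult_zero_right poly_smult smult_eq_0_iff)
  then obtain f where f: "Q f" and least: "\<And>g. Q g \<Longrightarrow> degree f \<le> degree g"
    using ex_has_least_nat[of Q _ degree] by blast
  obtain a g where fg: "f = pCons a g" by (cases f)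
  have g: "g \<in> poly_over R" "a \<in> R"
    using f by (auto simp: Q_def fg poly_over_def coeff_pCons split: nat.splits)
  have "a \<noteq> 0"
  proof
    assume "a = 0"
    then have "Q g" using f g assms(2) by (auto simp: Q_def fg)
    moreover have "g \<noteq> 0" using f \<open>a = 0\<close> by (auto simp: Q_def fg)
    ultimately show False using least[of g] by (simp add: fg)
  qed
  then show thesis using that[of a g] g f by (auto simp: Q_def fg)
qed

text \<open>\<open>r\<close> is the product of the constant and the leading coefficient of a
  relation for \<open>x\<close>: a unit leading coefficient makes \<open>x\<close> integral, a unit
  constant coefficient makes it invertible.\<close>

lemma algebraic_unit:
  assumes "algebraic_over K x" "x \<noteq> 0"
  obtains r where "r \<in> R" "r \<noteq> 0" "\<And>V. valuation_ring V \<Longrightarrow> R \<subseteq> V \<Longrightarrow> r \<notin> nonunits V \<Longrightarrow> x \<in> V \<and> x \<notin> nonunits V"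
proof -
  obtain a g where ag: "a \<in> R" "a \<noteq> 0" "g \<in> poly_over R" "poly (pCons a g) x = 0"
    using algebraic_relation[OF assms] by blast
  define f where "f = pCons a g"
  have f: "f \<in> poly_over R" using ag by (auto simp: f_def intro: poly_over_pCons)
  show thesis
  proof (rule that[of "a * lead_coeff f"])
    show "a * lead_coeff f \<in> R" "a * lead_coeff f \<noteq> 0"
      using ag f by (auto simp: f_def poly_over_def intro!: mult_mem)
    fix V assume V: "valuation_ring V" "R \<subseteq> V" "a * lead_coeff f \<notin> nonunits V"
    interpret V: valuation_ring V by fact
    have fV: "f \<in> poly_over V" "g \<in> poly_over V" and aV: "a \<in> V"
      using f ag V(2) poly_over_mono by blast+
    then have "lead_coeff f \<in> V" by (simp add: poly_over_def)
    then have "a \<notin> nonunits V" "lead_coeff f \<notin> nonunits V"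
      using V(3) V.ideal_mult V.ideal_mult2 aV by blast+
    then have xV: "x \<in> V"
      using V.integral_mem[OF fV(1)] ag by (auto simp: f_def)
    moreover have "x \<notin> nonunits V"
    proof
      assume "x \<in> nonunits V"
      then have "- (x * poly g x) \<in> nonunits V"
        using V.ideal_uminus V.ideal_mult2 V.poly_mem[OF fV(2) xV] by blast
      moreover have "- (x * poly g x) = a" using ag by (simp add: neg_eq_iff_add_eq_0 add.commute)
      ultimately show False using \<open>a \<notin> nonunits V\<close> by simp
    qed
    ultimately show "x \<in> V \<and> x \<notin> nonunits V" by blast
  qed
qed

text \<open>The localization of \<open>R\<close> at \<open>p\<close> is a discrete valuation ring;
  \<open>\<pi>\<close> is its uniformizer, and \<open>c\<close> serves as the inverse of
  \<open>\<pi>\<close> up to the unit \<open>c * \<pi>\<close>.\<close>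

lemma place:
  assumes alg: "\<And>x. algebraic_over K x" and p: "p \<in> primes_of R"
    and V: "valuation_ring V" "R \<subseteq> V" "nonunits V \<inter> R = p"
  obtains \<pi> where "\<pi> \<in> p" "uniformized_valuation_ring V \<pi>" "uniformized_valuation_ring.unramified_subfield V \<pi> K"
    "\<And>a. a \<in> K \<Longrightarrow> a \<in> V \<Longrightarrow> \<exists>r\<in>R. a - r \<in> nonunits V"
proof -
  interpret V: valuation_ring V by fact
  have pr: "primeideal p (subr R)" "p \<noteq> {0}" using p by (auto simp: primes_of_def)
  note P = primeideal_subrD[OF pr(1)] and I = ideal_subrD[OF primeideal_subrD(3)[OF pr(1)]]
  obtain c \<pi> where \<pi>: "\<pi> \<in> p" "c * \<pi> \<in> R" "c * \<pi> \<notin> p" and c: "\<And>x. x \<in> p \<Longrightarrow> c * x \<in> R"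
    and reach: "\<And>s. s \<in> R \<Longrightarrow> s \<noteq> 0 \<Longrightarrow> \<exists>n. c ^ n * s \<in> R \<and> c ^ n * s \<notin> p"
    by (rule prime_uniformizer[OF pr], rule that, assumption+)
  have unit: "V.unit r" if "r \<in> R" "r \<notin> p" for r using that V by blast
  have \<pi>0: "\<pi> \<noteq> 0" using \<pi> I(2) by auto
  have \<pi>n: "\<pi> \<in> nonunits V" using \<pi> V by blast
  \<comment> \<open>\<open>s\<close> is multiplied by \<open>c\<close> until it becomes a unit; then
    each \<open>c\<close> is traded for the unit \<open>c * \<pi>\<close> divided by
    \<open>\<pi>\<close>.\<close>
  have shape: "\<exists>n u. V.unit u \<and> s = u * \<pi> ^ n" if s: "s \<in> R" "s \<noteq> 0" for s
  proof -
    obtain n where n: "c ^ n * s \<in> R" "c ^ n * s \<notin> p" using reach[OF s] by blast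
    have u: "V.unit ((c ^ n * s) / (c * \<pi>) ^ n)"
      by (rule V.unit_divide[OF unit[OF n] V.unit_power[OF unit[OF \<pi>(2,3)]]])
    have "c \<noteq> 0" using \<pi> I(2) by auto
    then have "s = (c ^ n * s) / (c * \<pi>) ^ n * \<pi> ^ n" using \<pi>0 by (simp add: power_mult_distrib)
    with u show ?thesis by blast
  qed
  have sepR: "\<exists>n. s / \<pi> ^ n \<notin> V" if s: "s \<in> R" "s \<noteq> 0" for s
  proof -
    obtain n u where u: "V.unit u" "s = u * \<pi> ^ n" using shape[OF s] by blast
    have "s / \<pi> ^ Suc n \<notin> V"
    proof
      assume "s / \<pi> ^ Suc n \<in> V"
      then have "s / \<pi> ^ Suc n / u \<in> V" using u V.divide_unit_mem by blast
      moreover have "s / \<pi> ^ Suc n / u = inverse \<pi>"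
        using u \<pi>0 V.unit_nonzero[OF u(1)] by (simp add: field_simps)
      ultimately show False using \<pi>n \<pi>0 by (simp add: nonunits_def)
    qed
    then show ?thesis ..
  qed
  have U: "uniformized_valuation_ring V \<pi>"
  proof unfold_locales
    fix a :: 'a assume "a \<noteq> 0"
    show "\<exists>n. a / \<pi> ^ n \<notin> V"
    proof (cases "a \<in> V")
      case False
      then show ?thesis by (intro exI[of _ 0]) simp
    next
      case True
      \<comment> \<open>The constant term \<open>s\<close> of a relation for \<open>a\<close> is
        divisible by \<open>a\<close>, so a power of \<open>\<pi>\<close> that does not divide
        \<open>s\<close> does not divide \<open>a\<close>.\<close>
      obtain s g where s: "s \<in> R" "s \<noteq> 0" "g \<in> poly_over R" "poly (pCons s g) a = 0"
        using algebraic_relation[OF alg \<open>a \<noteq> 0\<close>] by blast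
      then obtain n where n: "s / \<pi> ^ n \<notin> V" using sepR by blast
      have "poly g a \<in> V" using s V(2) True poly_over_mono by (blast intro: V.poly_mem)
      have "a / \<pi> ^ n \<notin> V"
      proof
        assume "a / \<pi> ^ n \<in> V"
        then have "- ((a / \<pi> ^ n) * poly g a) \<in> V"
          using \<open>poly g a \<in> V\<close> by (intro V.uminus_mem V.mult_mem)
        moreover have "s = - (a * poly g a)" using s(4) by (simp add: eq_neg_iff_add_eq_0)
        then have "- ((a / \<pi> ^ n) * poly g a) = s / \<pi> ^ n" by simp
        ultimately show False using n by simp
      qed
      then show ?thesis ..
    qed
  qed (use \<pi>n \<pi>0 in auto)
  interpret U: uniformized_valuation_ring V \<pi> by fact
  have discrete: "U.discrete s" if s: "s \<in> R" "s \<noteq> 0" for s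
  proof -
    obtain n u where "V.unit u" "s = u * \<pi> ^ n" using shape[OF s] by blast
    then show ?thesis by (intro U.discreteI[of u s 0 n]) auto
  qed
  have "U.unramified_subfield K"
    unfolding U.unramified_subfield_def
  proof (intro conjI ballI impI)
    show "subfield_set K" by (rule subfield_set_fraction_field)
    show "\<pi> \<in> K" using \<pi> I(1) R_subset by blast
    fix x assume "x \<in> K" "x \<noteq> 0"
    then show "U.discrete x" by (auto simp: fraction_field_def intro!: U.discrete_divide[OF discrete discrete])
  qed
  moreover have "\<exists>r\<in>R. a - r \<in> nonunits V" if a: "a \<in> K" "a \<in> V" for a
  proof -
    obtain b s where bs: "b \<in> R" "s \<in> R" "s \<noteq> 0" "a = b / s" using a by (auto simp: fraction_field_def)
    then obtain n where "c ^ n * s \<in> R" "c ^ n * s \<notin> p" using reach by blast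
    with bs show ?thesis
    \<comment> \<open>The fraction \<open>b / s\<close> is expanded by \<open>c\<close> until its
      denominator is outside \<open>p\<close>, where it is invertible modulo \<open>p\<close>. As
      long as \<open>s\<close> lies in \<open>p\<close>, so does \<open>b\<close>, because
      \<open>a\<close> is in \<open>V\<close>; hence both stay in \<open>R\<close>.\<close>
    proof (induction n arbitrary: b s rule: nat.induct)
      case zero
      then have s: "s \<in> R" "s \<notin> p" by auto
      then obtain t where t: "t \<in> R" "s * t - 1 \<in> p" using prime_inverse[OF pr] by blast
      have "a - b * t = (- a) * (s * t - 1)" using zero by (simp add: field_simps)
      also have "\<dots> \<in> nonunits V" using t a V by (intro V.ideal_mult V.uminus_mem) auto
      finally show ?case using t zero by (intro bexI[of _ "b * t"] mult_mem)
    next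
      case (Suc n)
      show ?case
      proof (cases "s \<in> p")
        case True
        then have "s \<in> nonunits V" using V by blast
        then have "a * s \<in> nonunits V" using a by (intro V.ideal_mult)
        then have "b \<in> p" using Suc.prems V by auto
        have "c \<noteq> 0" using \<pi> I(2) by auto
        show ?thesis
          using Suc.prems c[OF True] c[OF \<open>b \<in> p\<close>] \<open>c \<noteq> 0\<close>
          by (intro Suc.IH[of "c * b" "c * s"]) (auto simp: mult_ac)
      next
        case False
        obtain t where t: "t \<in> R" "s * t - 1 \<in> p" using prime_inverse[OF pr Suc.prems(2) False] by blast
        have "a - b * t = (- a) * (s * t - 1)" using Suc.prems by (simp add: field_simps)
        also have "\<dots> \<in> nonunits V" using t a V by (intro V.ideal_mult V.uminus_mem) auto
        finally show ?thesis using t Suc.prems by (intro bexI[of _ "b * t"] mult_mem)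
      qed
    qed
  qed
  ultimately show thesis using that[OF \<pi>(1) U] by blast
qed

end

lemma ideals_set_simps [simp]:
  "monoid.mult (ideals_set R) = ideal_prod R" "one (ideals_set R) = carrier R"
  by (auto simp: ideals_set_def)

text \<open>By Chevalley's theorem any prime \<open>P\<close> over \<open>p\<close> is cut out by
  some \<open>V\<close>, so a statement about all \<open>V\<close> covers all \<open>P\<close>. The
  hypothesis ranges over every henselian unramified \<open>E\<close>, because residue separability
  compares \<open>L\<close> with an \<open>E\<close> built over an auxiliary root.\<close>

theorem unramified_criterion:
  fixes R :: "'a::alg_closed_field set"
  assumes R: "dedekind_domain R" and alg: "\<And>x. algebraic_over (fraction_field R) x"
    and p: "p \<in> primes_of R" and L: "subfield_set L" "fraction_field R \<subseteq> L"
    and all: "\<And>V \<pi> E. valuation_ring V \<Longrightarrow> R \<subseteq> V \<Longrightarrow> nonunits V \<inter> R = p \<Longrightarrow> uniformized_valuation_ring V \<pi> \<Longrightarrow>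
      fraction_field R \<subseteq> E \<Longrightarrow> uniformized_valuation_ring.unramified_subfield V \<pi> E \<Longrightarrow> henselian V E \<Longrightarrow> L \<subseteq> E"
  shows "\<not> ramified_in_finite R p L"
proof
  assume "ramified_in_finite R p L"
  interpret R: dedekind R by unfold_locales fact
  interpret L: subfield_set L by fact
  let ?K = "fraction_field R"
  define S where "S = integral_closure R L"
  obtain P where P: "primeideal P (subr S)" "P \<inter> R = p"
    and bad: "ramification_index S P p \<noteq> 1 \<or> \<not> residue_separable R p S P"
    using \<open>ramified_in_finite R p L\<close> by (auto simp: ramified_in_finite_def Let_def S_def)
  note prime = primeideal_subrD[OF P(1)]
  note I = ideal_subrD[OF prime(3)]
  interpret S: subdomain S by (rule subdomain_if_cring) (rule prime(4))
  have SL: "S \<subseteq> L" by (auto simp: S_def integral_closure_def)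
  have RS: "R \<subseteq> S"
  proof
    fix r assume r: "r \<in> R"
    then have "[:- r, 1:] \<in> poly_over R"
      by (intro R.poly_over_pCons R.poly_over_0 R.one_mem R.uminus_mem)
    with r show "r \<in> S"
      using R.R_subset L(2) by (auto simp: S_def integral_closure_def intro!: bexI[of _ "[:- r, 1:]"])
  qed
  obtain V where V: "valuation_ring V" "S \<subseteq> V" "nonunits V \<inter> S = P"
    using S.valuation_ring_over_prime[OF I(1,2) prime(1) I(3,4) prime(2)] by blast
  have RV: "R \<subseteq> V" "nonunits V \<inter> R = p" using RS V P(2) by auto
  obtain \<pi> where \<pi>: "\<pi> \<in> p" "uniformized_valuation_ring V \<pi>" "uniformized_valuation_ring.unramified_subfield V \<pi> ?K"
    and approx: "\<And>a. a \<in> ?K \<Longrightarrow> a \<in> V \<Longrightarrow> \<exists>r\<in>R. a - r \<in> nonunits V"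
    using R.place[OF alg p V(1) RV] by blast
  interpret uniformized_valuation_ring V \<pi> by fact
  note all' = all[OF V(1) RV \<pi>(2)]
  have pR: "p \<subseteq> R" "p \<subseteq> P" "p \<subseteq> S" using P(2) RS by auto
  have "ramification_index S P p = 1"
    unfolding ramification_index_def
  proof (rule Greatest_equality)
    interpret cring "subr S" by (rule prime(4))
    have "P \<subseteq> P [^]\<^bsub>ideals_set (subr S)\<^esub> (1 :: nat)"
    proof
      fix x assume "x \<in> P"
      then have "1 \<otimes>\<^bsub>subr S\<^esub> x \<in> S \<cdot>\<^bsub>subr S\<^esub> P" using S.one_mem by (intro ideal_prod.prod)
      then show "x \<in> P [^]\<^bsub>ideals_set (subr S)\<^esub> (1 :: nat)" by (simp add: nat_pow_def)
    qed
    moreover have "Idl\<^bsub>subr S\<^esub> p \<subseteq> P" using prime(3) pR by (intro genideal_minimal)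
    ultimately show "Idl\<^bsub>subr S\<^esub> p \<subseteq> P [^]\<^bsub>ideals_set (subr S)\<^esub> (1 :: nat)" by blast
    fix e :: nat assume e: "Idl\<^bsub>subr S\<^esub> p \<subseteq> P [^]\<^bsub>ideals_set (subr S)\<^esub> e"
    obtain E where E: "?K \<subseteq> E" "unramified_subfield E" "henselian V E" using henselian_extension[OF \<pi>(3)] by blast
    have "L \<subseteq> E" using all' E by blast
    have divP: "x / \<pi> \<in> V" if "x \<in> P" for x
    proof (cases "x = 0")
      case False
      have "x \<in> E" "x \<in> nonunits V" using that I(1) SL \<open>L \<subseteq> E\<close> V by blast+
      with False E show ?thesis by (auto simp: unramified_subfield_def intro: discrete_nonunit)
    qed (auto intro: zero_mem)
    \<comment> \<open>Elements of \<open>P\<close> are divisible by \<open>\<pi>\<close> because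
      \<open>L\<close> lies in an unramified \<open>E\<close>; so those of the \<open>n\<close>-th
      power of \<open>P\<close> are divisible by \<open>\<pi> ^ n\<close>, and
      \<open>\<pi> \<in> p\<close> bounds the exponent.\<close>
    have "x / \<pi> ^ n \<in> V" if "x \<in> P [^]\<^bsub>ideals_set (subr S)\<^esub> n" for n x
      using that
    proof (induction n arbitrary: x)
      case 0
      then show ?case using V by (auto simp: nat_pow_def)
    next
      case (Suc n)
      then have "x \<in> (P [^]\<^bsub>ideals_set (subr S)\<^esub> n) \<cdot>\<^bsub>subr S\<^esub> P" by (simp add: nat_pow_def)
      then show ?case
      proof induction
        case (prod i j)
        have "i / \<pi> ^ n * (j / \<pi>) \<in> V" using prod Suc.IH divP by (intro mult_mem) auto
        then show ?case by (simp add: mult.commute)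
      qed (auto simp: add_divide_distrib intro: add_mem)
    qed
    moreover have "\<pi> \<in> Idl\<^bsub>subr S\<^esub> p" using genideal_self[of p] pR \<pi>(1) by auto
    ultimately have *: "\<pi> / \<pi> ^ e \<in> V" using e by blast
    show "e \<le> 1"
    proof (rule ccontr)
      assume "\<not> e \<le> 1"
      then have e: "\<pi> ^ e = \<pi> * \<pi> * \<pi> ^ (e - 2)"
        by (metis (no_types) add_2_eq_Suc' le_add_diff_inverse2 mult.assoc mult.commute not_less_eq_eq numeral_2_eq_2 power_Suc One_nat_def)
      have "\<pi> / \<pi> ^ e * \<pi> ^ (e - 2) = inverse \<pi>" using pi_nonzero unfolding e by (simp add: field_simps)
      then have "inverse \<pi> \<in> V" using * mult_mem[OF _ power_mem[OF pi_mem]] by metis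
      then show False using pi_nonunit pi_nonzero by (simp add: nonunits_def)
    qed
  qed
  moreover have "residue_separable R p S P"
    unfolding residue_separable_def
  proof
    fix s assume s: "s \<in> S"
    have sV: "s \<in> V" using s V by blast
    obtain g where g: "g \<in> poly_over R" "lead_coeff g = 1" "poly g s = 0"
      using s by (auto simp: S_def integral_closure_def)
    have gKV: "g \<in> poly_over (?K \<inter> V)" using g(1) RV(1) R.R_subset by (auto simp: poly_over_def)
    have "s \<in> E" if "?K \<subseteq> E" "unramified_subfield E" "henselian V E" for E
      using all' that s SL by blast
    then obtain f u v where f: "f \<in> poly_over (?K \<inter> V)" "u \<in> poly_over (?K \<inter> V)" "v \<in> poly_over (?K \<inter> V)"
      "poly f s \<in> nonunits V" "u * f + v * pderiv f - 1 \<in> poly_over (?K \<inter> nonunits V)"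
      using residually_separable[OF \<pi>(2,3) sV gKV g(2)] g(3) ideal_zero by metis
    \<comment> \<open>Residue separability asks for polynomials over \<open>R\<close>, while
      \<open>f\<close>, \<open>u\<close>, \<open>v\<close> have coefficients in
      \<open>K \<inter> V\<close>; the residue fields agree, so lifts to \<open>R\<close> can be
      chosen.\<close>
    have lift: "\<exists>f'\<in>poly_over R. f - f' \<in> poly_over (nonunits V)" if "f \<in> poly_over (?K \<inter> V)" for f
      using that
    proof (induction f rule: pCons_induct)
      case 0
      then show ?case using poly_over_ideal_0 R.poly_over_0 by (intro bexI[of _ 0]) auto
    next
      case (pCons a f)
      then have "a \<in> ?K" "a \<in> V" "f \<in> poly_over (?K \<inter> V)"
        by (auto simp: poly_over_def coeff_pCons split: nat.splits)
      then obtain r f' where rf: "r \<in> R" "a - r \<in> nonunits V" "f' \<in> poly_over R" "f - f' \<in> poly_over (nonunits V)"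
        using approx pCons.IH by blast
      then show ?case
        by (intro bexI[of _ "pCons r f'"]) (auto simp: poly_over_def coeff_pCons split: nat.splits)
    qed
    obtain f' u' v' where f': "f' \<in> poly_over R" "f - f' \<in> poly_over (nonunits V)"
      and u': "u' \<in> poly_over R" "u - u' \<in> poly_over (nonunits V)"
      and v': "v' \<in> poly_over R" "v - v' \<in> poly_over (nonunits V)"
      using lift f by metis
    have inV: "h \<in> poly_over V" if "h \<in> poly_over (?K \<inter> V) \<or> h \<in> poly_over R" for h
      using that RV by (auto simp: poly_over_def)
    have "poly f s - poly (f - f') s \<in> nonunits V" using f(4) poly_ideal[OF f'(2) sV] by (rule ideal_diff)
    then have "poly f' s \<in> nonunits V" by simp
    moreover have "poly f' s \<in> S" using f'(1) RS s by (blast intro: S.poly_mem poly_over_mono)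
    ultimately have "poly f' s \<in> P" using V by blast
    have "u' * f' + v' * pderiv f' - 1 =
        (u * f + v * pderiv f - 1) - ((u - u') * f + u' * (f - f') + ((v - v') * pderiv f + v' * pderiv (f - f')))"
      by (simp add: algebra_simps pderiv_diff)
    also have "\<dots> \<in> poly_over (nonunits V)"
    proof (rule poly_over_ideal_diff)
      show "u * f + v * pderiv f - 1 \<in> poly_over (nonunits V)" using f(5) by (simp add: poly_over_Int)
      have "(u - u') * f \<in> poly_over (nonunits V)" "u' * (f - f') \<in> poly_over (nonunits V)"
        "(v - v') * pderiv f \<in> poly_over (nonunits V)" "v' * pderiv (f - f') \<in> poly_over (nonunits V)"
        by (rule poly_over_ideal_mult2 poly_over_ideal_mult;
            intro u' v' f' poly_over_ideal_pderiv inV poly_over_pderiv disjI1[OF f(1)] disjI2[OF u'(1)] disjI2[OF v'(1)])+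
      then show "(u - u') * f + u' * (f - f') + ((v - v') * pderiv f + v' * pderiv (f - f')) \<in> poly_over (nonunits V)"
        by (intro poly_over_ideal_add)
    qed
    finally have "u' * f' + v' * pderiv f' - 1 \<in> poly_over (nonunits V)" .
    moreover have "u' * f' + v' * pderiv f' - 1 \<in> poly_over R"
      using u' v' f' by (intro R.poly_over_diff R.poly_over_add R.poly_over_mult R.poly_over_pderiv R.poly_over_1)
    ultimately have "u' * f' + v' * pderiv f' - 1 \<in> poly_over p"
      unfolding RV(2)[symmetric] poly_over_Int by (rule IntI)
    then show "\<exists>f\<in>poly_over R. (\<exists>u\<in>poly_over R. \<exists>v\<in>poly_over R. u * f + v * pderiv f - 1 \<in> poly_over p) \<and> poly f s \<in> P"
      using f' u' v' \<open>poly f' s \<in> P\<close> by blast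
  qed
  ultimately show False using bad by blast
qed

section \<open>Perfect closures and generic valuation rings\<close>

text \<open>Such exponents are 1 and the powers of a prime characteristic. Working with them treats
  all characteristics at once, \<open>q = 1\<close> being the only case in characteristic 0.\<close>

definition frobenius_exponent :: "'a::field itself \<Rightarrow> nat \<Rightarrow> bool" where
  "frobenius_exponent _ q \<longleftrightarrow> q > 0 \<and> (\<forall>x y :: 'a. (x + y) ^ q = x ^ q + y ^ q)"

lemma frobenius_exponent_1: "frobenius_exponent TYPE('a::field) 1"
  by (simp add: frobenius_exponent_def)

lemma frobenius_exponent_mult:
  "frobenius_exponent TYPE('a::field) q \<Longrightarrow> frobenius_exponent TYPE('a) r \<Longrightarrow> frobenius_exponent TYPE('a) (q * r)"
  by (simp add: frobenius_exponent_def power_mult)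

lemma frobenius_exponent_CHAR:
  assumes "prime CHAR('a::field)" shows "frobenius_exponent TYPE('a) CHAR('a)"
  using assms prime_gt_0_nat[OF assms] by (auto simp: frobenius_exponent_def freshmans_dream)

context
  fixes q :: nat
  assumes q: "frobenius_exponent TYPE('a::field) q"
begin

lemma frobenius_pos: "q > 0"
  using q by (simp add: frobenius_exponent_def)

lemma frobenius_add: "(x + y :: 'a) ^ q = x ^ q + y ^ q"
  using q by (simp add: frobenius_exponent_def)

lemma frobenius_diff: "(x - y :: 'a) ^ q = x ^ q - y ^ q"
  using frobenius_add[of "x - y" y] by simp

lemma frobenius_of_nat: "(of_nat n :: 'a) ^ q = of_nat n"
  by (induction n) (use frobenius_pos in \<open>auto simp: frobenius_add\<close>)

lemma poly_map_frobenius: "poly (map_poly (\<lambda>a. a ^ q) f) (x ^ q) = (poly f x :: 'a) ^ q"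
  using frobenius_pos
  by (induction f rule: pCons_induct) (auto simp: map_poly_pCons frobenius_add power_mult_distrib)

lemma pderiv_map_frobenius: "pderiv (map_poly (\<lambda>a. a ^ q) f) = map_poly (\<lambda>a :: 'a. a ^ q) (pderiv f)"
  using frobenius_pos
  by (intro poly_eqI) (simp add: coeff_pderiv coeff_map_poly power_mult_distrib frobenius_of_nat del: of_nat_Suc)

end

definition perfect_closure :: "'a::field set \<Rightarrow> 'a set" where
  "perfect_closure E = {x. \<exists>q. frobenius_exponent TYPE('a) q \<and> x ^ q \<in> E}"

lemma perfect_closureI: "frobenius_exponent TYPE('a) q \<Longrightarrow> x ^ q \<in> E \<Longrightarrow> x \<in> perfect_closure (E :: 'a::field set)"
  by (auto simp: perfect_closure_def)

lemma perfect_closure_superset: "E \<subseteq> perfect_closure (E :: 'a::field set)"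
  using perfect_closureI[OF frobenius_exponent_1] by force

lemma perfect_closure_root:
  "frobenius_exponent TYPE('a) q \<Longrightarrow> x ^ q \<in> perfect_closure E \<Longrightarrow> x \<in> perfect_closure (E :: 'a::field set)"
  using frobenius_exponent_mult by (fastforce simp: perfect_closure_def simp flip: power_mult)

context subfield_set
begin

lemma subfield_set_perfect_closure: "subfield_set (perfect_closure E)"
proof unfold_locales
  show "1 \<in> perfect_closure E"
    using perfect_closure_superset one_mem by blast
  fix x y assume "x \<in> perfect_closure E" "y \<in> perfect_closure E"
  then obtain q r where q: "frobenius_exponent TYPE('a) q" "x ^ q \<in> E" and r: "frobenius_exponent TYPE('a) r" "y ^ r \<in> E"
    by (auto simp: perfect_closure_def)
  have qr: "frobenius_exponent TYPE('a) (q * r)"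
    using q r by (intro frobenius_exponent_mult)
  have "x ^ (q * r) \<in> E" "y ^ (q * r) \<in> E"
    using power_mem[OF q(2), of r] power_mem[OF r(2), of q] by (simp_all add: power_mult[symmetric] mult.commute)
  then have "(x - y) ^ (q * r) \<in> E" "(x * y) ^ (q * r) \<in> E"
    by (auto simp: frobenius_diff[OF qr] power_mult_distrib intro: diff_mem mult_mem)
  then show "x - y \<in> perfect_closure E" "x * y \<in> perfect_closure E"
    using perfect_closureI[OF qr] by auto
next
  fix x assume "x \<in> perfect_closure E"
  then show "inverse x \<in> perfect_closure E"
    by (auto simp: perfect_closure_def power_inverse intro: inverse_mem)
qed

lemma common_frobenius_exponent:
  assumes "f \<in> poly_over (perfect_closure E)"
  shows "\<exists>q. frobenius_exponent TYPE('a) q \<and> map_poly (\<lambda>a. a ^ q) f \<in> poly_over E"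
  using assms
proof (induction f rule: pCons_induct)
  case 0
  then show ?case using frobenius_exponent_1 poly_over_0 by (intro exI[of _ 1]) auto
next
  case (pCons a f)
  then have "a \<in> perfect_closure E" "f \<in> poly_over (perfect_closure E)"
    by (auto simp: poly_over_def coeff_pCons split: nat.splits)
  then obtain q r where q: "frobenius_exponent TYPE('a) q" "a ^ q \<in> E"
    and r: "frobenius_exponent TYPE('a) r" "map_poly (\<lambda>a. a ^ r) f \<in> poly_over E"
    using pCons.IH by (auto simp: perfect_closure_def)
  have qr: "frobenius_exponent TYPE('a) (q * r)"
    using q r by (intro frobenius_exponent_mult)
  have "(coeff f i ^ r) ^ q \<in> E" for i
    using r frobenius_pos[OF r(1)] by (intro power_mem[of "coeff f i ^ r"]) (auto simp: poly_over_def coeff_map_poly)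
  moreover have "(a ^ q) ^ r \<in> E" using power_mem[OF q(2)] .
  ultimately have "coeff (map_poly (\<lambda>a. a ^ (q * r)) (pCons a f)) i \<in> E" for i
    using frobenius_pos[OF qr]
    by (auto simp: coeff_map_poly coeff_pCons power_mult[symmetric] mult.commute split: nat.splits)
  with qr show ?case by (auto simp: poly_over_def)
qed

text \<open>Raising the coefficients of \<open>f\<close> to a power \<open>q\<close> moves them into
  \<open>E\<close>, and \<open>x ^ q\<close> is a simple root modulo \<open>V\<close> of the new
  polynomial, with derivative value \<open>poly (pderiv f) x ^ q\<close>.\<close>

lemma henselian_perfect_closure:
  assumes V: "valuation_ring V" and E: "henselian V E"
  shows "henselian V (perfect_closure E)"
  unfolding henselian_def
proof (intro ballI impI)
  interpret V: valuation_ring V by fact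
  fix f x assume f: "f \<in> poly_over (perfect_closure E \<inter> V)" and x: "x \<in> V"
    and root: "poly f x = 0 \<and> poly (pderiv f) x \<notin> nonunits V"
  obtain q where q: "frobenius_exponent TYPE('a) q" "map_poly (\<lambda>a. a ^ q) f \<in> poly_over E"
    using common_frobenius_exponent f by (auto simp: poly_over_Int)
  let ?g = "map_poly (\<lambda>a. a ^ q) f"
  have "?g \<in> poly_over V"
    using f frobenius_pos[OF q(1)] by (auto simp: poly_over_def coeff_map_poly intro: V.power_mem)
  moreover have "poly (pderiv f) x ^ q \<notin> nonunits V"
    using root x f V.ideal_power[of "poly (pderiv f) x" q]
    by (auto simp: poly_over_Int intro: V.poly_mem V.poly_over_pderiv)
  ultimately have "x ^ q \<in> E"
    using E root x q frobenius_pos[OF q(1)] V.power_mem[OF x, of q] unfolding henselian_def poly_over_Int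
    by (simp add: poly_map_frobenius[OF q(1)] pderiv_map_frobenius[OF q(1)])
  then show "x \<in> perfect_closure E"
    using q(1) by (rule perfect_closureI[rotated])
qed

text \<open>This makes the results on lifts of residue polynomials available for ordinary
  polynomials over a field.\<close>

lemma local_subdomain_0: "local_subdomain E {0}"
  by unfold_locales (auto intro: inverse_mem zero_mem)

end

section \<open>Separable elements and inseparable powers\<close>

lemma subfield_set_UNIV: "subfield_set UNIV"
  by unfold_locales auto

lemma poly_over_zero: "poly_over {0} = {0}"
  by (auto simp: poly_over_def poly_eq_iff)

lemma double_root_dvd:
  fixes f :: "'a::field poly"
  assumes "poly f y = 0" "poly (pderiv f) y = 0"
  shows "[:- y, 1:] ^ 2 dvd f"
proof -
  obtain g where g: "f = [:- y, 1:] * g"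
    using assms(1) by (auto simp: poly_eq_0_iff_dvd)
  have "poly g y = 0"
    using assms(2) by (simp add: g pderiv_diff pderiv_smult pderiv_pCons)
  then have "[:- y, 1:] dvd g" by (simp add: poly_eq_0_iff_dvd)
  then show ?thesis unfolding g power2_eq_square by (rule mult_dvd_mono[OF dvd_refl])
qed

lemma rsquarefree_simple_root:
  assumes "rsquarefree f" "poly f y = 0"
  shows "poly (pderiv f) y \<noteq> (0 :: 'a::field)"
proof
  assume "poly (pderiv f) y = 0"
  then have "2 \<le> order y f"
    using double_root_dvd[OF assms(2)] assms(1) by (auto simp: order_divides rsquarefree_def)
  with assms(1) show False by (metis rsquarefree_def not_one_le_zero numeral_le_one_iff semiring_norm(69) le_zero_eq zero_neq_numeral)
qed

text \<open>The minimal polynomial \<open>d\<close> of \<open>y\<close> over \<open>E\<close>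
  divides \<open>X ^ q - y ^ q = (X - y) ^ q\<close>, so \<open>y\<close> is its only root; the root
  is simple as \<open>d\<close> divides the separable \<open>f\<close>. Hence
  \<open>d = X - y\<close>.\<close>

lemma separable_in_perfect_closure:
  fixes E :: "'a::alg_closed_field set"
  assumes E: "subfield_set E" and f: "f \<in> poly_over E" "rsquarefree f" "poly f y = 0" and y: "y \<in> perfect_closure E"
  shows "y \<in> E"
proof -
  interpret subfield_set E by fact
  interpret loc: local_subdomain E "{0}" by (rule local_subdomain_0)
  have U: "local_subdomain UNIV {0 :: 'a}" using subfield_set.local_subdomain_0[OF subfield_set_UNIV] .
  have "f \<notin> poly_over {0}" using f by (auto simp: poly_over_zero rsquarefree_def)
  then obtain d where d: "d \<in> poly_over E" "lead_coeff d = 1" "poly d y \<in> {0}"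
    and div: "\<And>g. g \<in> poly_over E \<Longrightarrow> poly g y \<in> {0} \<Longrightarrow> \<exists>h\<in>poly_over E. g - d * h \<in> poly_over {0}"
    using loc.minimal_poly_mod[OF U _ _ _ _ f(1), of y] f(3)
    by (metis (no_types, lifting) Int_lower2 UNIV_I insertI1 subset_UNIV subset_refl)
  obtain h where h: "f = d * h"
    using div[OF f(1)] f(3) by (auto simp: poly_over_zero)
  have d': "poly (pderiv d) y \<noteq> 0"
  proof
    assume "poly (pderiv d) y = 0"
    then have "poly (pderiv f) y = 0"
      using d(3) by (simp add: h pderiv_mult)
    with rsquarefree_simple_root[OF f(2,3)] show False by simp
  qed
  obtain q where q: "frobenius_exponent TYPE('a) q" "y ^ q \<in> E"
    using y by (auto simp: perfect_closure_def)
  have "monom 1 q - [:y ^ q:] \<in> poly_over E"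
    using q by (intro poly_over_diff poly_over_monom poly_over_pCons poly_over_0 one_mem)
  from div[OF this] obtain k where k: "monom 1 q - [:y ^ q:] = d * k"
    by (auto simp: poly_over_zero poly_monom)
  have only: "z = y" if "poly d z = 0" for z
  proof -
    have "(z - y) ^ q = poly (monom 1 q - [:y ^ q:]) z"
      by (simp add: poly_monom frobenius_diff[OF q(1)])
    also have "\<dots> = 0" using that by (simp add: k)
    finally show ?thesis by simp
  qed
  obtain e where e: "d = [:- y, 1:] * e"
    using d(3) by (auto simp: poly_eq_0_iff_dvd)
  have "poly e y \<noteq> 0"
    using d' by (simp add: e pderiv_diff pderiv_smult pderiv_pCons)
  then have "poly e z \<noteq> 0" for z
    using only[of z] by (auto simp: e)
  then have "degree e = 0"
    using alg_closed_imp_poly_has_root by blast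
  then obtain c where c: "e = [:c:]" by (auto elim: degree_eq_zeroE)
  with d(2) have "c = 1" by (simp add: e split: if_splits)
  then have "coeff d 0 = - y" by (simp add: e c)
  moreover have "coeff d 0 \<in> E" using d(1) by (simp add: poly_over_def)
  ultimately show "y \<in> E"
    using uminus_mem[of "- y"] by simp
qed

text \<open>
  A polynomial of minimal degree vanishing at some \<open>z ^ q\<close> is separable: otherwise it would be a
  polynomial in \<open>X ^ p\<close>, and \<open>q\<close> could be replaced by \<open>q * p\<close>.
\<close>

lemma algebraic_simple_root:
  fixes K :: "'a::field set"
  assumes K: "subfield_set K" and z: "algebraic_over K z"
  obtains q g where "frobenius_exponent TYPE('a) q" "g \<in> poly_over K" "poly g (z ^ q) = 0"
    "poly (pderiv g) (z ^ q) \<noteq> 0"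
proof -
  interpret subfield_set K by fact
  define Q where "Q qg \<longleftrightarrow> frobenius_exponent TYPE('a) (fst qg) \<and> snd qg \<in> poly_over K \<and> snd qg \<noteq> 0 \<and>
    poly (snd qg) (z ^ fst qg) = 0" for qg
  obtain g\<^sub>0 where "g\<^sub>0 \<in> poly_over K" "g\<^sub>0 \<noteq> 0" "poly g\<^sub>0 z = 0"
    using z by (auto simp: algebraic_over_def)
  then have "Q (1, g\<^sub>0)" using frobenius_exponent_1 by (simp add: Q_def)
  then obtain qg where qg: "Q qg" and least: "\<And>qg'. Q qg' \<Longrightarrow> degree (snd qg) \<le> degree (snd qg')"
    using ex_has_least_nat[of Q _ "\<lambda>qg. degree (snd qg)"] by blast
  obtain q g where [simp]: "qg = (q, g)" by (cases qg)
  have q: "frobenius_exponent TYPE('a) q" and g: "g \<in> poly_over K" "g \<noteq> 0" "poly g (z ^ q) = 0"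
    using qg by (auto simp: Q_def)
  have deg: "degree g \<noteq> 0"
  proof
    assume "degree g = 0"
    then obtain c where "g = [:c:]" by (rule degree_eq_zeroE)
    with g show False by simp
  qed
  show thesis
  proof (cases "poly (pderiv g) (z ^ q) = 0")
    case True
    have "pderiv g = 0"
    proof (rule ccontr)
      assume "pderiv g \<noteq> 0"
      then have "Q (q, pderiv g)" using True q g by (auto simp: Q_def intro: poly_over_pderiv)
      then show False using least[of "(q, pderiv g)"] degree_pderiv_le[of g] deg by auto
    qed
    then have zero: "of_nat i * coeff g i = 0" for i
      using coeff_pderiv[of g "i - 1"] by (cases i) auto
    have "of_nat (degree g) = (0 :: 'a)"
      using zero[of "degree g"] g by simp
    then have "CHAR('a) dvd degree g" by (simp add: of_nat_eq_0_iff_char_dvd)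
    then have "CHAR('a) > 0" using deg by (auto intro: Nat.gr0I)
    then have p: "prime CHAR('a)" by (rule prime_CHAR_semidom)
    define p where "p = CHAR('a)"
    note p = p[folded p_def]
    \<comment> \<open>Coefficients of \<open>g\<close> in degrees not divisible by \<open>p\<close>
      vanish, so this is the polynomial with \<open>g(X) = h(X ^ p)\<close>.\<close>
    define h where "h = (\<Sum>i\<le>degree g div p. monom (coeff g (i * p)) i)"
    have coeff_h: "coeff h i = coeff g (i * p)" for i
    proof (cases "i \<le> degree g div p")
      case False
      then have "degree g < i * p"
        using p by (simp add: div_less_iff_less_mult prime_gt_0_nat not_le)
      with False show ?thesis by (simp add: h_def coeff_sum coeff_eq_0)
    qed (simp add: h_def coeff_sum)
    have "poly h (x ^ p) = poly g x" for x
    proof -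
      have "poly h (x ^ p) = (\<Sum>i\<le>degree g div p. coeff g (i * p) * x ^ (i * p))"
        by (simp add: h_def poly_sum poly_monom mult.commute flip: power_mult)
      also have "\<dots> = (\<Sum>j\<in>(\<lambda>i. i * p) ` {..degree g div p}. coeff g j * x ^ j)"
        using p by (subst sum.reindex) (auto simp: inj_on_def prime_gt_0_nat)
      also have "\<dots> = (\<Sum>j\<le>degree g. coeff g j * x ^ j)"
      proof (rule sum.mono_neutral_left)
        show "(\<lambda>i. i * p) ` {..degree g div p} \<subseteq> {..degree g}"
          by (auto intro: order_trans[OF mult_le_mono1 div_times_less_eq_dividend])
        show "\<forall>j\<in>{..degree g} - (\<lambda>i. i * p) ` {..degree g div p}. coeff g j * x ^ j = 0"
        proof
          fix j assume j: "j \<in> {..degree g} - (\<lambda>i. i * p) ` {..degree g div p}"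
          have "\<not> p dvd j"
          proof
            assume "p dvd j"
            then have "j = (j div p) * p" by simp
            moreover have "j div p \<le> degree g div p" using j by (simp add: div_le_mono)
            ultimately show False using j by blast
          qed
          then show "coeff g j * x ^ j = 0"
            using zero[of j] by (simp add: p_def of_nat_eq_0_iff_char_dvd)
        qed
      qed auto
      finally show ?thesis by (simp add: poly_altdef)
    qed
    from this[of "z ^ q"] have root: "poly h (z ^ (q * p)) = 0"
      using g by (simp add: power_mult)
    have "coeff h (degree g div p) \<noteq> 0"
      using g \<open>CHAR('a) dvd degree g\<close> by (simp add: coeff_h p_def)
    then have "h \<noteq> 0" by auto
    moreover have "h \<in> poly_over K" using g by (simp add: poly_over_def coeff_h)
    moreover have "frobenius_exponent TYPE('a) (q * p)"
      using q p unfolding p_def by (intro frobenius_exponent_mult frobenius_exponent_CHAR)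
    ultimately have "Q (q * p, h)" using root by (simp add: Q_def)
    then have "degree g \<le> degree h" using least by fastforce
    also have "degree h \<le> degree g div p"
      using p by (intro degree_le) (auto simp: coeff_h div_less_iff_less_mult prime_gt_0_nat intro!: coeff_eq_0)
    also have "\<dots> < degree g" using deg prime_gt_1_nat[OF p] by simp
    finally show thesis by simp
  qed (use that q g in blast)
qed

text \<open>The notion of almost all valuation rings: a property holds generically if finitely many
  nonzero elements can be named whose being units forces it. A filter lets such conditions be
  combined by \<open>eventually\<close> without tracking the finite sets.\<close>

definition generic :: "'a::field set filter" where
  "generic = inf (principal (Collect valuation_ring)) (INF c\<in>-{0}. principal {V. c \<in> V \<and> c \<notin> nonunits V})"

lemma eventually_generic:
  "eventually P generic \<longleftrightarrow> (\<exists>C :: 'a::field set. finite C \<and> 0 \<notin> C \<and>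
     (\<forall>V. valuation_ring V \<longrightarrow> (\<forall>c\<in>C. c \<in> V \<and> c \<notin> nonunits V) \<longrightarrow> P V))"
proof -
  have "eventually P generic \<longleftrightarrow> (\<exists>C \<subseteq> -{0 :: 'a}. finite C \<and>
      eventually (\<lambda>V. valuation_ring V \<longrightarrow> P V) (INF c\<in>C. principal {V. c \<in> V \<and> c \<notin> nonunits V}))"
    unfolding generic_def inf.commute[of "principal _"] eventually_inf_principal
    by (subst eventually_INF) auto
  also have "\<dots> \<longleftrightarrow> (\<exists>C \<subseteq> -{0 :: 'a}. finite C \<and>
      eventually (\<lambda>V. valuation_ring V \<longrightarrow> P V) (principal (\<Inter>c\<in>C. {V. c \<in> V \<and> c \<notin> nonunits V})))"
    by (intro arg_cong[where f = Ex] ext conj_cong refl) (simp add: INF_principal_finite)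
  finally show ?thesis
    by (auto simp: eventually_principal)
qed

lemma generic_valuation: "eventually valuation_ring generic"
  by (auto simp: eventually_generic)

lemma generic_unit: "c \<noteq> 0 \<Longrightarrow> eventually (\<lambda>V. c \<in> V \<and> c \<notin> nonunits V) generic"
  unfolding eventually_generic by (intro exI[of _ "{c}"]) auto

lemma generic_mem: "eventually (\<lambda>V. c \<in> V) generic"
proof (cases "c = 0")
  case True
  show ?thesis
    using generic_valuation by eventually_elim (auto simp: True valuation_ring_def subdomain.zero_mem)
next
  case False
  show ?thesis
    using generic_unit[OF False] by eventually_elim simp
qed

lemma generic_poly: "eventually (\<lambda>V. f \<in> poly_over V) generic"
proof -
  have "eventually (\<lambda>V. \<forall>c\<in>set (coeffs f). c \<in> V) generic"
    by (intro eventually_ball_finite finite_set ballI generic_mem)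
  with generic_mem[of 0] show ?thesis
  proof eventually_elim
    case (elim V)
    have "coeff f i \<in> V" for i
      using elim range_coeff[of f] by (metis insertE rangeI)
    then show ?case by (simp add: poly_over_def)
  qed
qed

text \<open>Each of the finitely many test elements \<open>c\<close> has a nonzero
  \<open>r c\<close> in \<open>R\<close> whose being a unit forces the same for \<open>c\<close>; a
  bad prime contains one of these \<open>r c\<close>.\<close>

lemma (in dedekind) generic_imp_finite:
  assumes alg: "\<And>x. algebraic_over K x" and ev: "eventually Q generic"
  shows "finite {p \<in> primes_of R. \<exists>V. valuation_ring V \<and> R \<subseteq> V \<and> nonunits V \<inter> R = p \<and> \<not> Q V}"
proof -
  obtain C :: "'a set" where C: "finite C" "0 \<notin> C"
    "\<And>V. valuation_ring V \<Longrightarrow> \<forall>c\<in>C. c \<in> V \<and> c \<notin> nonunits V \<Longrightarrow> Q V"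
    using ev unfolding eventually_generic by blast
  have "\<exists>r. \<forall>c\<in>C. r c \<in> R \<and> r c \<noteq> 0 \<and>
      (\<forall>V. valuation_ring V \<longrightarrow> R \<subseteq> V \<longrightarrow> r c \<notin> nonunits V \<longrightarrow> c \<in> V \<and> c \<notin> nonunits V)"
  proof (intro bchoice ballI)
    fix c assume "c \<in> C"
    then have "c \<noteq> 0" using C by auto
    obtain r where "r \<in> R" "r \<noteq> 0" "\<And>V. valuation_ring V \<Longrightarrow> R \<subseteq> V \<Longrightarrow> r \<notin> nonunits V \<Longrightarrow> c \<in> V \<and> c \<notin> nonunits V"
      by (rule algebraic_unit[OF alg \<open>c \<noteq> 0\<close>], rule that, assumption+)
    then show "\<exists>r. r \<in> R \<and> r \<noteq> 0 \<and> (\<forall>V. valuation_ring V \<longrightarrow> R \<subseteq> V \<longrightarrow> r \<notin> nonunits V \<longrightarrow> c \<in> V \<and> c \<notin> nonunits V)"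
      by blast
  qed
  then obtain r where r: "\<And>c. c \<in> C \<Longrightarrow> r c \<in> R \<and> r c \<noteq> 0"
    "\<And>c V. c \<in> C \<Longrightarrow> valuation_ring V \<Longrightarrow> R \<subseteq> V \<Longrightarrow> r c \<notin> nonunits V \<Longrightarrow> c \<in> V \<and> c \<notin> nonunits V"
    by blast
  have "finite (\<Union>c\<in>C. {p \<in> primes_of R. r c \<in> p})"
    using C r by (intro finite_UN_I finite_primes_containing) auto
  moreover have *: "p \<in> (\<Union>c\<in>C. {p \<in> primes_of R. r c \<in> p})"
    if "p \<in> primes_of R" "valuation_ring V" "R \<subseteq> V" "nonunits V \<inter> R = p" "\<not> Q V" for p V
  proof -
    obtain c where "c \<in> C" "\<not> (c \<in> V \<and> c \<notin> nonunits V)"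
      using C(3)[OF \<open>valuation_ring V\<close>] \<open>\<not> Q V\<close> by blast
    then have "r c \<in> nonunits V" using r(2) that by blast
    then show ?thesis using that r \<open>c \<in> C\<close> by blast
  qed
  ultimately show ?thesis
    by (elim finite_subset[rotated]) (use * in blast)
qed

section \<open>Etale points in affine charts\<close>

lemma infinite_UNIV_alg_closed: "infinite (UNIV :: 'a::alg_closed_field set)"
proof
  assume fin: "finite (UNIV :: 'a set)"
  define f where "f = (\<Prod>a\<in>(UNIV :: 'a set). [:- a, 1:]) + 1"
  have "degree (\<Prod>a\<in>(UNIV :: 'a set). [:- a, 1:]) = card (UNIV :: 'a set)"
    by (subst degree_prod_eq_sum_degree) auto
  moreover have "card (UNIV :: 'a set) > 0"
    using fin by (simp add: card_gt_0_iff)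
  ultimately have "degree f > 0"
    unfolding f_def by (subst degree_add_eq_left) auto
  then obtain x where x: "poly f x = 0"
    using alg_closed_imp_poly_has_root by blast
  have "poly (\<Prod>a\<in>(UNIV :: 'a set). [:- a, 1:]) x = 0"
    using fin by (auto simp: poly_prod)
  with x show False by (simp add: f_def)
qed

lemma poly_eq_cofinite:
  fixes f g :: "'a::alg_closed_field poly"
  assumes "finite {x. poly f x \<noteq> poly g x}"
  shows "f = g"
proof (rule ccontr)
  assume "f \<noteq> g"
  then have "finite {x. poly (f - g) x = 0}"
    by (intro poly_roots_finite) auto
  with assms have "finite ({x. poly f x \<noteq> poly g x} \<union> {x. poly (f - g) x = 0})"
    by blast
  moreover have "{x. poly f x \<noteq> poly g x} \<union> {x. poly (f - g) x = 0} = UNIV"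
    by auto
  ultimately show False using infinite_UNIV_alg_closed by metis
qed

section \<open>Binary forms and affine charts\<close>

lemma form_scale: "form n f (c * x) (c * y) = c ^ n * form n f x y"
proof -
  have "coeff f i * (c * x) ^ i * (c * y) ^ (n - i) = c ^ n * (coeff f i * x ^ i * y ^ (n - i))" if "i \<le> n" for i
  proof -
    have "c ^ n = c ^ i * c ^ (n - i)" using that by (simp flip: power_add)
    then show ?thesis by (simp add: power_mult_distrib mult_ac)
  qed
  then show ?thesis
    unfolding form_def sum_distrib_left by (intro sum.cong) auto
qed

text \<open>The Boolean selects the affine chart, so that arguments are given once for both:
  \<open>True\<close> normalizes the second coordinate to 1, \<open>False\<close> the first.\<close>

definition hom_x :: "bool \<Rightarrow> 'a::field \<Rightarrow> 'a" where "hom_x b t = (if b then t else 1)"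

definition hom_y :: "bool \<Rightarrow> 'a::field \<Rightarrow> 'a" where "hom_y b t = (if b then 1 else t)"

definition chart :: "bool \<Rightarrow> 'a::field \<Rightarrow> 'a proj1" where
  "chart b t = pt (hom_x b t) (hom_y b t)"

text \<open>In the chart \<open>False\<close> the coefficients are reversed relative to the formal
  degree \<open>n\<close>, which may exceed \<open>degree f\<close>; \<open>reflect_poly\<close>
  would lose the difference.\<close>

definition dehom :: "bool \<Rightarrow> nat \<Rightarrow> 'a::field poly \<Rightarrow> 'a poly" where
  "dehom b n f = (if b then f else (\<Sum>i\<le>n. monom (coeff f i) (n - i)))"

lemma hom_nonzero: "(hom_x b t, hom_y b t) \<noteq> (0, 0)"
  by (auto simp: hom_x_def hom_y_def)

lemma form_hom: "degree f \<le> n \<Longrightarrow> form n f (hom_x b t) (hom_y b t) = poly (dehom b n f) t"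
proof (cases b)
  case True
  assume "degree f \<le> n"
  then have "(\<Sum>i\<le>n. coeff f i * t ^ i) = (\<Sum>i\<le>degree f. coeff f i * t ^ i)"
    by (intro sum.mono_neutral_right) (auto simp: coeff_eq_0)
  then show ?thesis
    using True by (simp add: form_def hom_x_def hom_y_def dehom_def poly_altdef)
qed (simp add: form_def hom_x_def hom_y_def dehom_def poly_sum poly_monom)

lemma chart_eq_iff: "chart b s = chart b t \<longleftrightarrow> s = t"
  unfolding chart_def by (subst pt_eq_iff) (use hom_nonzero in \<open>auto simp: hom_x_def hom_y_def split: if_splits\<close>)

lemma inj_chart: "inj (chart b)"
  by (rule injI) (simp add: chart_eq_iff)

lemma pt_chart_True: "y \<noteq> 0 \<Longrightarrow> pt x y = chart True (x / y)"
  unfolding chart_def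
  by (subst pt_eq_iff) (auto simp: hom_x_def hom_y_def intro!: exI[of _ "inverse y"] simp: divide_inverse mult.commute)

lemma pt_chart_False: "x \<noteq> 0 \<Longrightarrow> pt x y = chart False (y / x)"
  unfolding chart_def
  by (subst pt_eq_iff) (auto simp: hom_x_def hom_y_def intro!: exI[of _ "inverse x"] simp: divide_inverse mult.commute)

lemma zariski_closed_finite:
  assumes "zariski_closed Z" "Z \<noteq> UNIV"
  shows "finite Z"
proof -
  obtain T where T: "\<forall>(n, f)\<in>T. degree f \<le> n"
    "Z = {pt x y |x y. (x, y) \<noteq> (0, 0) \<and> (\<forall>(n, f)\<in>T. form n f x y = 0)}"
    using assms(1) by (auto simp: zariski_closed_def)
  obtain P where "P \<notin> Z" using assms(2) by blast
  obtain x y where "(x, y) \<noteq> (0, 0)" "P = pt x y" by (rule pt_exhaust)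
  with \<open>P \<notin> Z\<close> obtain n f where nf: "(n, f) \<in> T" "form n f x y \<noteq> 0"
    unfolding T(2) by blast
  then have "f \<noteq> 0" by (auto simp: form_def)
  have deg: "degree f \<le> n" using T nf by blast
  have "Z \<subseteq> insert (pt 1 0) (chart True ` {t. poly f t = 0})"
  proof
    fix Q assume "Q \<in> Z"
    then obtain u v where uv: "(u, v) \<noteq> (0, 0)" "Q = pt u v" "form n f u v = 0"
      using nf unfolding T(2) by blast
    show "Q \<in> insert (pt 1 0) (chart True ` {t. poly f t = 0})"
    proof (cases "v = 0")
      case True
      then have "u \<noteq> 0" using uv by auto
      with True uv have "Q = pt 1 0"
        by (auto simp: pt_eq_iff intro!: exI[of _ "inverse u"])
      then show ?thesis by simp
    next
      case False
      then have "form n f u v = v ^ n * form n f (hom_x True (u / v)) (hom_y True (u / v))"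
        by (subst form_scale[symmetric]) (simp add: hom_x_def hom_y_def)
      then have "poly f (u / v) = 0"
        using uv False by (simp add: form_hom[OF deg] dehom_def)
      then show ?thesis
        using uv pt_chart_True[OF False, of u] by blast
    qed
  qed
  moreover have "finite (insert (pt 1 0) (chart True ` {t. poly f t = 0}))"
    using poly_roots_finite[OF \<open>f \<noteq> 0\<close>] by simp
  ultimately show ?thesis by (rule finite_subset)
qed

lemma near_cofinite:
  assumes "near P A"
  shows "A P" "finite {Q. \<not> A Q}"
proof -
  obtain U where U: "zariski_open U" "P \<in> U" "\<forall>Q\<in>U. A Q"
    using assms by (auto simp: near_def)
  then show "A P" by blast
  have "finite (- U)"
    using U by (intro zariski_closed_finite) (auto simp: zariski_open_def)
  then show "finite {Q. \<not> A Q}"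
    by (rule finite_subset[rotated]) (use U in blast)
qed

text \<open>The pullback of a binary form along the parametrization \<open>[A : B]\<close>, kept as
  a polynomial so that its order of vanishing can be studied.\<close>

definition eval_pair :: "nat \<Rightarrow> 'a::field poly \<Rightarrow> 'a poly \<Rightarrow> 'a poly \<Rightarrow> 'a poly" where
  "eval_pair n f A B = (\<Sum>i\<le>n. smult (coeff f i) (A ^ i * B ^ (n - i)))"

lemma poly_eval_pair: "poly (eval_pair n f A B) t = form n f (poly A t) (poly B t)"
  by (simp add: eval_pair_def form_def poly_sum mult.assoc)

lemma pderiv_sum: "pderiv (sum f I) = (\<Sum>i\<in>I. pderiv (f i))"
  by (induction I rule: infinite_finite_induct) (auto simp: pderiv_add)

text \<open>Euler's relation: a tangent vector proportional to the point multiplies a form by its degree.\<close>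

lemma pderiv_eval_pair:
  assumes A: "poly (pderiv A) z = c * poly A z" and B: "poly (pderiv B) z = c * poly B z"
  shows "poly (pderiv (eval_pair n f A B)) z = of_nat n * c * poly (eval_pair n f A B) z"
proof -
  have pow: "poly (pderiv (C ^ i)) z = of_nat i * c * poly (C ^ i) z"
    if "poly (pderiv C) z = c * poly C z" for C i
    by (induction i) (auto simp: pderiv_mult that algebra_simps)
  have "poly (pderiv (smult (coeff f i) (A ^ i * B ^ (n - i)))) z =
      of_nat n * c * poly (smult (coeff f i) (A ^ i * B ^ (n - i))) z" if "i \<le> n" for i
  proof -
    have "of_nat n = (of_nat i + of_nat (n - i) :: 'a)"
      using that by (simp flip: of_nat_add)
    then show ?thesis
      using pow[OF A, of i] pow[OF B, of "n - i"]
      by (simp add: pderiv_smult pderiv_mult algebra_simps)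
  qed
  then show ?thesis
    by (simp add: eval_pair_def pderiv_sum poly_sum sum_distrib_left)
qed

lemma regular_in_chart:
  assumes "regular_at (chart b z) g"
  obtains p q where "poly q z \<noteq> 0" "g (chart b z) = poly p z / poly q z"
    "finite {t. \<not> (poly q t \<noteq> 0 \<and> g (chart b t) = poly p t / poly q t)}"
proof -
  obtain n p q where deg: "degree p \<le> n" "degree q \<le> n"
    and near: "near (chart b z) (\<lambda>Q. \<forall>x y. (x, y) \<noteq> (0, 0) \<and> Q = pt x y \<longrightarrow>
           form n q x y \<noteq> 0 \<and> g Q = form n p x y / form n q x y)" (is "near _ ?A")
    using assms unfolding regular_at_def by blast
  have A: "poly (dehom b n q) t \<noteq> 0 \<and> g (chart b t) = poly (dehom b n p) t / poly (dehom b n q) t"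
    if "?A (chart b t)" for t
  proof -
    have "form n q (hom_x b t) (hom_y b t) \<noteq> 0 \<and>
        g (chart b t) = form n p (hom_x b t) (hom_y b t) / form n q (hom_x b t) (hom_y b t)"
      using that hom_nonzero[of b t] chart_def[of b t] by blast
    then show ?thesis by (simp add: form_hom deg)
  qed
  have "finite (chart b -` {Q. \<not> ?A Q})"
    using near_cofinite(2)[OF near] inj_chart by (rule finite_vimageI)
  then have "finite {t. \<not> (poly (dehom b n q) t \<noteq> 0 \<and> g (chart b t) = poly (dehom b n p) t / poly (dehom b n q) t)}"
    by (rule finite_subset[rotated]) (use A in blast)
  with that A[OF near_cofinite(1)[OF near]] show thesis by blast
qed

text \<open>Where the Wronskian vanishes, \<open>(A', B')\<close> is proportional to
  \<open>(A, B)\<close>, so by Euler's relation the pulled back numerator, which vanishes at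
  \<open>z\<close>, has vanishing derivative there. Finiteness of the fibres turns the exceptional
  points of \<open>h\<close> into finitely many parameters \<open>t\<close>.\<close>

lemma regular_pullback:
  assumes fin: "finite_morphism \<phi>"
    and \<phi>: "\<And>t. (poly A t, poly B t) \<noteq> (0, 0)" "\<And>t. \<phi> (chart b t) = pt (poly A t) (poly B t)"
    and w: "poly (pderiv A * B - A * pderiv B) z = 0"
    and h: "regular_at (\<phi> (chart b z)) h" "h (\<phi> (chart b z)) = 0"
  obtains p q where "[:- z, 1:] ^ 2 dvd p" "poly q z \<noteq> 0"
    "finite {t. \<not> (poly q t \<noteq> 0 \<and> h (\<phi> (chart b t)) = poly p t / poly q t)}"
proof -
  obtain n p q where deg: "degree p \<le> n" "degree q \<le> n"
    and near: "near (\<phi> (chart b z)) (\<lambda>Q. \<forall>x y. (x, y) \<noteq> (0, 0) \<and> Q = pt x y \<longrightarrow>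
           form n q x y \<noteq> 0 \<and> h Q = form n p x y / form n q x y)" (is "near _ ?A")
    using h(1) unfolding regular_at_def by blast
  let ?p = "eval_pair n p A B" and ?q = "eval_pair n q A B"
  have A: "poly ?q t \<noteq> 0 \<and> h (\<phi> (chart b t)) = poly ?p t / poly ?q t"
    if "?A (\<phi> (chart b t))" for t
    using that \<phi>(1)[of t] \<phi>(2)[of t] unfolding poly_eval_pair by blast
  have at_z: "poly ?q z \<noteq> 0 \<and> h (\<phi> (chart b z)) = poly ?p z / poly ?q z"
    by (rule A) (rule near_cofinite(1)[OF near])
  have "\<phi> -` {Q. \<not> ?A Q} = (\<Union>Q\<in>{Q. \<not> ?A Q}. \<phi> -` {Q})" by auto
  also have "finite \<dots>"
    using near_cofinite(2)[OF near] fin by (intro finite_UN_I) (auto simp: finite_morphism_def)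
  finally have "finite (chart b -` (\<phi> -` {Q. \<not> ?A Q}))"
    using inj_chart by (rule finite_vimageI)
  then have "finite {t. \<not> (poly ?q t \<noteq> 0 \<and> h (\<phi> (chart b t)) = poly ?p t / poly ?q t)}"
    by (rule finite_subset[rotated]) (use A in blast)
  moreover have "[:- z, 1:] ^ 2 dvd ?p"
  proof (rule double_root_dvd)
    show root: "poly ?p z = 0" using at_z h(2) by (metis divide_eq_0_iff)
    obtain c where c: "poly (pderiv A) z = c * poly A z" "poly (pderiv B) z = c * poly B z"
    proof (cases "poly B z = 0")
      case True
      then have "poly A z \<noteq> 0" using \<phi>(1)[of z] by auto
      with True w that[of "poly (pderiv A) z / poly A z"] show thesis by simp
    next
      case False
      with w that[of "poly (pderiv B) z / poly B z"] show thesis by (simp add: field_simps)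
    qed
    show "poly (pderiv ?p) z = 0" using pderiv_eval_pair[OF c, of n p] root by simp
  qed
  ultimately show thesis using at_z that by blast
qed

lemma chart_parameter:
  obtains f where "regular_at (chart b z) f" "\<And>t. f (chart b t) = t - z"
proof -
  define f where "f Q = inv_into UNIV (chart b) Q - z" for Q
  have f: "f (chart b t) = t - z" for t
    by (simp add: f_def inj_chart)
  \<comment> \<open>The local parameter is \<open>(x - z * y) / y\<close> in one chart and
    \<open>(y - z * x) / x\<close> in the other, written as quotients of linear forms.\<close>
  define p q where "p = (if b then [:- z, 1:] else [:1, - z:])" and "q = (if b then [:1:] else [:0, 1 :: 'a:])"
  have form1: "form (Suc 0) r x y = coeff r 0 * y + coeff r 1 * x" for r and x y :: 'a
    by (simp add: form_def atMost_Suc)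
  define U where "U = - {pt x y |x y. (x, y) \<noteq> (0, 0) \<and> form 1 q x y = 0}"
  have "zariski_closed (- U)"
    unfolding zariski_closed_def
    by (intro exI[of _ "{(1, q)}"]) (auto simp: U_def q_def)
  moreover have "chart b z \<in> U"
  proof (rule ccontr)
    assume "chart b z \<notin> U"
    then obtain x y where xy: "(x, y) \<noteq> (0, 0)" "form 1 q x y = 0" "chart b z = pt x y"
      by (auto simp: U_def)
    then obtain c where "c \<noteq> 0" "x = c * hom_x b z" "y = c * hom_y b z"
      using pt_eq_iff[OF hom_nonzero[of b z] xy(1)] by (auto simp: chart_def)
    with xy show False
      by (auto simp: form1 q_def hom_x_def hom_y_def split: if_splits)
  qed
  moreover have "form 1 q x y \<noteq> 0 \<and> f Q = form 1 p x y / form 1 q x y"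
    if "Q \<in> U" "(x, y) \<noteq> (0, 0)" "Q = pt x y" for Q x y
  proof -
    have nz: "form 1 q x y \<noteq> 0" using that by (auto simp: U_def)
    have "f Q = form 1 p x y / form 1 q x y"
    proof (cases b)
      case True
      then have "y \<noteq> 0" using nz by (simp add: form1 q_def)
      with True that show ?thesis
        using pt_chart_True[of y x] f[of "x / y"] by (simp add: form1 p_def q_def field_simps)
    next
      case False
      then have "x \<noteq> 0" using nz by (simp add: form1 q_def)
      with False that show ?thesis
        using pt_chart_False[of x y] f[of "y / x"] by (simp add: form1 p_def q_def field_simps)
    qed
    with nz show ?thesis by blast
  qed
  ultimately have "regular_at (chart b z) f"
    unfolding regular_at_def near_def zariski_open_def
    by (intro exI[of _ 1] exI[of _ p] exI[of _ q] conjI exI[of _ U]) (auto simp: p_def q_def)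
  with f that show thesis by blast
qed

text \<open>Were the Wronskian zero at \<open>z\<close>, every pullback of a function vanishing at
  the image point would be divisible by the square of \<open>t - z\<close>, and the local parameter
  \<open>t - z\<close> could not lie in the ideal these pullbacks generate.\<close>

lemma unramified_wronskian:
  fixes \<phi> :: "'a::alg_closed_field proj1 \<Rightarrow> 'a proj1"
  assumes fin: "finite_morphism \<phi>"
    and \<phi>: "\<And>t. (poly A t, poly B t) \<noteq> (0, 0)" "\<And>t. \<phi> (chart b t) = pt (poly A t) (poly B t)"
    and unr: "unramified_at \<phi> (chart b z)"
  shows "poly (pderiv A * B - A * pderiv B) z \<noteq> 0"
proof
  assume w: "poly (pderiv A * B - A * pderiv B) z = 0"
  obtain f where f: "regular_at (chart b z) f" "\<And>t. f (chart b t) = t - z"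
    using chart_parameter by blast
  have "\<exists>(m::nat) g h. (\<forall>i<m. regular_at (chart b z) (g i) \<and> regular_at (\<phi> (chart b z)) (h i) \<and> h i (\<phi> (chart b z)) = 0) \<and>
      near (chart b z) (\<lambda>Q. f Q = (\<Sum>i<m. g i Q * h i (\<phi> Q)))"
    using unr[unfolded unramified_at_def, rule_format, of f] f by simp
  then obtain m :: nat and g h where
    gh: "\<And>i. i < m \<Longrightarrow> regular_at (chart b z) (g i)" "\<And>i. i < m \<Longrightarrow> regular_at (\<phi> (chart b z)) (h i)"
      "\<And>i. i < m \<Longrightarrow> h i (\<phi> (chart b z)) = 0"
    and near: "near (chart b z) (\<lambda>Q. f Q = (\<Sum>i<m. g i Q * h i (\<phi> Q)))"
    by blast
  define good where "good u a c \<longleftrightarrow> finite {t. \<not> (poly c t \<noteq> 0 \<and> u t = poly a t / poly c t)}"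
    for u :: "'a \<Rightarrow> 'a" and a c :: "'a poly"
  have "\<exists>a c. poly c z \<noteq> 0 \<and> good (\<lambda>t. g i (chart b t)) a c" if "i < m" for i
    unfolding good_def by (rule regular_in_chart[OF gh(1)[OF that]]) blast
  then obtain a c where ac: "\<And>i. i < m \<Longrightarrow> poly (c i) z \<noteq> 0" "\<And>i. i < m \<Longrightarrow> good (\<lambda>t. g i (chart b t)) (a i) (c i)"
    by metis
  have "\<exists>p q. [:- z, 1:] ^ 2 dvd p \<and> poly q z \<noteq> 0 \<and> good (\<lambda>t. h i (\<phi> (chart b t))) p q" if "i < m" for i
    unfolding good_def by (rule regular_pullback[OF fin \<phi> w gh(2,3)[OF that]]) blast+
  then obtain p q where pq: "\<And>i. i < m \<Longrightarrow> [:- z, 1:] ^ 2 dvd p i" "\<And>i. i < m \<Longrightarrow> poly (q i) z \<noteq> 0"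
    "\<And>i. i < m \<Longrightarrow> good (\<lambda>t. h i (\<phi> (chart b t))) (p i) (q i)"
    by metis
  \<comment> \<open>\<open>D {..<m}\<close> is a common denominator, nonzero at \<open>z\<close>.
    Clearing it turns the local identity into one between polynomials, valid off the finite set
    \<open>bad\<close> and hence everywhere.\<close>
  define D where "D I = (\<Prod>i\<in>I. c i * q i)" for I
  define bad where "bad = chart b -` {Q. f Q \<noteq> (\<Sum>i<m. g i Q * h i (\<phi> Q))} \<union>
    (\<Union>i<m. {t. \<not> (poly (c i) t \<noteq> 0 \<and> g i (chart b t) = poly (a i) t / poly (c i) t)}) \<union>
    (\<Union>i<m. {t. \<not> (poly (q i) t \<noteq> 0 \<and> h i (\<phi> (chart b t)) = poly (p i) t / poly (q i) t)})"
  have "finite bad"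
    unfolding bad_def using ac(2) pq(3) unfolding good_def using near_cofinite(2)[OF near] inj_chart[of b]
    by (intro finite_UnI finite_vimageI) auto
  moreover have "poly ([:- z, 1:] * D {..<m}) t = poly (\<Sum>i<m. a i * p i * D ({..<m} - {i})) t"
    if "t \<notin> bad" for t
  proof -
    have eqs: "poly (c i) t \<noteq> 0" "g i (chart b t) = poly (a i) t / poly (c i) t"
      "poly (q i) t \<noteq> 0" "h i (\<phi> (chart b t)) = poly (p i) t / poly (q i) t" if "i < m" for i
      using \<open>t \<notin> bad\<close> that unfolding bad_def by blast+
    have "t - z = (\<Sum>i<m. g i (chart b t) * h i (\<phi> (chart b t)))"
      using that f(2)[of t] by (simp add: bad_def)
    then have "poly ([:- z, 1:] * D {..<m}) t =
        (\<Sum>i<m. g i (chart b t) * h i (\<phi> (chart b t)) * poly (D {..<m}) t)"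
      by (simp add: sum_distrib_right[symmetric]) (simp add: left_diff_distrib[symmetric])
    also have "\<dots> = (\<Sum>i<m. poly (a i * p i * D ({..<m} - {i})) t)"
    proof (rule sum.cong[OF refl])
      fix i assume "i \<in> {..<m}"
      then have i: "i < m" "D {..<m} = c i * q i * D ({..<m} - {i})"
        unfolding D_def by (auto intro: prod.remove)
      then show "g i (chart b t) * h i (\<phi> (chart b t)) * poly (D {..<m}) t = poly (a i * p i * D ({..<m} - {i})) t"
        using eqs[of i] by simp
    qed
    finally show ?thesis by (simp add: poly_sum)
  qed
  then have "{t. poly ([:- z, 1:] * D {..<m}) t \<noteq> poly (\<Sum>i<m. a i * p i * D ({..<m} - {i})) t} \<subseteq> bad"
    by blast
  ultimately have "[:- z, 1:] * D {..<m} = (\<Sum>i<m. a i * p i * D ({..<m} - {i}))"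
    by (intro poly_eq_cofinite) (elim finite_subset[rotated])
  moreover have "[:- z, 1:] ^ 2 dvd (\<Sum>i<m. a i * p i * D ({..<m} - {i}))"
    using pq(1) by (intro dvd_sum) (auto intro: dvd_mult2 dvd_mult)
  ultimately have "[:- z, 1:] * [:- z, 1:] dvd [:- z, 1:] * D {..<m}"
    by (simp only: power2_eq_square)
  then have "[:- z, 1:] dvd D {..<m}"
    by (subst (asm) dvd_mult_cancel_left) auto
  then have "poly (D {..<m}) z = 0" by (simp add: poly_eq_0_iff_dvd)
  moreover have "poly (D {..<m}) z \<noteq> 0"
    using ac(1) pq(2) by (auto simp: D_def poly_prod)
  ultimately show False by simp
qed

section \<open>Reduction of post-critically finite maps\<close>

text \<open>A root of the generator of the ideal of \<open>A\<close> and \<open>B\<close> would be a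
  common root; without roots the generator is constant.\<close>

lemma bezout_poly:
  fixes A B :: "'a::alg_closed_field poly"
  assumes "\<And>x. (poly A x, poly B x) \<noteq> (0, 0)"
  obtains u v where "u * A + v * B = 1"
proof -
  have U: "local_subdomain UNIV {0 :: 'a}" using subfield_set.local_subdomain_0[OF subfield_set_UNIV] .
  interpret local_subdomain UNIV "{0 :: 'a}" by (rule U)
  have all: "f \<in> poly_over UNIV" for f :: "'a poly" by (simp add: poly_over_def)
  define J where "J = {u * A + v * B |u v. True}"
  have J: "A \<in> J" "B \<in> J"
    by (force simp: J_def intro: exI[of _ 1] exI[of _ 0])+
  have "A \<noteq> 0 \<or> B \<noteq> 0" using assms[of 0] by auto
  then obtain g where g: "g \<in> J" "g \<notin> poly_over {0}" using J by (auto simp: poly_over_zero)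
  have diffJ: "f - h \<in> J" if fh: "f \<in> J" "h \<in> J" for f h
  proof -
    obtain u v u' v' where "f = u * A + v * B" "h = u' * A + v' * B" using fh unfolding J_def by blast
    then have "f - h = (u - u') * A + (v - v') * B" by (simp add: algebra_simps)
    then show ?thesis by (auto simp: J_def)
  qed
  have multJ: "f * h \<in> J" if h: "h \<in> J" for f h
  proof -
    obtain u v where "h = u * A + v * B" using h unfolding J_def by blast
    then have "f * h = (f * u) * A + (f * v) * B" by (simp add: algebra_simps)
    then show ?thesis by (auto simp: J_def)
  qed
  have zeroJ: "0 \<in> J" using diffJ[OF J(1) J(1)] by simp
  obtain d where d: "d \<in> J" "lead_coeff d = 1" "\<And>g. g \<in> J \<Longrightarrow> \<exists>q\<in>poly_over UNIV. g - d * q \<in> poly_over {0}"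
    by (rule poly_ideal_generator[of J g]) (use all diffJ multJ zeroJ g in \<open>auto simp: poly_over_zero\<close>)
  have "degree d = 0"
  proof (rule ccontr)
    assume "degree d \<noteq> 0"
    then obtain x where x: "poly d x = 0" using alg_closed_imp_poly_has_root by blast
    have "poly f x = 0" if "f \<in> J" for f using d(3)[OF that] x by (auto simp: poly_over_zero)
    then show False using J assms[of x] by auto
  qed
  then have "d = 1" using d(2) by (metis degree_0_id one_pCons)
  then show thesis using d(1) that by (auto simp: J_def)
qed

text \<open>Abstracts the perfect closure of a henselian \<open>E\<close>. Closure under
  \<open>q\<close>-th roots absorbs inseparable elements, of which only a power is a simple
  root.\<close>

definition henselian_over :: "'a::field set \<Rightarrow> 'a set \<Rightarrow> 'a set \<Rightarrow> bool" where
  "henselian_over K V F \<longleftrightarrow> subfield_set F \<and> K \<subseteq> F \<and> henselian V F \<and>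
     (\<forall>q x. frobenius_exponent TYPE('a) q \<and> x ^ q \<in> F \<longrightarrow> x \<in> F)"

text \<open>Some power \<open>z ^ q\<close> is a simple root of a polynomial \<open>g\<close> over
  \<open>K\<close>. For almost all \<open>V\<close> it stays simple modulo \<open>V\<close>, and
  then it lies in every \<open>F\<close> at once.\<close>

lemma generic_algebraic:
  fixes K :: "'a::field set"
  assumes "subfield_set K" "algebraic_over K z"
  shows "eventually (\<lambda>V. \<forall>F. henselian_over K V F \<longrightarrow> z \<in> F) generic"
proof -
  obtain q g where q: "frobenius_exponent TYPE('a) q" and g: "g \<in> poly_over K" "poly g (z ^ q) = 0"
    "poly (pderiv g) (z ^ q) \<noteq> 0"
    by (rule algebraic_simple_root[OF assms])
  show ?thesis
    using generic_mem[of "z ^ q"] generic_unit[OF g(3)] generic_poly[of g]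
  proof eventually_elim
    case (elim V)
    show ?case
    proof (intro allI impI)
      fix F assume F: "henselian_over K V F"
      then have "g \<in> poly_over (F \<inter> V)"
        using g elim by (auto simp: henselian_over_def poly_over_def)
      then have "z ^ q \<in> F"
        using F g elim unfolding henselian_over_def henselian_def by blast
      with F q show "z \<in> F" by (auto simp: henselian_over_def)
    qed
  qed
qed

lemma generic_rational:
  fixes K :: "'a::field set"
  assumes "subfield_set K" "\<And>x. algebraic_over K x"
  shows "eventually (\<lambda>V. \<forall>F. henselian_over K V F \<longrightarrow> P \<in> rational_points F) generic"
proof -
  obtain x y where P: "(x, y) \<noteq> (0, 0)" "P = pt x y" by (rule pt_exhaust)
  show ?thesis
    using generic_algebraic[OF assms, of x] generic_algebraic[OF assms, of y]
  proof eventually_elim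
    case (elim V)
    then show ?case using P by (auto simp: rational_points_def)
  qed
qed

text \<open>Two points are congruent if they have the same reduction modulo the maximal ideal of \<open>V\<close>.\<close>

definition congruent_points :: "'a::field set \<Rightarrow> 'a proj1 \<Rightarrow> 'a proj1 \<Rightarrow> bool" where
  "congruent_points V P Q \<longleftrightarrow>
     (\<exists>b. \<exists>x\<in>V. \<exists>y\<in>V. P = chart b x \<and> Q = chart b y \<and> x - y \<in> nonunits V)"

lemma generic_not_congruent:
  assumes "P \<noteq> Q"
  shows "eventually (\<lambda>V. \<not> congruent_points V P Q) generic"
proof -
  have "eventually (\<lambda>V. \<not> (\<exists>x\<in>V. \<exists>y\<in>V. P = chart b x \<and> Q = chart b y \<and> x - y \<in> nonunits V)) generic" for b
  proof (cases "\<exists>x y. P = chart b x \<and> Q = chart b y")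
    case True
    then obtain x y where xy: "P = chart b x" "Q = chart b y" by blast
    then have "x - y \<noteq> 0" using assms by auto
    from generic_unit[OF this] show ?thesis
      by eventually_elim (auto simp: xy chart_eq_iff)
  qed auto
  from this[of True] this[of False] show ?thesis
    by eventually_elim (auto simp: congruent_points_def ex_bool_eq)
qed

section \<open>Rational points in charts with integral coordinate\<close>

lemma rational_chart_iff:
  assumes "subfield_set F" shows "chart b x \<in> rational_points F \<longleftrightarrow> x \<in> F"
proof
  interpret subfield_set F by fact
  show "chart b x \<in> rational_points F" if "x \<in> F"
  proof -
    have "hom_x b x \<in> F" "hom_y b x \<in> F"
      using that one_mem by (auto simp: hom_x_def hom_y_def)
    then show ?thesis
      unfolding rational_points_def chart_def using hom_nonzero[of b x] by blast
  qed
  assume "chart b x \<in> rational_points F"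
  then obtain u v where uv: "u \<in> F" "v \<in> F" "(u, v) \<noteq> (0, 0)" "chart b x = pt u v"
    by (auto simp: rational_points_def)
  then obtain c where "c \<noteq> 0" "u = c * hom_x b x" "v = c * hom_y b x"
    using pt_eq_iff[OF hom_nonzero[of b x] uv(3)] by (auto simp: chart_def)
  then have "x = u / v \<or> x = v / u"
    by (auto simp: hom_x_def hom_y_def split: if_splits)
  then show "x \<in> F" using uv divide_mem by auto
qed

lemma rational_point_cases:
  assumes "subfield_set F" "P \<in> rational_points F" "valuation_ring V"
  obtains b x where "x \<in> F" "x \<in> V" "P = chart b x"
proof -
  interpret subfield_set F by fact
  interpret V: valuation_ring V by fact
  obtain u v where uv: "u \<in> F" "v \<in> F" "(u, v) \<noteq> (0, 0)" "P = pt u v"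
    using assms by (auto simp: rational_points_def)
  show thesis
  proof (cases "v \<noteq> 0 \<and> u / v \<in> V")
    case True
    then show thesis using uv pt_chart_True[of v u] that[of "u / v" True] divide_mem by auto
  next
    case False
    have "u \<noteq> 0 \<and> v / u \<in> V"
      using False uv V.total[of "u / v"] V.zero_mem by (cases "u = 0"; cases "v = 0") auto
    then show thesis using uv pt_chart_False[of u v] that[of "v / u" False] divide_mem by auto
  qed
qed

text \<open>
  The map \<open>[A : B]\<close> in a chart, with Wronskian \<open>A' B - A B'\<close>.  If it takes a rational value
  \<open>[\<beta>\<^sub>0 : \<beta>\<^sub>1]\<close> at \<open>x\<close>, then \<open>x\<close> is a root of \<open>\<beta>\<^sub>1 A - \<beta>\<^sub>0 B\<close>, whose derivative at \<open>x\<close> is a multiple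
  of the Wronskian.
\<close>

lemma preimage_mem_henselian:
  assumes V: "valuation_ring V" and F: "henselian_over K V F"
    and AB: "A \<in> poly_over (K \<inter> V)" "B \<in> poly_over (K \<inter> V)"
    and uv: "u \<in> poly_over V" "v \<in> poly_over V" "u * A + v * B = 1"
    and x: "x \<in> V" "pt (poly A x) (poly B x) \<in> rational_points F"
    and w: "poly (pderiv A * B - A * pderiv B) x \<notin> nonunits V"
  shows "x \<in> F"
proof -
  interpret V: valuation_ring V by fact
  interpret F: subfield_set F using F by (simp add: henselian_over_def)
  have KF: "K \<subseteq> F" and hF: "henselian V F" using F by (auto simp: henselian_over_def)
  have mem: "poly A x \<in> V" "poly B x \<in> V" "poly u x \<in> V" "poly v x \<in> V"
    using AB uv x by (auto simp: poly_over_Int intro: V.poly_mem)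
  have one: "poly u x * poly A x + poly v x * poly B x = 1"
    using arg_cong[OF uv(3), of "\<lambda>f. poly f x"] by simp
  have prim: "poly A x \<notin> nonunits V \<or> poly B x \<notin> nonunits V"
    using one V.ideal_add V.ideal_mult mem V.one_notin by metis
  obtain b y where y: "y \<in> F" "y \<in> V" "pt (poly A x) (poly B x) = chart b y"
    by (rule rational_point_cases[OF F.subfield_set_axioms x(2) V])
  define c d where "c = hom_x b y" and "d = hom_y b y"
  have cd: "c \<in> F \<inter> V" "d \<in> F \<inter> V"
    using y by (auto simp: c_def d_def hom_x_def hom_y_def intro: V.one_mem F.one_mem)
  have "(poly A x, poly B x) \<noteq> (0, 0)" using prim V.ideal_zero by auto
  then obtain l where l: "l \<noteq> 0" "poly A x = l * c" "poly B x = l * d"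
    using pt_eq_iff[OF hom_nonzero[of b y], of "poly A x" "poly B x"] y(3)
    unfolding chart_def c_def d_def by metis
  \<comment> \<open>One of the homogeneous coordinates \<open>c\<close>, \<open>d\<close> is 1, so
    \<open>l\<close> is a value of \<open>A\<close> or \<open>B\<close>.\<close>
  have lV: "l \<in> V"
    using l mem by (cases b) (auto simp: c_def d_def hom_x_def hom_y_def)
  define f where "f = smult d A - smult c B"
  have "subdomain (F \<inter> V)"
    by unfold_locales (auto intro: F.ring_mem V.ring_mem)
  moreover have "A \<in> poly_over (F \<inter> V)" "B \<in> poly_over (F \<inter> V)"
    using AB KF by (auto simp: poly_over_def)
  ultimately have f: "f \<in> poly_over (F \<inter> V)"
    unfolding f_def using cd by (intro subdomain.poly_over_diff subdomain.poly_over_smult)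
  have root: "poly f x = 0" by (simp add: f_def l)
  have "l * poly (pderiv f) x = poly (pderiv A * B - A * pderiv B) x"
    by (simp add: f_def pderiv_diff pderiv_smult l algebra_simps)
  then have "poly (pderiv f) x \<notin> nonunits V"
    using w V.ideal_mult[OF lV] by metis
  with f root x(1) hF show ?thesis unfolding henselian_def by blast
qed

text \<open>The Bezout relation over \<open>V\<close> keeps \<open>A\<close> and \<open>B\<close>
  from vanishing together modulo the maximal ideal, so one of the two values is a unit at
  \<open>x\<close>, hence also at \<open>y\<close>, and both images lie in the same chart with
  coordinates in \<open>V\<close>.\<close>

lemma congruent_image:
  assumes V: "valuation_ring V"
    and AB: "A \<in> poly_over V" "B \<in> poly_over V" and uv: "u \<in> poly_over V" "v \<in> poly_over V" "u * A + v * B = 1"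
    and xy: "x \<in> V" "y \<in> V" "x - y \<in> nonunits V"
  shows "congruent_points V (pt (poly A x) (poly B x)) (pt (poly A y) (poly B y))"
proof -
  interpret V: valuation_ring V by fact
  have mem: "poly A z \<in> V" "poly B z \<in> V" "poly u z \<in> V" "poly v z \<in> V" if "z \<in> V" for z
    using AB uv that by (auto intro: V.poly_mem)
  have one: "poly u x * poly A x + poly v x * poly B x = 1"
    using arg_cong[OF uv(3), of "\<lambda>f. poly f x"] by simp
  have prim: "poly A x \<notin> nonunits V \<or> poly B x \<notin> nonunits V"
    using one V.ideal_add V.ideal_mult mem[OF xy(1)] V.one_notin by metis
  have cA: "poly A x - poly A y \<in> nonunits V" and cB: "poly B x - poly B y \<in> nonunits V"
    using AB xy by (auto intro: V.poly_cong_arg)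
  have aux: "s / r \<in> V \<and> s' / r' \<in> V \<and> s / r - s' / r' \<in> nonunits V \<and> r \<noteq> 0 \<and> r' \<noteq> 0"
    if "r \<in> V" "s \<in> V" "r' \<in> V" "s' \<in> V" "r \<notin> nonunits V" "r - r' \<in> nonunits V" "s - s' \<in> nonunits V" for r s r' s'
  proof -
    have r: "V.unit r" "V.unit r'" using that V.ideal_cong by auto
    then have nz: "r \<noteq> 0" "r' \<noteq> 0" using V.unit_nonzero by auto
    have "s / r - s' / r' = inverse (r * r') * (r' * (s - s') - s' * (r - r'))"
      using nz by (simp add: field_simps)
    also have "\<dots> \<in> nonunits V"
      by (rule V.ideal_mult[OF _ V.ideal_diff[OF V.ideal_mult[OF _ that(7)] V.ideal_mult[OF _ that(6)]]])
        (use that V.unit_inverse[OF V.unit_mult[OF r]] in auto)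
    finally show ?thesis using that r nz V.divide_unit_mem by blast
  qed
  from prim show ?thesis
  proof
    assume "poly B x \<notin> nonunits V"
    with aux[of "poly B x" "poly A x" "poly B y" "poly A y"] mem xy cA cB
    have "poly A x / poly B x \<in> V" "poly A y / poly B y \<in> V" "poly A x / poly B x - poly A y / poly B y \<in> nonunits V"
      "poly B x \<noteq> 0" "poly B y \<noteq> 0" by auto
    then show ?thesis unfolding congruent_points_def using pt_chart_True by blast
  next
    assume "poly A x \<notin> nonunits V"
    with aux[of "poly A x" "poly B x" "poly A y" "poly B y"] mem xy cA cB
    have "poly B x / poly A x \<in> V" "poly B y / poly A y \<in> V" "poly B x / poly A x - poly B y / poly A y \<in> nonunits V"
      "poly A x \<noteq> 0" "poly A y \<noteq> 0" by auto
    then show ?thesis unfolding congruent_points_def using pt_chart_False by blast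
  qed
qed

lemma coeff_dehom_mem: "subdomain K \<Longrightarrow> f \<in> poly_over K \<Longrightarrow> dehom b n f \<in> poly_over K"
proof (cases b)
  assume K: "subdomain K" "f \<in> poly_over K" "\<not> b"
  then have "coeff f i \<in> K" for i by (simp add: poly_over_def)
  with K show ?thesis
    by (simp add: dehom_def subdomain.poly_over_sum subdomain.poly_over_monom)
qed (simp add: dehom_def)

lemma generic_chart:
  fixes \<phi> :: "'a::alg_closed_field proj1 \<Rightarrow> 'a proj1"
  assumes K: "subfield_set K" and mor: "P1_morphism K \<phi>" and fin: "finite_morphism \<phi>"
    and Z: "finite Z" and unr: "\<forall>P. P \<notin> Z \<longrightarrow> unramified_at \<phi> P"
  shows "eventually (\<lambda>V. (\<forall>x\<in>V. \<forall>F. henselian_over K V F \<longrightarrow> \<phi> (chart b x) \<in> rational_points F \<longrightarrow>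
      (\<forall>z\<in>Z. \<not> congruent_points V (chart b x) z) \<longrightarrow> x \<in> F) \<and>
      (\<forall>x\<in>V. \<forall>y\<in>V. x - y \<in> nonunits V \<longrightarrow> congruent_points V (\<phi> (chart b x)) (\<phi> (chart b y)))) generic"
proof -
  interpret K: subfield_set K by fact
  obtain d F G where FG: "F \<in> poly_over K" "G \<in> poly_over K" "degree F \<le> d" "degree G \<le> d"
    and \<phi>: "\<And>x y. (x, y) \<noteq> (0, 0) \<Longrightarrow> (form d F x y, form d G x y) \<noteq> (0, 0)"
      "\<And>x y. (x, y) \<noteq> (0, 0) \<Longrightarrow> \<phi> (pt x y) = pt (form d F x y) (form d G x y)"
    using mor unfolding P1_morphism_def by blast
  define A B where "A = dehom b d F" and "B = dehom b d G"
  have AK: "A \<in> poly_over K" "B \<in> poly_over K"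
    using FG K.subdomain_axioms by (auto simp: A_def B_def intro: coeff_dehom_mem)
  have nz: "(poly A t, poly B t) \<noteq> (0, 0)" for t
    using \<phi>(1)[OF hom_nonzero[of b t]] FG by (simp add: A_def B_def form_hom)
  have \<phi>_chart: "\<phi> (chart b t) = pt (poly A t) (poly B t)" for t
    using \<phi>(2)[OF hom_nonzero[of b t]] FG by (simp add: A_def B_def form_hom chart_def)
  \<comment> \<open>Good reduction of \<open>\<phi>\<close>: this identity is fixed once, and its
    coefficients lie in almost every \<open>V\<close>.\<close>
  obtain u v where uv: "u * A + v * B = 1"
    using bezout_poly[OF nz] by blast
  define w where "w = pderiv A * B - A * pderiv B"
  have wz: "chart b t \<in> Z" if "poly w t = 0" for t
    using unramified_wronskian[OF fin nz \<phi>_chart, of t] unr that by (auto simp: w_def)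
  have "w \<noteq> 0"
  proof
    assume "w = 0"
    then have "chart b -` Z = UNIV" using wz by auto
    then show False using finite_vimageI[OF Z inj_chart[of b]] infinite_UNIV_alg_closed by metis
  qed
  then have "lead_coeff w \<noteq> 0" by simp
  from generic_unit[OF this] generic_valuation generic_poly[of A] generic_poly[of B] generic_poly[of u] generic_poly[of v]
  show ?thesis
  proof eventually_elim
    case (elim V)
    interpret V: valuation_ring V by fact
    have wV: "w \<in> poly_over V"
      unfolding w_def using elim by (intro V.poly_over_diff V.poly_over_mult V.poly_over_pderiv)
    show ?case
    proof (intro conjI ballI allI impI)
      fix x F assume x: "x \<in> V" and F: "henselian_over K V F" "\<phi> (chart b x) \<in> rational_points F"
        and nc: "\<forall>z\<in>Z. \<not> congruent_points V (chart b x) z"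
      have "poly w x \<notin> nonunits V"
      proof
        assume wx: "poly w x \<in> nonunits V"
        \<comment> \<open>Made monic, the Wronskian has a root \<open>z\<close> in the residue class
          of \<open>x\<close>; roots of the Wronskian give points of \<open>Z\<close>, against the
          hypothesis on \<open>x\<close>.\<close>
        define H where "H = smult (inverse (lead_coeff w)) w"
        have inv: "inverse (lead_coeff w) \<in> V"
          using elim by (intro V.inverse_mem) auto
        have "H \<in> poly_over V" unfolding H_def by (intro V.poly_over_smult inv wV)
        moreover have "lead_coeff H = 1" using \<open>w \<noteq> 0\<close> by (simp add: H_def)
        moreover have "poly H x \<in> nonunits V"
          unfolding H_def poly_smult by (rule V.ideal_mult[OF inv wx])
        ultimately obtain z where z: "z \<in> V" "poly H z = 0" "x - z \<in> nonunits V"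
          using monic_root_mod[OF V.valuation_ring_axioms _ _ x] by blast
        then have "poly w z = 0" using \<open>w \<noteq> 0\<close> by (simp add: H_def)
        then have "chart b z \<in> Z" by (rule wz)
        moreover have "congruent_points V (chart b x) (chart b z)"
          using z x unfolding congruent_points_def by blast
        ultimately show False using nc by blast
      qed
      then show "x \<in> F"
        using elim AK F x uv unfolding \<phi>_chart w_def
        by (intro preimage_mem_henselian[of V K F A B u v x]) (auto simp: poly_over_Int)
    next
      fix x y assume "x \<in> V" "y \<in> V" "x - y \<in> nonunits V"
      then show "congruent_points V (\<phi> (chart b x)) (\<phi> (chart b y))"
        unfolding \<phi>_chart using elim uv by (intro congruent_image[of V A B u v])
    qed
  qed
qed

text \<open>The conditions on \<open>V\<close> involve only \<open>\<phi>\<close>, \<open>Z\<close>,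
  the preimage of \<open>Z\<close> and \<open>\<alpha>\<close>, so one \<open>V\<close> serves all
  \<open>n\<close> and all \<open>F\<close>. The induction carries along that a preimage outside
  \<open>Z\<close> is not congruent to a point of \<open>Z\<close>.\<close>

lemma generic_preimages_rational:
  fixes \<phi> :: "'a::alg_closed_field proj1 \<Rightarrow> 'a proj1"
  assumes K: "subfield_set K" "\<And>x. algebraic_over K x" and mor: "P1_morphism K \<phi>" and pcf: "PCF \<phi>"
  shows "eventually (\<lambda>V. \<forall>F. henselian_over K V F \<longrightarrow> (\<forall>n. (\<phi> ^^ n) -` {\<alpha>} \<subseteq> rational_points F)) generic"
proof -
  obtain W where fin: "finite_morphism \<phi>" and W: "zariski_open W" "W \<noteq> {}" "\<phi> -` W \<subseteq> W" "\<forall>P\<in>W. etale_at \<phi> P"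
    using pcf by (auto simp: PCF_def)
  define Z where "Z = - W"
  have Z: "finite Z"
    using W unfolding Z_def zariski_open_def by (intro zariski_closed_finite) auto
  have forward: "\<phi> P \<in> Z" if "P \<in> Z" for P using that W(3) by (auto simp: Z_def)
  have unr: "\<forall>P. P \<notin> Z \<longrightarrow> unramified_at \<phi> P" using W(4) by (auto simp: Z_def etale_at_def)
  \<comment> \<open>A point whose image is in \<open>Z\<close> escapes the simple-root argument, so
    rationality is imposed on this finite set directly; \<open>\<alpha>\<close> starts the
    induction.\<close>
  define T where "T = insert \<alpha> (\<phi> -` Z)"
  have "\<phi> -` Z = (\<Union>P\<in>Z. \<phi> -` {P})" by auto
  then have T: "finite T"
    using Z fin unfolding T_def finite_morphism_def by (simp add: finite_UN_I)
  have T_rational: "eventually (\<lambda>V. \<forall>P\<in>T. \<forall>F. henselian_over K V F \<longrightarrow> P \<in> rational_points F) generic"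
    using T by (intro eventually_ball_finite ballI generic_rational K)
  have T_distinct: "eventually (\<lambda>V. \<forall>P\<in>T - Z. \<forall>z\<in>Z. \<not> congruent_points V P z) generic"
    using T Z by (intro eventually_ball_finite ballI generic_not_congruent) auto
  define Good where "Good V b \<longleftrightarrow> (\<forall>x\<in>V. \<forall>F. henselian_over K V F \<longrightarrow> \<phi> (chart b x) \<in> rational_points F \<longrightarrow>
      (\<forall>z\<in>Z. \<not> congruent_points V (chart b x) z) \<longrightarrow> x \<in> F) \<and>
      (\<forall>x\<in>V. \<forall>y\<in>V. x - y \<in> nonunits V \<longrightarrow> congruent_points V (\<phi> (chart b x)) (\<phi> (chart b y)))" for V b
  have "eventually (\<lambda>V. Good V b) generic" for b
    unfolding Good_def by (rule generic_chart[OF K(1) mor fin Z unr])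
  then have "eventually (\<lambda>V. \<forall>b. Good V b) generic"
    by (rule eventually_all_finite)
  with T_rational T_distinct show ?thesis
    using generic_valuation
  proof eventually_elim
    case (elim V)
    have step: "x \<in> F"
      if "x \<in> V" "henselian_over K V F" "\<phi> (chart b x) \<in> rational_points F"
        "\<And>z. z \<in> Z \<Longrightarrow> \<not> congruent_points V (chart b x) z" for b x F
      using elim(3)[rule_format, of b, unfolded Good_def, THEN conjunct1] that by blast
    have cong: "congruent_points V (\<phi> P) (\<phi> Q)" if "congruent_points V P Q" for P Q
    proof -
      obtain b x y where xy: "x \<in> V" "y \<in> V" "P = chart b x" "Q = chart b y" "x - y \<in> nonunits V"
        using \<open>congruent_points V P Q\<close> unfolding congruent_points_def by blast
      then show ?thesis
        using elim(3)[rule_format, of b, unfolded Good_def, THEN conjunct2] by blast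
    qed
    show ?case
    proof (intro allI impI subsetI)
      fix F n \<theta> assume F: "henselian_over K V F" and \<theta>: "\<theta> \<in> (\<phi> ^^ n) -` {\<alpha>}"
      have subF: "subfield_set F" using F by (simp add: henselian_over_def)
      have base: "P \<in> rational_points F \<and> (P \<notin> Z \<longrightarrow> (\<forall>z\<in>Z. \<not> congruent_points V P z))" if "P \<in> T" for P
        using elim(1,2) F that by blast
      have "\<theta> \<in> rational_points F \<and> (\<theta> \<notin> Z \<longrightarrow> (\<forall>z\<in>Z. \<not> congruent_points V \<theta> z))"
        using \<theta>
      proof (induction n arbitrary: \<theta>)
        case 0
        then show ?case using base[of \<alpha>] by (simp add: T_def)
      next
        case (Suc n)
        have "\<phi> \<theta> \<in> (\<phi> ^^ n) -` {\<alpha>}" using Suc.prems by (simp add: funpow_swap1)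
        note IH = Suc.IH[OF this]
        show ?case
        proof (cases "\<phi> \<theta> \<in> Z")
          case True
          then show ?thesis using base[of \<theta>] by (simp add: T_def)
        next
          case False
          \<comment> \<open>A congruence of \<open>\<theta>\<close> with \<open>z\<close> would pass
            to the images, and the image of \<open>z\<close> is again in \<open>Z\<close>,
            contradicting the induction hypothesis.\<close>
          have nc: "\<not> congruent_points V \<theta> z" if "z \<in> Z" for z
            using IH False forward[OF that] cong by blast
          have "subfield_set UNIV" by (rule subfield_set_UNIV)
          moreover have "\<theta> \<in> rational_points UNIV"
            by (rule pt_exhaust[of \<theta>]) (auto simp: rational_points_def)
          ultimately obtain b x where x: "x \<in> V" "\<theta> = chart b x"
            by (rule rational_point_cases[OF _ _ elim(4)])
          then have "x \<in> F" using step[of x F b] F IH nc by blast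
          then show ?thesis using x rational_chart_iff[OF subF] nc by blast
        qed
      qed
      then show "\<theta> \<in> rational_points F" ..
    qed
  qed
qed

section \<open>Transfer to library subfields and generated fields, and conclusion\<close>

lemma subfield_set_if_subfield:
  assumes "subfield L ambient" shows "subfield_set (L :: 'a::field set)"
proof -
  have sub: "subring L ambient" using assms by (rule subfieldE)
  have mem: "1 \<in> L" "\<And>x y. x \<in> L \<Longrightarrow> y \<in> L \<Longrightarrow> x * y \<in> L" "\<And>x y. x \<in> L \<Longrightarrow> y \<in> L \<Longrightarrow> x + y \<in> L"
    using subringE(3,6,7)[OF sub] by auto
  interpret ambient: cring "ambient :: 'a ring" by (rule cring_from_type_algebra)
  have minus: "- x \<in> L" if "x \<in> L" for x
  proof -
    have "\<ominus>\<^bsub>ambient\<^esub> x = - x" by (intro ambient.minus_equality) auto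
    then show ?thesis using subringE(5)[OF sub that] by simp
  qed
  show ?thesis
  proof unfold_locales
    show "x - y \<in> L" if "x \<in> L" "y \<in> L" for x y
      using mem(3)[OF that(1) minus[OF that(2)]] by simp
    show "inverse x \<in> L" if "x \<in> L" for x
    proof (cases "x = 0")
      case False
      then have "\<exists>y\<in>L. x * y = 1"
        using subfield.subfield_Units[OF assms] that by (auto simp: Units_def)
      then show ?thesis by (metis inverse_unique)
    qed (use that in auto)
  qed (use mem in auto)
qed

lemma generate_field_subset:
  assumes "subfield_set F" "S \<subseteq> F"
  shows "generate_field ambient S \<subseteq> (F :: 'a::field set)"
proof
  interpret subfield_set F by fact
  interpret ambient: field "ambient :: 'a ring" by (rule field_from_type_algebra)
  fix x assume "x \<in> generate_field ambient S"
  then show "x \<in> F"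
  proof induction
    case (a_inv h)
    have "\<ominus>\<^bsub>ambient\<^esub> h = - h" by (intro ambient.minus_equality) auto
    with a_inv show ?case by (simp add: uminus_mem)
  next
    case (m_inv h)
    then have "h \<noteq> 0" by simp
    then have "inv\<^bsub>ambient\<^esub> h = inverse h" by (intro ambient.comm_inv_char) auto
    with m_inv show ?case by (simp add: inverse_mem)
  qed (use assms one_mem add_mem mult_mem in auto)
qed

lemma coordinates_subset:
  assumes F: "subfield_set F" and P: "P \<in> rational_points F" shows "coordinates P \<subseteq> F"
proof
  fix c assume "c \<in> coordinates P"
  then consider x y where "y \<noteq> 0" "P = pt x y" "c = x / y" | x y where "x \<noteq> 0" "P = pt x y" "c = y / x"
    by (auto simp: coordinates_def)
  then show "c \<in> F"
  proof cases
    case (1 x y)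
    then show ?thesis using P rational_chart_iff[OF F, of True "x / y"] by (simp add: pt_chart_True)
  next
    case (2 x y)
    then show ?thesis using P rational_chart_iff[OF F, of False "y / x"] by (simp add: pt_chart_False)
  qed
qed

theorem theorem8:
  fixes R K :: "'a::alg_closed_field set" and \<phi> :: "'a proj1 \<Rightarrow> 'a proj1"
  assumes "dedekind_domain R"
    and "K = fraction_field R"
    and "\<forall>x. algebraic_over K x"
    and "P1_morphism K \<phi>"
    and "PCF \<phi>"
  shows "\<forall>\<alpha>\<in>rational_points K. finite (ramified_primes_inf R \<phi> \<alpha>)"
proof
  fix \<alpha> assume "\<alpha> \<in> rational_points K"
  interpret R: dedekind R by unfold_locales fact
  have K: "subfield_set K" unfolding assms(2) by (rule R.subfield_set_fraction_field)
  have alg: "algebraic_over K x" for x using assms(3) by blast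
  define Q where "Q V \<longleftrightarrow> (\<forall>F. henselian_over K V F \<longrightarrow> (\<forall>n. (\<phi> ^^ n) -` {\<alpha>} \<subseteq> rational_points F))" for V
  \<comment> \<open>\<open>Bad\<close> depends neither on \<open>n\<close> nor on \<open>L\<close>,
    so it is fixed before any finite subextension is considered.\<close>
  define Bad where "Bad = {p \<in> primes_of R. \<exists>V. valuation_ring V \<and> R \<subseteq> V \<and> nonunits V \<inter> R = p \<and> \<not> Q V}"
  have "eventually Q generic"
    unfolding Q_def using K alg assms(4,5) by (rule generic_preimages_rational)
  then have "finite Bad"
    unfolding Bad_def using R.generic_imp_finite alg assms(2) by blast
  moreover have "ramified_primes_inf R \<phi> \<alpha> \<subseteq> Bad"
  proof
    fix p assume "p \<in> ramified_primes_inf R \<phi> \<alpha>"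
    then obtain L where p: "p \<in> primes_of R" and L: "subfield L ambient" "K \<subseteq> L"
      "L \<subseteq> preimage_field_inf K \<phi> \<alpha>" "separable_over K L" "ramified_in_finite R p L"
      unfolding ramified_primes_inf_def ramifies_in_def assms(2) by blast
    show "p \<in> Bad"
    proof (rule ccontr)
      assume notbad: "p \<notin> Bad"
      have "\<not> ramified_in_finite R p L"
      proof (rule unramified_criterion[OF assms(1) alg[unfolded assms(2)] p subfield_set_if_subfield[OF L(1)] L(2)[unfolded assms(2)]])
        fix V \<pi> E
        assume V: "valuation_ring V" "R \<subseteq> V" "nonunits V \<inter> R = p" and U: "uniformized_valuation_ring V \<pi>"
          and E: "fraction_field R \<subseteq> E" "uniformized_valuation_ring.unramified_subfield V \<pi> E" "henselian V E"
        interpret E: subfield_set E using E(2) by (simp add: uniformized_valuation_ring.unramified_subfield_def[OF U])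
        have "Q V" using notbad p V by (auto simp: Bad_def)
        \<comment> \<open>Rationality of the preimages needs closure under \<open>q\<close>-th
          roots, so it is applied in the perfect closure of \<open>E\<close>; separability of
          \<open>L\<close> afterwards brings the inclusion down to \<open>E\<close>.\<close>
        moreover have hens: "henselian_over K V (perfect_closure E)"
          unfolding henselian_over_def
          using E.subfield_set_perfect_closure E(1) perfect_closure_superset[of E] E.henselian_perfect_closure[OF V(1) E(3)]
            perfect_closure_root[of _ _ E] by (auto simp: assms(2))
        ultimately have rat: "(\<phi> ^^ n) -` {\<alpha>} \<subseteq> rational_points (perfect_closure E)" for n
          by (auto simp: Q_def)
        have "preimage_field K \<phi> n \<alpha> \<subseteq> perfect_closure E" for n
          unfolding preimage_field_def
          using rat[of n] hens E.subfield_set_perfect_closure coordinates_subset[OF E.subfield_set_perfect_closure]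
          by (intro generate_field_subset) (auto simp: henselian_over_def)
        then have LE: "L \<subseteq> perfect_closure E"
          using L(3) unfolding preimage_field_inf_def by blast
        show "L \<subseteq> E"
        proof
          fix y assume y: "y \<in> L"
          then obtain f where f: "f \<in> poly_over K" "rsquarefree f" "poly f y = 0"
            using L(4) by (auto simp: separable_over_def)
          have "f \<in> poly_over E" using f(1) E(1) assms(2) poly_over_mono by blast
          then show "y \<in> E"
            using separable_in_perfect_closure[OF E.subfield_set_axioms _ f(2,3)] y LE by blast
        qed
      qed
      with L show False by blast
    qed
  qed
  ultimately show "finite (ramified_primes_inf R \<phi> \<alpha>)"
    by (rule finite_subset[rotated])
qed

end
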